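(* Let $p\neq 2$ be a prime, let $k$ be a field of characteristic $p$, and let $P$ be a finite $p$-group. Then $\operatorname{HH}^1(kP)$ is solvable as a Lie algebra if and only if the directed graph $\Gamma(P)$ is acyclic.
   Context: For a $k$-algebra $A$, $\operatorname{HH}^1(A)=\operatorname{Der}(A)/\operatorname{InnDer}(A)$, where $\operatorname{Der}(A)$ is the Lie algebra of $k$-linear derivations $A\to A$ with the commutator bracket and $\operatorname{InnDer}(A)$ is the ideal of derivations $a\mapsto xa-ax$ with $x\in A$; this quotient is a Lie algebra. For a group $H$, write $H'=[H,H]$. For a finite group $G$ and a subgroup $H\le G$, the transfer $\operatorname{tr}_H^G:G\to H/H'$ is the group homomorphism defined as follows: choose a right transversal $t_1,\dots,t_m$ of $H$ in $G$; for $g\in G$ write $t_i g=g_{[i]}t_j$ with $g_{[i]}\in H$ (and $j$ depending on $i$); then $\operatorname{tr}_H^G(g)=\left(\prod_{i=1}^m g_{[i]}\right)H'$. $C_P(x)$ is the centralizer of $x$ in $P$ and $\Phi(\cdot)$ denotes the Frattini subgroup of a finite $p$-group (the intersection of its maximal subgroups, equivalently the smallest normal subgroup with elementary abelian quotient). $\Gamma(P)$ is the directed graph whose vertices are the elements of $P/\Phi(P)$, with an edge from $a$ to $b$ (where $a,b\in P/\Phi(P)$, possibly $a=b$) exactly when there are $x,y\in P$ with images $a,b$ respectively in $P/\Phi(P)$ such that $\operatorname{tr}_{C_P(x)}^P(y)\notin\Phi(C_P(x)/C_P(x)')$. Acyclic means containing no directed cycle; a loop (an edge from a vertex to itself) counts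 as a directed cycle. *)

theory Defs
  imports
    "HOL-Computational_Algebra.Primes"
    "Graph_Theory.Pair_Digraph"
    "HOL-Algebra.Generated_Groups"
    "HOL-Algebra.AbelCoset"
    "HOL-Algebra.Module"
begin

section \<open>Lie algebras\<close>

text \<open>
  Scalars are the elements of a type of class \<^class>\<open>field\<close>. As usual for HOL-Algebra modules, the
  ring fields \<^term>\<open>mult\<close> and \<^term>\<open>one\<close> of the underlying module record carry no meaning.
\<close>

record ('k, 'v) lie_algebra = "('k, 'v) module" +
  bracket :: "'v \<Rightarrow> 'v \<Rightarrow> 'v"

inductive_set lie_span :: "('k, 'v, 'm) lie_algebra_scheme \<Rightarrow> 'v set \<Rightarrow> 'v set"
  for L and S where
  zero: "\<zero>\<^bsub>L\<^esub> \<in> lie_span L S"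
| base: "v \<in> S \<Longrightarrow> v \<in> lie_span L S"
| add: "u \<in> lie_span L S \<Longrightarrow> v \<in> lie_span L S \<Longrightarrow> u \<oplus>\<^bsub>L\<^esub> v \<in> lie_span L S"
| smult: "v \<in> lie_span L S \<Longrightarrow> c \<odot>\<^bsub>L\<^esub> v \<in> lie_span L S"

definition lie_derived :: "('k, 'v, 'm) lie_algebra_scheme \<Rightarrow> 'v set \<Rightarrow> 'v set" where
  "lie_derived L U = lie_span L {bracket L u v | u v. u \<in> U \<and> v \<in> U}"

definition lie_solvable :: "('k, 'v, 'm) lie_algebra_scheme \<Rightarrow> bool" where
  "lie_solvable L \<longleftrightarrow> (\<exists>n. (lie_derived L ^^ n) (carrier L) = {\<zero>\<^bsub>L\<^esub>})"

text \<open>The elements are the cosets of the ideal \<open>I\<close>; compare \<open>FactRing\<close> in HOL-Algebra.\<close>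

definition lie_quotient ::
    "('k, 'v, 'm) lie_algebra_scheme \<Rightarrow> 'v set \<Rightarrow> ('k, 'v set) lie_algebra" where
  "lie_quotient L I =
    \<lparr>carrier = a_rcosets\<^bsub>L\<^esub> I, mult = undefined, one = undefined,
     zero = I, add = set_add L,
     smult = (\<lambda>c X. \<Union>x\<in>X. I +>\<^bsub>L\<^esub> (c \<odot>\<^bsub>L\<^esub> x)),
     bracket = (\<lambda>X Y. \<Union>x\<in>X. \<Union>y\<in>Y. I +>\<^bsub>L\<^esub> bracket L x y)\<rparr>"


section \<open>Derivations and first Hochschild cohomology\<close>

text \<open>
  A \<open>k\<close>-algebra is given by a module record, including its multiplicative part; it need not be
  commutative, so the locale \<open>algebra\<close> of HOL-Algebra does not apply.
  Maps \<open>A \<rightarrow> A\<close> are extensional functions on the carrier.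
\<close>

definition Der :: "('k, 'a, 'm) module_scheme \<Rightarrow> ('a \<Rightarrow> 'a) set" where
  "Der A = {D \<in> carrier A \<rightarrow>\<^sub>E carrier A.
     (\<forall>x\<in>carrier A. \<forall>y\<in>carrier A. D (x \<oplus>\<^bsub>A\<^esub> y) = D x \<oplus>\<^bsub>A\<^esub> D y) \<and>
     (\<forall>c. \<forall>x\<in>carrier A. D (c \<odot>\<^bsub>A\<^esub> x) = c \<odot>\<^bsub>A\<^esub> D x) \<and>
     (\<forall>x\<in>carrier A. \<forall>y\<in>carrier A.
        D (x \<otimes>\<^bsub>A\<^esub> y) = (D x \<otimes>\<^bsub>A\<^esub> y) \<oplus>\<^bsub>A\<^esub> (x \<otimes>\<^bsub>A\<^esub> D y))}"

definition InnDer :: "('k, 'a, 'm) module_scheme \<Rightarrow> ('a \<Rightarrow> 'a) set" where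
  "InnDer A = {(\<lambda>a\<in>carrier A. (x \<otimes>\<^bsub>A\<^esub> a) \<ominus>\<^bsub>A\<^esub> (a \<otimes>\<^bsub>A\<^esub> x)) | x. x \<in> carrier A}"

definition Der_lie :: "('k, 'a, 'm) module_scheme \<Rightarrow> ('k, 'a \<Rightarrow> 'a) lie_algebra" where
  "Der_lie A =
    \<lparr>carrier = Der A, mult = undefined, one = undefined,
     zero = (\<lambda>a\<in>carrier A. \<zero>\<^bsub>A\<^esub>),
     add = (\<lambda>D E. \<lambda>a\<in>carrier A. D a \<oplus>\<^bsub>A\<^esub> E a),
     smult = (\<lambda>c D. \<lambda>a\<in>carrier A. c \<odot>\<^bsub>A\<^esub> D a),
     bracket = (\<lambda>D E. \<lambda>a\<in>carrier A. D (E a) \<ominus>\<^bsub>A\<^esub> E (D a))\<rparr>"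

definition HH1 :: "('k, 'a, 'm) module_scheme \<Rightarrow> ('k, ('a \<Rightarrow> 'a) set) lie_algebra" where
  "HH1 A = lie_quotient (Der_lie A) (InnDer A)"


section \<open>Group algebras\<close>

text \<open>
  For a finite group \<open>G\<close>, the element \<open>\<Sum>g\<in>G. f g \<cdot> g\<close> of the group algebra is represented by its
  coefficient function \<open>f\<close>, which vanishes outside the carrier of \<open>G\<close>.
  (For infinite \<open>G\<close> a finite-support condition would be missing.)
\<close>

definition group_algebra ::
    "('g, 'm) monoid_scheme \<Rightarrow> ('k::field, 'g \<Rightarrow> 'k) module" where
  "group_algebra G =
    \<lparr>carrier = {f. \<forall>x. x \<notin> carrier G \<longrightarrow> f x = 0},
     mult = (\<lambda>f h x. \<Sum>(y, z) \<in> {(y, z) \<in> carrier G \<times> carrier G. y \<otimes>\<^bsub>G\<^esub> z = x}. f y * h z),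
     one = (\<lambda>x. if x = \<one>\<^bsub>G\<^esub> then 1 else 0),
     zero = (\<lambda>x. 0),
     add = (\<lambda>f h x. f x + h x),
     smult = (\<lambda>c f x. c * f x)\<rparr>"


section \<open>Centralizers, Frattini subgroups and the transfer\<close>

definition centralizer :: "('g, 'm) monoid_scheme \<Rightarrow> 'g \<Rightarrow> 'g set" where
  "centralizer G x = {g \<in> carrier G. g \<otimes>\<^bsub>G\<^esub> x = x \<otimes>\<^bsub>G\<^esub> g}"

definition maximal_subgroup :: "'g set \<Rightarrow> ('g, 'm) monoid_scheme \<Rightarrow> bool" where
  "maximal_subgroup M G \<longleftrightarrow> subgroup M G \<and> M \<noteq> carrier G \<and>
     (\<forall>K. subgroup K G \<and> M \<subseteq> K \<longrightarrow> K = M \<or> K = carrier G)"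

text \<open>If there are no maximal subgroups, as in the trivial group, this is the whole group.\<close>

definition frattini :: "('g, 'm) monoid_scheme \<Rightarrow> 'g set" where
  "frattini G = carrier G \<inter> \<Inter>{M. maximal_subgroup M G}"

definition abelianization :: "('g, 'm) monoid_scheme \<Rightarrow> 'g set \<Rightarrow> 'g set monoid" where
  "abelianization G H = (G\<lparr>carrier := H\<rparr>) Mod derived G H"

text \<open>A right transversal is enumerated as a list, containing one element of each coset \<open>H t\<close>.\<close>

definition right_transversal :: "('g, 'm) monoid_scheme \<Rightarrow> 'g set \<Rightarrow> 'g list \<Rightarrow> bool" where
  "right_transversal G H ts \<longleftrightarrow> set ts \<subseteq> carrier G \<and>
     (\<forall>g\<in>carrier G. \<exists>!i. i < length ts \<and> g \<in> H #>\<^bsub>G\<^esub> (ts ! i))"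

text \<open>The \<open>h \<in> H\<close> with \<open>t g = h t'\<close> for some \<open>t'\<close> in the transversal.\<close>

definition transfer_factor ::
    "('g, 'm) monoid_scheme \<Rightarrow> 'g set \<Rightarrow> 'g list \<Rightarrow> 'g \<Rightarrow> 'g \<Rightarrow> 'g" where
  "transfer_factor G H ts g t = (THE h. h \<in> H \<and> (\<exists>t'\<in>set ts. t \<otimes>\<^bsub>G\<^esub> g = h \<otimes>\<^bsub>G\<^esub> t'))"

text \<open>The result does not depend on the chosen transversal or on its enumeration.\<close>

definition group_transfer :: "('g, 'm) monoid_scheme \<Rightarrow> 'g set \<Rightarrow> 'g \<Rightarrow> 'g set" where
  "group_transfer G H g =
    (let ts = (SOME ts. right_transversal G H ts)
     in derived G H #>\<^bsub>G\<^esub> foldr (mult G) (map (transfer_factor G H ts g) ts) \<one>\<^bsub>G\<^esub>)"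


section \<open>The directed graph of a $p$-group\<close>

definition Gamma :: "('g, 'm) monoid_scheme \<Rightarrow> 'g set pair_pre_digraph" where
  "Gamma P =
    \<lparr>pverts = carrier (P Mod frattini P),
     parcs = {(a, b). \<exists>x\<in>carrier P. \<exists>y\<in>carrier P.
        a = frattini P #>\<^bsub>P\<^esub> x \<and> b = frattini P #>\<^bsub>P\<^esub> y \<and>
        group_transfer P (centralizer P x) y \<notin> frattini (abelianization P (centralizer P x))}\<rparr>"

text \<open>A cycle in the sense of the Graph\_Theory library may be a loop.\<close>

definition acyclic_digraph :: "'a pair_pre_digraph \<Rightarrow> bool" where
  "acyclic_digraph G \<longleftrightarrow> \<not> (\<exists>c. pre_digraph.cycle (with_proj G) c)"

end

theory Submission
  imports Defs "HOL-Number_Theory.Cong" "HOL-Algebra.Group_Action" "HOL-Algebra.Multiplicative_Group"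
begin

text \<open>
  Let \<open>E\<close> be the largest elementary abelian quotient of \<open>P\<close>. A derivation of \<open>kP\<close> preserves the kernel
  of \<open>kP \<rightarrow> kE\<close> and so induces a derivation of \<open>kE\<close>, its symbol. Derivations of \<open>kE\<close> are sums of the
  derivations \<open>a \<partial>\<^sub>f\<close> for \<open>a \<in> E\<close> and \<open>f\<close> a homomorphism from \<open>E\<close> to the additive group of \<open>k\<close> (a
  character), where \<open>\<partial>\<^sub>f g = f(g) g\<close>; their bracket is
  \<open>[a \<partial>\<^sub>f, b \<partial>\<^sub>e] = f(b) a b \<partial>\<^sub>e - e(a) a b \<partial>\<^sub>f\<close>. Inner derivations have symbol zero. The proof shows
  that solvability is decided by the algebra of symbols, and then reads it off from the graph.

  Which symbols occur: the decomposition of the first cohomology by conjugacy classes attaches a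
  derivation to every \<open>x\<close> in \<open>P\<close> and every character \<open>f\<close> of the centralizer of \<open>x\<close>, and its symbol is
  \<open>x \<partial>\<^sub>F\<close> with \<open>F\<close> the composite of \<open>f\<close> with the transfer (\<open>realizable_acts\<close>). Conversely every nonzero
  component of a symbol is explained in this way (\<open>symbol_nonzero_realizable\<close>). Since the Frattini
  subgroup of the abelianization is the common kernel of its characters, there is an edge from \<open>a\<close> to
  \<open>b\<close> in the graph exactly if some symbol \<open>a \<partial>\<^sub>F\<close> has \<open>F(b) \<noteq> 0\<close>.

  Derivations of symbol zero: their values lie in the square of the augmentation ideal \<open>J\<close> of \<open>kP\<close>, so
  they map \<open>J\<^sup>m\<close> into \<open>J\<^sup>m\<^sup>+\<^sup>1\<close> for all \<open>m\<close>. As \<open>J\<close> is nilpotent, they form a nilpotent Lie algebra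
  (\<open>symbol_free_imp_solvable\<close>).

  If the graph is acyclic, a component at \<open>c\<close> of a bracket arises from \<open>c = a b\<close> with an edge from \<open>a\<close> to
  \<open>b\<close>; in the absence of a loop at \<open>a\<close> there is then also an edge from \<open>a\<close> to \<open>c\<close>. Inductively a
  component at \<open>c\<close> in the \<open>n\<close>-th derived algebra is the end of a walk of length \<open>n\<close>
  (\<open>derived_series_walk\<close>), and walks in a finite acyclic graph have bounded length.

  If there is a cycle, it is used that \<open>x\<close> and its inverse have the same centralizer, so that \<open>x \<partial>\<^sub>F\<close> and
  \<open>x\<^sup>-\<^sup>1 \<partial>\<^sub>F\<close> occur together. A loop at \<open>x\<close> yields a copy of \<open>sl\<^sub>2\<close>, spanned by \<open>x \<partial>\<^sub>F\<close>, \<open>\<partial>\<^sub>F\<close>,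
  \<open>x\<^sup>-\<^sup>1 \<partial>\<^sub>F\<close>, which is perfect because \<open>p \<noteq> 2\<close> (\<open>loop_attained\<close>). Without loops the identity
  \<open>[x\<^sup>-\<^sup>1 \<partial>\<^sub>f, [x \<partial>\<^sub>f, y \<partial>\<^sub>e]] = f(y)\<^sup>2 y \<partial>\<^sub>e\<close> for \<open>f(x) = 0\<close> shows, applied to the predecessor \<open>x\<close> of each
  vertex \<open>y\<close> of the cycle, that the symbols on the cycle persist in every term of the derived series
  (\<open>cycle_attained\<close>).
\<close>

section \<open>Additive characters and maximal subgroups\<close>

definition additive_character ::
    "('g, 'm) monoid_scheme \<Rightarrow> 'g set \<Rightarrow> ('g \<Rightarrow> 'k::ab_group_add) \<Rightarrow> bool" where
  "additive_character G H f \<longleftrightarrow> (\<forall>x\<in>H. \<forall>y\<in>H. f (x \<otimes>\<^bsub>G\<^esub> y) = f x + f y)"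

lemma additive_characterD:
  "additive_character G H f \<Longrightarrow> x \<in> H \<Longrightarrow> y \<in> H \<Longrightarrow> f (x \<otimes>\<^bsub>G\<^esub> y) = f x + f y"
  by (simp add: additive_character_def)

context group
begin

lemma additive_character_one:
  assumes "additive_character G H f" "subgroup H G"
  shows "f \<one> = 0"
  using additive_characterD[OF assms(1), of \<one> \<one>] subgroup.one_closed[OF assms(2)] by simp

lemma additive_character_inv:
  assumes "additive_character G H f" "subgroup H G" "x \<in> H"
  shows "f (inv x) = - f x"
proof -
  have "f (x \<otimes> inv x) = f x + f (inv x)"
    using assms by (simp add: additive_characterD subgroup.m_inv_closed)
  then show ?thesis
    using assms by (simp add: additive_character_one subgroup.mem_carrier add_eq_0_iff)
qed

lemma additive_character_pow:
  fixes f :: "'a \<Rightarrow> 'k::ring_1"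
  assumes "additive_character G H f" "subgroup H G" "x \<in> H"
  shows "f (x [^] (n::nat)) = of_nat n * f x"
proof -
  have "x [^] n \<in> H \<and> f (x [^] n) = of_nat n * f x" for n :: nat
  proof (induction n)
    case 0
    then show ?case
      using assms by (simp add: additive_character_one subgroup.one_closed)
  next
    case (Suc n)
    then show ?case
      using assms by (simp add: additive_characterD subgroup.m_closed algebra_simps)
  qed
  then show ?thesis by simp
qed

text \<open>
  The values of \<open>f\<close> form an elementary abelian group, in which a subgroup that is maximal among those
  avoiding a given vector is a hyperplane; the maximal subgroup is its preimage. There are two uses:
  characters of a group vanish on its Frattini subgroup, and characters of an abelianization detect
  elements outside the Frattini subgroup.
\<close>

lemma character_separated_by_maximal_subgroup:
  fixes f :: "'a \<Rightarrow> 'k::field"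
  assumes fin: "finite (carrier G)" and p: "prime CHAR('k)"
    and f: "additive_character G (carrier G) f" and g: "g \<in> carrier G" "f g \<noteq> 0"
  shows "\<exists>M. maximal_subgroup M G \<and> g \<notin> M"
proof -
  note fm = additive_characterD[OF f]
  have f1: "f \<one> = 0" and finv: "\<And>x. x \<in> carrier G \<Longrightarrow> f (inv x) = - f x"
    and fpow: "\<And>x n. x \<in> carrier G \<Longrightarrow> f (x [^] (n::nat)) = of_nat n * f x"
    using additive_character_one[OF f] additive_character_inv[OF f] additive_character_pow[OF f]
      subgroup_self by auto
  define S where "S = {K. subgroup K G \<and> {x \<in> carrier G. f x = 0} \<subseteq> K \<and> g \<notin> K}"
  have "subgroup {x \<in> carrier G. f x = 0} G"
    by (unfold_locales) (auto simp: f1 finv fm)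
  then have ne: "S \<noteq> {}"
    using g by (auto simp: S_def)
  have "S \<subseteq> Pow (carrier G)"
    by (auto simp: S_def dest: subgroup.subset)
  then have "finite S"
    using fin finite_subset by blast
  then obtain K where K: "K \<in> S" and max: "\<And>K'. K' \<in> S \<Longrightarrow> K \<subseteq> K' \<Longrightarrow> K' = K"
    using finite_has_maximal[OF _ ne] by metis
  have sK: "subgroup K G" and kerK: "\<And>x. x \<in> carrier G \<Longrightarrow> f x = 0 \<Longrightarrow> x \<in> K" and gK: "g \<notin> K"
    using K by (auto simp: S_def)
  have KG: "\<And>x. x \<in> K \<Longrightarrow> x \<in> carrier G"
    using sK subgroup.mem_carrier by metis
  have "K2 = carrier G" if K2: "subgroup K2 G" "K \<subseteq> K2" "K2 \<noteq> K" for K2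
  proof -
    have gK2: "g \<in> K2"
      using max[of K2] K2 kerK by (auto simp: S_def)
    have "w \<in> K2" if w: "w \<in> carrier G" for w
    proof (cases "w \<in> K")
      case False
      \<comment> \<open>The preimage of the span of \<open>f ` K\<close> and \<open>f w\<close>; it is strictly larger than \<open>K\<close>, so it
        contains \<open>g\<close>, and \<open>f w\<close> can then be solved for in terms of \<open>f g\<close>.\<close>
      define W where
        "W = {z \<in> carrier G. \<exists>\<kappa>\<in>K. \<exists>i::nat. f z = f \<kappa> + of_nat i * f w}"
      have "subgroup W G"
      proof (rule subgroupI)
        show "W \<subseteq> carrier G" by (auto simp: W_def)
        have "\<one> \<in> W"
          using subgroup.one_closed[OF sK] by (auto simp: W_def f1 intro!: bexI[of _ \<one>] exI[of _ 0])
        then show "W \<noteq> {}" by auto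
        fix a assume "a \<in> W"
        then obtain \<kappa> i where a: "a \<in> carrier G" "\<kappa> \<in> K" "f a = f \<kappa> + of_nat i * f w"
          by (auto simp: W_def)
        \<comment> \<open>Natural multiples suffice for \<open>W\<close> to be a subgroup, since \<open>CHAR('k) - 1\<close> represents \<open>-1\<close>.\<close>
        have "of_nat (CHAR('k) - 1) = (- 1 :: 'k)"
          using prime_gt_0_nat[OF p] by (metis Suc_pred' add_eq_0_iff of_nat_CHAR of_nat_Suc diff_Suc_1 One_nat_def)
        then have "of_nat (i * (CHAR('k) - 1)) = - (of_nat i :: 'k)"
          by (simp only: of_nat_mult) simp
        then have "f (inv a) = f (inv \<kappa>) + of_nat (i * (CHAR('k) - 1)) * f w"
          using a KG by (simp only: finv) (simp add: algebra_simps)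
        then show "inv a \<in> W"
          unfolding W_def using a subgroup.m_inv_closed[OF sK] by blast
        fix b assume "b \<in> W"
        then obtain \<kappa>' i' where b: "b \<in> carrier G" "\<kappa>' \<in> K" "f b = f \<kappa>' + of_nat i' * f w"
          by (auto simp: W_def)
        have "f (a \<otimes> b) = f (\<kappa> \<otimes> \<kappa>') + of_nat (i + i') * f w"
          using a b KG by (simp add: fm algebra_simps)
        then show "a \<otimes> b \<in> W"
          unfolding W_def using a b subgroup.m_closed[OF sK] by blast
      qed
      moreover have KW: "K \<subseteq> W"
        using KG by (auto simp: W_def intro!: exI[of _ 0])
      moreover have "w \<in> W"
        using w subgroup.one_closed[OF sK] by (auto simp: W_def f1 intro!: bexI[of _ \<one>] exI[of _ 1])
      then have "W \<noteq> K" using False by auto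
      ultimately have "g \<in> W"
        using max[of W] kerK by (auto simp: S_def)
      then obtain \<kappa> i where gi: "\<kappa> \<in> K" "f g = f \<kappa> + of_nat i * f w"
        by (auto simp: W_def)
      have "of_nat i \<noteq> (0 :: 'k)"
      proof
        assume "of_nat i = (0 :: 'k)"
        then have "g \<otimes> inv \<kappa> \<in> K"
          using gi KG g by (intro kerK) (auto simp: fm finv)
        then have "g \<otimes> inv \<kappa> \<otimes> \<kappa> \<in> K"
          using gi subgroup.m_closed[OF sK] by blast
        then show False
          using gK gi KG g by (simp add: m_assoc)
      qed
      then have "coprime i CHAR('k)"
        using p by (metis of_nat_eq_0_iff_char_dvd prime_imp_coprime coprime_commute)
      then obtain j where "[i * j = 1] (mod CHAR('k))"
        using cong_solve_coprime_nat by fastforce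
      then have j: "of_nat i * of_nat j = (1 :: 'k)"
        by (metis of_nat_1 of_nat_eq_iff_cong_CHAR of_nat_mult)
      let ?v = "(g \<otimes> inv \<kappa>) [^] j"
      have v: "?v \<in> carrier G" "?v \<in> K2"
        using g gi KG K2 gK2 subgroup_int_pow_closed[OF K2(1), of "g \<otimes> inv \<kappa>" "int j"]
        by (auto simp: int_pow_int subgroup.m_closed subgroup.m_inv_closed)
      have "f ?v = of_nat i * of_nat j * f w"
        using g gi KG by (simp add: fpow fm finv)
      then have "f (w \<otimes> inv ?v) = 0"
        using v w j by (simp add: fm finv)
      then have "w \<otimes> inv ?v \<in> K2"
        using v w kerK K2(2) by (meson m_closed inv_closed subsetD)
      then have "w \<otimes> inv ?v \<otimes> ?v \<in> K2"
        using v K2 subgroup.m_closed by metis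
      then show ?thesis
        using v w by (simp add: m_assoc)
    qed (use K2 in auto)
    then show ?thesis
      using K2 subgroup.subset by blast
  qed
  then have "maximal_subgroup K G"
    using sK gK g by (auto simp: maximal_subgroup_def)
  then show ?thesis
    using gK by blast
qed

end

text \<open>
  A maximal subgroup \<open>M\<close> and an element \<open>b\<close> outside it generate the group, so every element is
  \<open>m \<otimes> b [^] i\<close>; the character reads off \<open>i\<close>. The exponent is well defined modulo the characteristic,
  because a power of \<open>b\<close> in \<open>M\<close> with exponent prime to the group order would bring \<open>b\<close> itself into \<open>M\<close>.
\<close>

lemma (in comm_group) maximal_subgroup_separated_by_character:
  assumes p: "prime CHAR('k::field)" and ord: "order G = CHAR('k) ^ r"
    and M: "maximal_subgroup M G" and b: "b \<in> carrier G" "b \<notin> M"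
  shows "\<exists>f :: 'a \<Rightarrow> 'k. additive_character G (carrier G) f \<and> f b \<noteq> 0"
proof -
  let ?p = "CHAR('k)"
  have sM: "subgroup M G" using M by (simp add: maximal_subgroup_def)
  have MG: "\<And>x. x \<in> M \<Longrightarrow> x \<in> carrier G"
    using sM subgroup.mem_carrier by metis
  have fin: "finite (carrier G)"
    using ord p by (intro order_gt_0_iff_finite[THEN iffD1]) (simp add: prime_gt_0_nat)
  have pdvd: "int ?p dvd n" if n: "b [^] (n::int) \<in> M" for n
  proof (rule ccontr)
    assume "\<not> int ?p dvd n"
    then have "coprime n (int ?p ^ r)"
      using p by (metis coprime_commute coprime_power_right_iff prime_imp_coprime prime_nat_int_transfer)
    then obtain u v where uv: "u * n + v * int ?p ^ r = 1"
      by (metis bezout_int coprime_iff_gcd_eq_1)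
    have "b [^] (int ?p ^ r) = \<one>"
      using pow_order_eq_1[OF b(1)] ord by (metis int_pow_int of_nat_power)
    then have "b [^] (v * int ?p ^ r) = \<one>"
      using b by (metis int_pow_pow int_pow_one mult.commute)
    then have "b [^] (1::int) = (b [^] n) [^] u"
      using b by (metis int_pow_mult int_pow_pow int_pow_closed mult.commute r_one uv)
    then show False
      using b n subgroup_int_pow_closed[OF sM, of "b [^] n" u] by simp
  qed
  define W where "W = {m \<otimes> b [^] (i::int) | m i. m \<in> M}"
  have "subgroup W G"
  proof (rule subgroupI)
    show "W \<subseteq> carrier G" using b MG by (auto simp: W_def)
    show "W \<noteq> {}" using subgroup.one_closed[OF sM] by (auto simp: W_def)
    fix a assume "a \<in> W"
    then obtain m i where a: "a = m \<otimes> b [^] (i::int)" "m \<in> M" by (auto simp: W_def)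
    have "inv a = inv m \<otimes> b [^] (- i)"
      using a b MG by (simp add: inv_mult int_pow_neg)
    then show "inv a \<in> W"
      using a subgroup.m_inv_closed[OF sM] by (auto simp: W_def)
    fix c assume "c \<in> W"
    then obtain m' j where c: "c = m' \<otimes> b [^] (j::int)" "m' \<in> M" by (auto simp: W_def)
    have "a \<otimes> c = (m \<otimes> m') \<otimes> b [^] (i + j)"
      using a b c MG by (simp add: int_pow_mult m_ac)
    then show "a \<otimes> c \<in> W"
      using a c subgroup.m_closed[OF sM] by (auto simp: W_def)
  qed
  moreover have "M \<subseteq> W"
  proof
    fix m assume "m \<in> M"
    then show "m \<in> W"
      using MG unfolding W_def by (auto intro!: exI[of _ m] exI[of _ "0::int"])
  qed
  moreover have "b \<in> W"
    using b subgroup.one_closed[OF sM] by (auto simp: W_def intro!: exI[of _ \<one>] exI[of _ "1::int"])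
  ultimately have W: "W = carrier G"
    using M b by (auto simp: maximal_subgroup_def)
  define e where "e = (\<lambda>z. SOME i::int. \<exists>m\<in>M. z = m \<otimes> b [^] i)"
  have e: "of_int (e (m \<otimes> b [^] i)) = (of_int i :: 'k)" if "m \<in> M" for m i
  proof -
    have "\<exists>m'\<in>M. m \<otimes> b [^] i = m' \<otimes> b [^] e (m \<otimes> b [^] i)"
      unfolding e_def by (rule someI) (use that in blast)
    then obtain m' where m': "m' \<in> M" "m \<otimes> b [^] i = m' \<otimes> b [^] e (m \<otimes> b [^] i)"
      by blast
    define j where "j = e (m \<otimes> b [^] i)"
    have eq: "m \<otimes> b [^] i = m' \<otimes> b [^] j"
      using m' by (simp add: j_def)
    have "b [^] (i - j) = inv m \<otimes> (m \<otimes> b [^] i) \<otimes> inv (b [^] j)"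
      using that MG b by (simp add: int_pow_diff flip: m_assoc)
    also have "\<dots> = inv m \<otimes> m'"
      unfolding eq using that m'(1) MG b by (simp add: m_assoc)
    also have "\<dots> \<in> M"
      using that m'(1) sM by (simp add: subgroup.m_closed subgroup.m_inv_closed)
    finally have "int ?p dvd i - j" by (rule pdvd)
    then obtain q where "i - j = int ?p * q" by (auto simp: dvd_def)
    then have "of_int (i - j) = (0 :: 'k)"
      by (simp only: of_int_mult of_int_of_nat_eq of_nat_CHAR mult_zero_left)
    then show ?thesis by (simp add: j_def)
  qed
  define f :: "'a \<Rightarrow> 'k" where "f = (\<lambda>z. of_int (e z))"
  have "additive_character G (carrier G) f"
    unfolding additive_character_def
  proof (intro ballI)
    fix x y assume "x \<in> carrier G" "y \<in> carrier G"
    then have "x \<in> W" "y \<in> W" by (simp_all only: W)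
    then obtain m i m' j where x: "m \<in> M" "x = m \<otimes> b [^] (i::int)"
      and y: "m' \<in> M" "y = m' \<otimes> b [^] (j::int)"
      unfolding W_def by blast
    have "x \<otimes> y = (m \<otimes> m') \<otimes> b [^] (i + j)"
      using x y b MG by (simp add: int_pow_mult m_ac)
    moreover have "m \<otimes> m' \<in> M"
      using x y sM by (simp add: subgroup.m_closed)
    ultimately show "f (x \<otimes> y) = f x + f y"
      using x y e by (simp add: f_def)
  qed
  moreover have "f b = 1"
    using e[of \<one> 1] b subgroup.one_closed[OF sM] by (simp add: f_def)
  ultimately show ?thesis by fastforce
qed

context group
begin

text \<open>
  Characters of \<open>H\<close> are the same as characters of its abelianization, an abelian \<open>p\<close>-group; there the two
  separation lemmas show that the Frattini subgroup is the common kernel of all characters.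
\<close>

lemma frattini_abelianization_iff:
  assumes p: "prime CHAR('k::field)" and ord: "order G = CHAR('k) ^ n"
    and H: "subgroup H G" and h: "h \<in> H"
  shows "derived G H #> h \<notin> frattini (abelianization G H) \<longleftrightarrow>
    (\<exists>f :: 'a \<Rightarrow> 'k. additive_character G H f \<and> f h \<noteq> 0)"
proof -
  let ?GH = "G\<lparr>carrier := H\<rparr>" and ?N = "derived G H"
  let ?B = "abelianization G H"
  have fin: "finite (carrier G)"
    using ord p by (intro order_gt_0_iff_finite[THEN iffD1]) (simp add: prime_gt_0_nat)
  interpret GH: group ?GH using subgroup_imp_group[OF H] .
  have nN: "?N \<lhd> ?GH" by (rule derived_subgroup_is_normal[OF H])
  interpret B: comm_group ?B
    unfolding abelianization_def by (rule derived_quot_of_subgroup_is_comm_group[OF H])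
  have rc: "r_coset ?GH ?N x = ?N #> x" for x by (simp add: r_coset_def)
  have carB: "carrier ?B = (\<lambda>x. ?N #> x) ` H"
    by (simp add: abelianization_def carrier_FactGroup rc)
  have finB: "finite (carrier ?B)"
    unfolding carB using finite_subset[OF subgroup.subset[OF H] fin] by simp
  have "order ?B * card ?N = order ?GH"
    using GH.lagrange[OF normal_imp_subgroup[OF nN]]
    by (simp add: order_def abelianization_def FactGroup_def)
  then have "order ?B dvd order ?GH" by (metis dvd_triv_left)
  also have "order ?GH dvd order G"
    unfolding lagrange[OF H, symmetric] by (simp add: order_def)
  finally obtain r where r: "order ?B = CHAR('k) ^ r"
    using p divides_primepow_nat ord by metis
  have homB: "?N #> (x \<otimes> y) = (?N #> x) \<otimes>\<^bsub>?B\<^esub> (?N #> y)" if "x \<in> H" "y \<in> H" for x y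
    using normal.rcos_sum[OF nN, of x y] that by (simp add: abelianization_def rc set_mult_def)
  show ?thesis
  proof
    assume "?N #> h \<notin> frattini ?B"
    then obtain M where M: "maximal_subgroup M ?B" "?N #> h \<notin> M"
      using h by (auto simp: frattini_def carB)
    then obtain F :: "'a set \<Rightarrow> 'k" where F: "additive_character ?B (carrier ?B) F" "F (?N #> h) \<noteq> 0"
      using B.maximal_subgroup_separated_by_character[OF p r M(1) _ M(2)] h carB by auto
    have "additive_character G H (\<lambda>x. F (?N #> x))"
      unfolding additive_character_def
      using additive_characterD[OF F(1)] by (simp add: homB carB)
    with F show "\<exists>f :: 'a \<Rightarrow> 'k. additive_character G H f \<and> f h \<noteq> 0"
      by (intro exI[of _ "\<lambda>x. F (?N #> x)"]) simp
  next
    assume "\<exists>f :: 'a \<Rightarrow> 'k. additive_character G H f \<and> f h \<noteq> 0"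
    then obtain f :: "'a \<Rightarrow> 'k" where f: "additive_character G H f" "f h \<noteq> 0" by blast
    let ?K = "\<lparr>carrier = UNIV, mult = (+), one = 0 :: 'k\<rparr>"
    \<comment> \<open>A character kills commutators and hence factors through the abelianization.\<close>
    have "f x = 0" if "x \<in> ?N" for x
    proof -
      from that show ?thesis unfolding derived_def
      proof (induction rule: generate.induct)
        case one
        then show ?case by (rule additive_character_one[OF f(1) H])
      next
        case (incl h)
        then show ?case
          using f(1) H additive_character_inv[OF f(1) H]
          by (auto simp: additive_characterD subgroup.m_closed subgroup.m_inv_closed)
      next
        case (inv h)
        then obtain a b where ab: "h = a \<otimes> b \<otimes> inv a \<otimes> inv b" "a \<in> H" "b \<in> H" by auto
        then have "h \<in> H" "f h = 0"
          using f(1) H additive_character_inv[OF f(1) H]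
          by (auto simp: additive_characterD subgroup.m_closed subgroup.m_inv_closed)
        then show ?case using additive_character_inv[OF f(1) H] by simp
      next
        case (eng h1 h2)
        have "h1 \<in> H" "h2 \<in> H"
          using eng(1,2) derived_incl[OF _ H, of H] by (auto simp: derived_def)
        with eng show ?case using f(1) by (simp add: additive_characterD)
      qed
    qed
    then have fN: "f x = f y" if "x \<in> H" "y \<in> H" "?N #> x = ?N #> y" for x y
    proof -
      have "x \<in> ?N #> y"
        using that GH.rcos_self[OF _ normal_imp_subgroup[OF nN], of x] by (simp add: rc)
      then obtain n where n: "n \<in> ?N" "x = n \<otimes> y" by (auto simp: r_coset_def)
      then have "n \<in> H" using derived_incl[OF _ H, of H] by auto
      with n that f(1) \<open>\<And>x. x \<in> ?N \<Longrightarrow> f x = 0\<close> show ?thesis by (simp add: additive_characterD)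
    qed
    obtain F where F: "F \<in> hom (?GH Mod ?N) ?K" "\<And>x. x \<in> H \<Longrightarrow> F (?N #> x) = f x"
    proof (rule FactGroup_universal[of f ?GH ?K ?N])
      show "f \<in> hom ?GH ?K"
        using f(1) by (auto simp: hom_def additive_character_def)
      show "?N \<lhd> ?GH" by (rule nN)
      show "f x = f y" if "x \<in> carrier ?GH" "y \<in> carrier ?GH" "r_coset ?GH ?N x = r_coset ?GH ?N y"
        for x y
        using fN[of x y] that unfolding rc by simp
    next
      fix F assume "F \<in> hom (?GH Mod ?N) ?K" "\<And>x. x \<in> carrier ?GH \<Longrightarrow> F (r_coset ?GH ?N x) = f x"
      then show thesis using that unfolding rc by simp
    qed
    have "additive_character ?B (carrier ?B) F"
      using F(1) by (auto simp: hom_def additive_character_def abelianization_def)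
    moreover have "?N #> h \<in> carrier ?B" "F (?N #> h) \<noteq> 0"
      using h F f by (auto simp: carB)
    ultimately obtain M where "maximal_subgroup M ?B" "?N #> h \<notin> M"
      using B.character_separated_by_maximal_subgroup[OF finB p] by blast
    then show "?N #> h \<notin> frattini ?B"
      by (auto simp: frattini_def)
  qed
qed

end

section \<open>Characters and the transfer\<close>

definition transversal_of :: "('g, 'm) monoid_scheme \<Rightarrow> 'g set \<Rightarrow> 'g list" where
  "transversal_of G H = (SOME ts. right_transversal G H ts)"

text \<open>
  The transfer composed with \<open>f\<close>. In cohomological terms this is the corestriction
  \<open>Hom(H, k) \<rightarrow> Hom(G, k)\<close>.
\<close>

definition transferred_character ::
    "('g, 'm) monoid_scheme \<Rightarrow> 'g set \<Rightarrow> ('g \<Rightarrow> 'k::ab_group_add) \<Rightarrow> 'g \<Rightarrow> 'k" where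
  "transferred_character G H f g =
    (\<Sum>t\<in>set (transversal_of G H). f (transfer_factor G H (transversal_of G H) g t))"

locale finite_subgroup = group G + subgroup H G
  for G :: "('a, 'b) monoid_scheme" (structure) and H +
  assumes fin: "finite (carrier G)"
begin

abbreviation reps :: "'a list" where "reps \<equiv> transversal_of G H"

lemma right_transversal_reps: "right_transversal G H reps"
proof -
  obtain Cs where Cs: "set Cs = rcosets H" "distinct Cs"
    using fin finite_distinct_list[of "rcosets H"] by (auto simp: RCOSETS_def)
  define r where "r = (\<lambda>C. SOME g. g \<in> carrier G \<and> C = H #> g)"
  have r: "r C \<in> carrier G \<and> C = H #> r C" if "C \<in> rcosets H" for C
    unfolding r_def by (rule someI_ex) (use that in \<open>auto simp: RCOSETS_def\<close>)
  have "right_transversal G H (map r Cs)"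
    unfolding right_transversal_def
  proof (intro conjI ballI)
    show "set (map r Cs) \<subseteq> carrier G" using r Cs by auto
    fix g assume g: "g \<in> carrier G"
    then have "H #> g \<in> set Cs"
      using Cs by (simp add: rcosetsI subset)
    then obtain i where i: "i < length Cs" "Cs ! i = H #> g" by (metis in_set_conv_nth)
    have eq: "g \<in> H #> (map r Cs ! j) \<longleftrightarrow> Cs ! j = H #> g" if "j < length Cs" for j
      using that r[of "Cs ! j"] Cs(1) g repr_independence[of g H "r (Cs ! j)"] subgroup_axioms
        rcos_self[OF g] by (metis nth_map nth_mem)
    show "\<exists>!i. i < length (map r Cs) \<and> g \<in> H #> (map r Cs ! i)"
    proof (rule ex1I[of _ i])
      show "i < length (map r Cs) \<and> g \<in> H #> (map r Cs ! i)"
        using i(1) eq[OF i(1)] i(2) by (simp only: length_map)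
      fix j assume "j < length (map r Cs) \<and> g \<in> H #> (map r Cs ! j)"
      then have "j < length Cs" "Cs ! j = Cs ! i" using i eq by auto
      then show "j = i" using i Cs(2) nth_eq_iff_index_eq by blast
    qed
  qed
  then show ?thesis
    unfolding transversal_of_def by (rule someI)
qed

lemma reps_in_carrier: "t \<in> set reps \<Longrightarrow> t \<in> carrier G"
  using right_transversal_reps by (auto simp: right_transversal_def)

lemma ex1_rep:
  assumes "g \<in> carrier G"
  shows "\<exists>!t. t \<in> set reps \<and> g \<in> H #> t"
  using assms right_transversal_reps unfolding right_transversal_def by (metis in_set_conv_nth)

lemma distinct_reps: "distinct reps"
proof -
  have "i = j" if "i < length reps" "j < length reps" "reps ! i = reps ! j" for i j
    using that right_transversal_reps rcos_self[OF _ subgroup_axioms]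
    unfolding right_transversal_def by (metis nth_mem subsetD)
  then show ?thesis by (meson distinct_conv_nth)
qed

lemma coset_unique:
  assumes "t \<in> set reps" "t' \<in> set reps" "h \<in> H" "h' \<in> H" "h \<otimes> t = h' \<otimes> t'"
  shows "h = h'" "t = t'"
proof -
  have "h \<otimes> t \<in> H #> t" "h' \<otimes> t' \<in> H #> t'" "h \<otimes> t \<in> carrier G"
    using assms(1-4) reps_in_carrier by (auto simp: r_coset_def)
  then show "t = t'" using ex1_rep[of "h \<otimes> t"] assms by auto
  then have "h \<otimes> t = h' \<otimes> t" using assms(5) by simp
  then show "h = h'" using assms(1,3,4) reps_in_carrier by simp
qed

lemma coset_decomposition:
  assumes "g \<in> carrier G"
  obtains h t where "h \<in> H" "t \<in> set reps" "g = h \<otimes> t"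
  using ex1_rep[OF assms] by (auto simp: r_coset_def)

lemma transfer_factor_eqI:
  assumes "h \<in> H" "t' \<in> set reps" "t \<otimes> g = h \<otimes> t'"
  shows "transfer_factor G H reps g t = h"
  unfolding transfer_factor_def
  by (rule the_equality) (use assms coset_unique in \<open>metis+\<close>)

lemma transfer_factor_in:
  assumes "g \<in> carrier G" "t \<in> set reps"
  shows "transfer_factor G H reps g t \<in> H"
proof -
  obtain h t' where "h \<in> H" "t' \<in> set reps" "t \<otimes> g = h \<otimes> t'"
    using coset_decomposition[of "t \<otimes> g"] assms reps_in_carrier by blast
  then show ?thesis using transfer_factor_eqI by metis
qed

text \<open>
  Right multiplication by \<open>g\<close> permutes the right cosets of \<open>H\<close>, and so their representatives.
\<close>

lemma coset_permutation:
  assumes g: "g \<in> carrier G"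
  obtains \<pi> where "bij_betw \<pi> (set reps) (set reps)"
    "\<And>t. t \<in> set reps \<Longrightarrow> t \<otimes> g = transfer_factor G H reps g t \<otimes> \<pi> t"
proof -
  define \<pi> where "\<pi> = (\<lambda>t. THE t'. t' \<in> set reps \<and> t \<otimes> g \<in> H #> t')"
  have \<pi>: "\<pi> t \<in> set reps \<and> t \<otimes> g = transfer_factor G H reps g t \<otimes> \<pi> t"
    if t: "t \<in> set reps" for t
  proof -
    have tg: "t \<otimes> g \<in> carrier G" using t g reps_in_carrier by simp
    have *: "\<pi> t \<in> set reps \<and> t \<otimes> g \<in> H #> \<pi> t"
      unfolding \<pi>_def by (rule theI') (rule ex1_rep[OF tg])
    then obtain h where "h \<in> H" "t \<otimes> g = h \<otimes> \<pi> t" by (auto simp: r_coset_def)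
    with * show ?thesis using transfer_factor_eqI by metis
  qed
  have "inj_on \<pi> (set reps)"
  proof (rule inj_onI)
    fix s t assume st: "s \<in> set reps" "t \<in> set reps" "\<pi> s = \<pi> t"
    define a b where "a = transfer_factor G H reps g s" and "b = transfer_factor G H reps g t"
    have ab: "a \<in> H" "b \<in> H" using st g transfer_factor_in by (auto simp: a_def b_def)
    have c: "s \<in> carrier G" "t \<in> carrier G" "a \<in> carrier G" "b \<in> carrier G" "\<pi> t \<in> carrier G"
      using st ab reps_in_carrier \<pi> by auto
    have eq: "s \<otimes> g = a \<otimes> \<pi> t" "t \<otimes> g = b \<otimes> \<pi> t"
      using \<pi> st by (auto simp: a_def b_def)
    have "inv a \<otimes> (s \<otimes> g) = \<pi> t" "inv b \<otimes> (t \<otimes> g) = \<pi> t"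
      unfolding eq using c by (auto simp flip: m_assoc)
    then have "(inv a \<otimes> s) \<otimes> g = (inv b \<otimes> t) \<otimes> g"
      using c g by (simp add: m_assoc)
    then have "inv a \<otimes> s = inv b \<otimes> t" using c g by simp
    then show "s = t" using coset_unique(2)[of s t "inv a" "inv b"] st ab by simp
  qed
  moreover have "\<pi> ` set reps \<subseteq> set reps" using \<pi> by blast
  ultimately have bij: "bij_betw \<pi> (set reps) (set reps)"
    by (simp add: bij_betw_def endo_inj_surj)
  with \<pi> that show ?thesis by blast
qed

lemma sum_reps_translate:
  fixes K :: "'a \<Rightarrow> 'k::ab_group_add"
  assumes K: "\<And>h x. h \<in> H \<Longrightarrow> x \<in> carrier G \<Longrightarrow> K (h \<otimes> x) = K x"
    and g: "g \<in> carrier G"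
  shows "(\<Sum>t\<in>set reps. K (t \<otimes> g)) = (\<Sum>t\<in>set reps. K t)"
proof -
  obtain \<pi> where bij: "bij_betw \<pi> (set reps) (set reps)"
    and \<pi>: "\<And>t. t \<in> set reps \<Longrightarrow> t \<otimes> g = transfer_factor G H reps g t \<otimes> \<pi> t"
    using coset_permutation[OF g] by blast
  have "(\<Sum>t\<in>set reps. K (t \<otimes> g)) = (\<Sum>t\<in>set reps. K (\<pi> t))"
    using bij by (intro sum.cong refl)
      (simp add: \<pi> K transfer_factor_in g bij_betw_apply reps_in_carrier)
  also have "\<dots> = (\<Sum>t\<in>set reps. K t)"
    by (rule sum.reindex_bij_betw[OF bij])
  finally show ?thesis .
qed

text \<open>
  A function \<open>\<theta>\<close> on \<open>G\<close> that extends \<open>f\<close> in the indicated way is a primitive for the transfer: in each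
  summand \<open>\<theta> (t \<otimes> g) - \<theta> t\<close> the representative of the coset of \<open>t \<otimes> g\<close> contributes a term that cancels
  after summation. Derivations of the group algebra supply such functions, and conversely.
\<close>

lemma transferred_character_telescope:
  fixes \<theta> :: "'a \<Rightarrow> 'k::ab_group_add"
  assumes \<theta>: "\<And>h x. h \<in> H \<Longrightarrow> x \<in> carrier G \<Longrightarrow> \<theta> (h \<otimes> x) = f h + \<theta> x"
    and g: "g \<in> carrier G"
  shows "(\<Sum>t\<in>set reps. \<theta> (t \<otimes> g) - \<theta> t) = transferred_character G H f g"
proof -
  obtain \<pi> where bij: "bij_betw \<pi> (set reps) (set reps)"
    and \<pi>: "\<And>t. t \<in> set reps \<Longrightarrow> t \<otimes> g = transfer_factor G H reps g t \<otimes> \<pi> t"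
    using coset_permutation[OF g] by blast
  have "(\<Sum>t\<in>set reps. \<theta> (t \<otimes> g)) =
      (\<Sum>t\<in>set reps. f (transfer_factor G H reps g t)) + (\<Sum>t\<in>set reps. \<theta> (\<pi> t))"
    unfolding sum.distrib[symmetric]
    using bij by (intro sum.cong refl)
      (simp add: \<pi> \<theta> transfer_factor_in g bij_betw_apply reps_in_carrier)
  also have "(\<Sum>t\<in>set reps. \<theta> (\<pi> t)) = (\<Sum>t\<in>set reps. \<theta> t)"
    by (rule sum.reindex_bij_betw[OF bij])
  finally show ?thesis
    by (simp add: transferred_character_def sum_subtractf)
qed

text \<open>
  Write \<open>x = h \<otimes> t\<close> with \<open>t\<close> a representative, and put \<open>\<theta> x = f h\<close>.
\<close>

lemma ex_coset_cochain:
  obtains \<theta> :: "'a \<Rightarrow> 'k::ab_group_add"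
  where "\<And>h x. h \<in> H \<Longrightarrow> x \<in> carrier G \<Longrightarrow> additive_character G H f \<Longrightarrow> \<theta> (h \<otimes> x) = f h + \<theta> x"
proof
  define \<theta> where "\<theta> = (\<lambda>x. f (THE h. h \<in> H \<and> (\<exists>t\<in>set reps. x = h \<otimes> t)))"
  have \<theta>: "\<theta> (h \<otimes> t) = f h" if "h \<in> H" "t \<in> set reps" for h t
  proof -
    have "(THE h'. h' \<in> H \<and> (\<exists>t'\<in>set reps. h \<otimes> t = h' \<otimes> t')) = h"
      by (rule the_equality) (use that coset_unique in \<open>metis+\<close>)
    then show ?thesis by (simp add: \<theta>_def)
  qed
  fix h x assume h: "h \<in> H" "x \<in> carrier G" "additive_character G H f"
  obtain h' t where x: "h' \<in> H" "t \<in> set reps" "x = h' \<otimes> t" using coset_decomposition h by blast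
  have "h \<otimes> x = (h \<otimes> h') \<otimes> t" using x h reps_in_carrier by (simp add: m_assoc)
  then show "\<theta> (h \<otimes> x) = f h + \<theta> x"
    using x h \<theta>[of "h \<otimes> h'" t] \<theta>[of h' t] by (simp add: additive_characterD)
qed

lemma transfer_notin_frattini_iff:
  assumes p: "prime CHAR('k::field)" and ord: "order G = CHAR('k) ^ n" and g: "g \<in> carrier G"
  shows "group_transfer G H g \<notin> frattini (abelianization G H) \<longleftrightarrow>
    (\<exists>f :: 'a \<Rightarrow> 'k. additive_character G H f \<and> transferred_character G H f g \<noteq> 0)"
proof -
  define w where "w = foldr (\<otimes>) (map (transfer_factor G H reps g) reps) \<one>"
  have *: "foldr (\<otimes>) (map (transfer_factor G H reps g) us) \<one> \<in> H \<and>
      (additive_character G H f \<longrightarrow> f (foldr (\<otimes>) (map (transfer_factor G H reps g) us) \<one>) =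
        (\<Sum>t\<leftarrow>us. f (transfer_factor G H reps g t)))"
    if "set us \<subseteq> set reps" for us and f :: "'a \<Rightarrow> 'k"
    using that
  proof (induction us)
    case Nil
    then show ?case using additive_character_one subgroup_axioms by auto
  next
    case (Cons u us)
    then show ?case using transfer_factor_in[OF g, of u] by (simp add: additive_characterD)
  qed
  have w: "w \<in> H" using * by (simp add: w_def)
  have "f w = transferred_character G H f g" if "additive_character G H f" for f :: "'a \<Rightarrow> 'k"
    using *[of reps f] that distinct_reps
    by (simp add: w_def transferred_character_def sum_list_distinct_conv_sum_set)
  moreover have "group_transfer G H g = derived G H #> w"
    by (simp add: group_transfer_def w_def transversal_of_def Let_def)
  ultimately show ?thesis
    using frattini_abelianization_iff[OF p ord subgroup_axioms w] by metis
qed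

end

section \<open>The derived series of a quotient Lie algebra\<close>

lemma lie_derived_mono:
  assumes "U \<subseteq> V"
  shows "lie_derived L U \<subseteq> lie_derived L V"
proof
  fix x assume "x \<in> lie_derived L U"
  then show "x \<in> lie_derived L V"
    unfolding lie_derived_def
    by (induction rule: lie_span.induct) (use assms in \<open>auto intro: lie_span.intros\<close>)
qed

lemma zero_in_lie_derived: "\<zero>\<^bsub>L\<^esub> \<in> lie_derived L U"
  unfolding lie_derived_def by (rule lie_span.zero)

lemma bracket_in_lie_derived: "u \<in> U \<Longrightarrow> v \<in> U \<Longrightarrow> bracket L u v \<in> lie_derived L U"
  unfolding lie_derived_def by (rule lie_span.base) blast

lemma smult_in_lie_derived: "u \<in> lie_derived L U \<Longrightarrow> c \<odot>\<^bsub>L\<^esub> u \<in> lie_derived L U"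
  unfolding lie_derived_def by (rule lie_span.smult)

lemma UN_constant_eq: "a \<in> X \<Longrightarrow> (\<Union>x\<in>X. C) = C"
  by auto

text \<open>
  These are the conditions under which the operations on cosets in \<open>lie_quotient\<close> are well defined.
\<close>

locale lie_ideal = abelian_subgroup I L
  for I and L :: "('k, 'v, 'm) lie_algebra_scheme" (structure) +
  assumes smult_closed: "v \<in> carrier L \<Longrightarrow> c \<odot> v \<in> carrier L"
    and smult_add: "u \<in> carrier L \<Longrightarrow> v \<in> carrier L \<Longrightarrow> c \<odot> (u \<oplus> v) = c \<odot> u \<oplus> c \<odot> v"
    and bracket_closed: "u \<in> carrier L \<Longrightarrow> v \<in> carrier L \<Longrightarrow> bracket L u v \<in> carrier L"
    and bracket_add_left: "u \<in> carrier L \<Longrightarrow> v \<in> carrier L \<Longrightarrow> w \<in> carrier L \<Longrightarrow>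
      bracket L (u \<oplus> v) w = bracket L u w \<oplus> bracket L v w"
    and bracket_add_right: "u \<in> carrier L \<Longrightarrow> v \<in> carrier L \<Longrightarrow> w \<in> carrier L \<Longrightarrow>
      bracket L u (v \<oplus> w) = bracket L u v \<oplus> bracket L u w"
    and ideal_smult: "v \<in> I \<Longrightarrow> c \<odot> v \<in> I"
    and ideal_left: "u \<in> I \<Longrightarrow> v \<in> carrier L \<Longrightarrow> bracket L u v \<in> I"
    and ideal_right: "u \<in> carrier L \<Longrightarrow> v \<in> I \<Longrightarrow> bracket L u v \<in> I"
begin

abbreviation "Q \<equiv> lie_quotient L I"

lemma coset_add_ideal: "i \<in> I \<Longrightarrow> v \<in> carrier L \<Longrightarrow> I +> (i \<oplus> v) = I +> v"
  using a_rcos_sum[of i v] a_rcos_sum[of \<zero> v] a_rcos_const[of i] a_rcos_const[of \<zero>] by simp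

lemma in_coset_iff: "x \<in> I +> v \<longleftrightarrow> (\<exists>i\<in>I. x = i \<oplus> v)"
  by (auto simp: a_r_coset_def')

lemma coset_nonempty: "v \<in> carrier L \<Longrightarrow> v \<in> I +> v"
  by (rule a_rcos_self)

lemma quotient_add: "u \<in> carrier L \<Longrightarrow> v \<in> carrier L \<Longrightarrow> (I +> u) \<oplus>\<^bsub>Q\<^esub> (I +> v) = I +> (u \<oplus> v)"
  by (simp add: lie_quotient_def a_rcos_sum)

lemma quotient_smult:
  assumes "v \<in> carrier L" shows "c \<odot>\<^bsub>Q\<^esub> (I +> v) = I +> (c \<odot> v)"
proof -
  have "I +> (c \<odot> x) = I +> (c \<odot> v)" if x: "x \<in> I +> v" for x
  proof -
    obtain i where "i \<in> I" "x = i \<oplus> v" using x by (auto simp: in_coset_iff)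
    then show ?thesis
      using assms by (simp add: smult_add a_Hcarr ideal_smult smult_closed coset_add_ideal)
  qed
  then have "c \<odot>\<^bsub>Q\<^esub> (I +> v) = (\<Union>x\<in>I +> v. I +> (c \<odot> v))"
    unfolding lie_quotient_def by (simp cong: SUP_cong_simp)
  also have "\<dots> = I +> (c \<odot> v)"
    using coset_nonempty[OF assms] by (intro UN_constant_eq) auto
  finally show ?thesis .
qed

lemma quotient_bracket:
  assumes "u \<in> carrier L" "v \<in> carrier L"
  shows "bracket Q (I +> u) (I +> v) = I +> bracket L u v"
proof -
  have "I +> bracket L x y = I +> bracket L u v" if x: "x \<in> I +> u" and y: "y \<in> I +> v" for x y
  proof -
    obtain i j where i: "i \<in> I" "x = i \<oplus> u" and j: "j \<in> I" "y = j \<oplus> v"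
      using x y by (auto simp: in_coset_iff)
    have y: "y \<in> carrier L" using j assms by (simp add: a_Hcarr)
    have "I +> bracket L x y = I +> bracket L u y"
      using i y assms by (simp add: bracket_add_left a_Hcarr ideal_left bracket_closed coset_add_ideal)
    also have "\<dots> = I +> bracket L u v"
      using j assms by (simp add: bracket_add_right a_Hcarr ideal_right bracket_closed coset_add_ideal)
    finally show ?thesis .
  qed
  then have "bracket Q (I +> u) (I +> v) = (\<Union>x\<in>I +> u. \<Union>y\<in>I +> v. I +> bracket L u v)"
    unfolding lie_quotient_def by (simp cong: SUP_cong_simp)
  also have "\<dots> = I +> bracket L u v"
    using coset_nonempty[OF assms(1)] coset_nonempty[OF assms(2)] by (simp only: UN_constant_eq[of v] UN_constant_eq[of u])
  finally show ?thesis .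
qed

lemma lie_derived_subset: "U \<subseteq> carrier L \<Longrightarrow> lie_derived L U \<subseteq> carrier L"
proof
  fix x assume U: "U \<subseteq> carrier L" and "x \<in> lie_derived L U"
  from this(2) show "x \<in> carrier L"
    unfolding lie_derived_def
    by (induction rule: lie_span.induct) (use U in \<open>auto intro: smult_closed bracket_closed\<close>)
qed

lemma derived_series_subset: "(lie_derived L ^^ n) (carrier L) \<subseteq> carrier L"
  by (induction n) (simp_all add: lie_derived_subset)

lemma derived_series_antimono:
  "(lie_derived L ^^ Suc n) (carrier L) \<subseteq> (lie_derived L ^^ n) (carrier L)"
proof (induction n)
  case 0
  then show ?case by (simp add: lie_derived_subset)
next
  case (Suc n)
  then show ?case using lie_derived_mono[OF Suc] by simp
qed

lemma zero_in_derived_series: "\<zero> \<in> (lie_derived L ^^ n) (carrier L)"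
  by (cases n) (simp_all add: zero_in_lie_derived)

text \<open>
  The quotient map is a surjective homomorphism, so it carries spans of brackets onto spans of brackets.
\<close>

lemma lie_derived_quotient:
  assumes U: "U \<subseteq> carrier L"
  shows "lie_derived Q ((+>) I ` U) = (+>) I ` lie_derived L U"
proof (intro subset_antisym subsetI)
  fix X assume "X \<in> lie_derived Q ((+>) I ` U)"
  then show "X \<in> (+>) I ` lie_derived L U"
    unfolding lie_derived_def
  proof (induction rule: lie_span.induct)
    case zero
    have "\<zero>\<^bsub>Q\<^esub> = I +> \<zero>" using a_subset by (simp add: lie_quotient_def)
    then show ?case using lie_span.zero by (rule image_eqI)
  next
    case (base X)
    then obtain u v where uv: "u \<in> U" "v \<in> U" "X = bracket Q (I +> u) (I +> v)"
      by blast
    then have "X = I +> bracket L u v"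
      using U quotient_bracket by (metis subsetD)
    with uv show ?case by (intro image_eqI lie_span.base) auto
  next
    case (add X Y)
    then obtain u v where uv: "X = I +> u" "u \<in> lie_derived L U" "Y = I +> v" "v \<in> lie_derived L U"
      by (auto simp: lie_derived_def)
    then have "X \<oplus>\<^bsub>Q\<^esub> Y = I +> (u \<oplus> v)" by (simp add: quotient_add subsetD[OF lie_derived_subset[OF U]])
    then show ?case
      unfolding lie_derived_def[symmetric]
      by (rule image_eqI) (use uv in \<open>simp add: lie_derived_def lie_span.add\<close>)
  next
    case (smult X c)
    then obtain u where u: "X = I +> u" "u \<in> lie_derived L U" by (auto simp: lie_derived_def)
    then have "c \<odot>\<^bsub>Q\<^esub> X = I +> (c \<odot> u)" by (simp add: quotient_smult subsetD[OF lie_derived_subset[OF U]])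
    then show ?case
      unfolding lie_derived_def[symmetric]
      by (rule image_eqI) (use u in \<open>simp add: lie_derived_def lie_span.smult\<close>)
  qed
next
  fix X assume "X \<in> (+>) I ` lie_derived L U"
  then obtain v where X: "X = I +> v" and "v \<in> lie_derived L U" by auto
  from this(2) have "I +> v \<in> lie_derived Q ((+>) I ` U) \<and> v \<in> carrier L"
    unfolding lie_derived_def
  proof (induction rule: lie_span.induct)
    case zero
    have "I +> \<zero> = \<zero>\<^bsub>Q\<^esub>" using a_subset by (simp add: lie_quotient_def)
    then show ?case by (simp add: lie_span.zero)
  next
    case (base x)
    then obtain u v where uv: "u \<in> U" "v \<in> U" "x = bracket L u v" by auto
    then have "I +> x = bracket Q (I +> u) (I +> v)" using U quotient_bracket by auto
    then have "I +> x \<in> {bracket Q X Y | X Y. X \<in> (+>) I ` U \<and> Y \<in> (+>) I ` U}" using uv by auto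
    then show ?case using uv U by (auto intro: lie_span.base bracket_closed)
  next
    case (add u v)
    then show ?case by (simp add: lie_span.add flip: quotient_add)
  next
    case (smult v c)
    then show ?case by (simp add: lie_span.smult smult_closed flip: quotient_smult)
  qed
  then show "X \<in> lie_derived Q ((+>) I ` U)" using X by simp
qed

lemma derived_series_quotient:
  "(lie_derived Q ^^ n) (carrier Q) = (+>) I ` (lie_derived L ^^ n) (carrier L)"
proof (induction n)
  case 0
  have "carrier Q = a_rcosets I" by (simp add: lie_quotient_def)
  then show ?case by (simp only: A_RCOSETS_def' UNION_singleton_eq_range funpow_0)
next
  case (Suc n)
  then show ?case using lie_derived_quotient[OF derived_series_subset, of n] by simp
qed

theorem lie_solvable_quotient_iff:
  "lie_solvable Q \<longleftrightarrow> (\<exists>n. (lie_derived L ^^ n) (carrier L) \<subseteq> I)"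
proof -
  have "(+>) I ` S = {I} \<longleftrightarrow> S \<subseteq> I" if "S \<subseteq> carrier L" "\<zero> \<in> S" for S
  proof
    assume eq: "(+>) I ` S = {I}"
    show "S \<subseteq> I"
    proof
      fix v assume v: "v \<in> S"
      have "I +> v \<in> (+>) I ` S" by (rule imageI[OF v])
      then have "I +> v = I" unfolding eq by (rule singletonD)
      moreover have "v \<in> I +> v" by (rule coset_nonempty) (use v that in blast)
      ultimately show "v \<in> I" by simp
    qed
  next
    assume "S \<subseteq> I"
    then have "I +> v = I" if "v \<in> S" for v
      using that by (intro a_rcos_const) blast
    then have "(+>) I ` S = (\<lambda>_. I) ` S" by (rule image_cong[OF refl])
    then show "(+>) I ` S = {I}" using \<open>\<zero> \<in> S\<close> by (simp add: image_constant)
  qed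
  note * = this[OF derived_series_subset zero_in_derived_series]
  have "\<zero>\<^bsub>Q\<^esub> = I" by (simp add: lie_quotient_def)
  then show ?thesis
    unfolding lie_solvable_def derived_series_quotient by (simp only: *)
qed

end

section \<open>Derivations of a group algebra\<close>

text \<open>
  Elements of the group algebra are studied through their pairings with functions \<open>v\<close> on the group.
  A linear map is replaced by its transpose \<open>dual D\<close> on functions; this turns convolution identities
  into identities of functions of group elements. For example a derivation is characterized by
  \<open>dual D v (g h) = dual D (\<lambda>w. v (w h)) g + dual D (\<lambda>w. v (g w)) h\<close>.
\<close>

locale finite_group_algebra = group P
  for P :: "('g, 'm) monoid_scheme" (structure) +
  fixes A :: "('k::field, 'g \<Rightarrow> 'k) module"
  assumes A_def: "A = group_algebra P" and finP: "finite (carrier P)"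
begin

abbreviation L where "L \<equiv> Der_lie A"

definition pair :: "('g \<Rightarrow> 'k) \<Rightarrow> ('g \<Rightarrow> 'k) \<Rightarrow> 'k" where
  "pair c v = (\<Sum>w\<in>carrier P. c w * v w)"

definition delta :: "'g \<Rightarrow> 'g \<Rightarrow> 'k" where
  "delta g = (\<lambda>x. if x = g then 1 else 0)"

text \<open>
  The transpose of \<open>D\<close>: on group elements, \<open>dual D v\<close> is the function \<open>g \<mapsto> v(D g)\<close>, with \<open>v\<close> extended
  linearly.
\<close>

definition dual :: "(('g \<Rightarrow> 'k) \<Rightarrow> 'g \<Rightarrow> 'k) \<Rightarrow> ('g \<Rightarrow> 'k) \<Rightarrow> 'g \<Rightarrow> 'k" where
  "dual D v g = pair (D (delta g)) v"

lemma pair_cong: "(\<And>w. w \<in> carrier P \<Longrightarrow> v w = v' w) \<Longrightarrow> pair c v = pair c v'"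
  by (simp add: pair_def)

lemma pair_add: "pair c (\<lambda>w. v w + v' w) = pair c v + pair c v'"
  by (simp add: pair_def sum.distrib algebra_simps)

lemma pair_diff: "pair c (\<lambda>w. v w - v' w) = pair c v - pair c v'"
  by (simp add: pair_def sum_subtractf algebra_simps)

lemma pair_smult: "pair c (\<lambda>w. a * v w) = a * pair c v"
  by (simp add: pair_def sum_distrib_left algebra_simps)

lemma pair_zero: "pair c (\<lambda>w. 0) = 0"
  by (simp add: pair_def)

lemma pair_left_add: "pair (\<lambda>w. c w + c' w) v = pair c v + pair c' v"
  by (simp add: pair_def sum.distrib algebra_simps)

lemma pair_left_diff: "pair (\<lambda>w. c w - c' w) v = pair c v - pair c' v"
  by (simp add: pair_def sum_subtractf algebra_simps)

lemma pair_left_smult: "pair (\<lambda>w. a * c w) v = a * pair c v"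
  by (simp add: pair_def sum_distrib_left algebra_simps)

lemma pair_left_zero: "pair (\<lambda>w. 0) v = 0"
  by (simp add: pair_def)

lemma pair_swap: "pair c (\<lambda>w. pair d (\<lambda>z. F w z)) = pair d (\<lambda>z. pair c (\<lambda>w. F w z))"
  unfolding pair_def sum_distrib_left
  by (subst sum.swap) (simp add: mult.left_commute)

lemma pair_delta: "g \<in> carrier P \<Longrightarrow> pair (delta g) v = v g"
  using finP by (simp add: pair_def delta_def if_distrib[of "\<lambda>a. a * _"] cong: if_cong)

lemma pair_delta_right: "g \<in> carrier P \<Longrightarrow> pair c (delta g) = c g"
  using finP by (simp add: pair_def delta_def if_distrib[of "\<lambda>a. _ * a"] cong: if_cong)

lemma carrier_A: "carrier A = {f. \<forall>x. x \<notin> carrier P \<longrightarrow> f x = 0}"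
  by (simp add: A_def group_algebra_def)

lemma add_A: "f \<oplus>\<^bsub>A\<^esub> h = (\<lambda>x. f x + h x)"
  by (simp add: A_def group_algebra_def)

lemma smult_A: "c \<odot>\<^bsub>A\<^esub> f = (\<lambda>x. c * f x)"
  by (simp add: A_def group_algebra_def)

lemma zero_A: "\<zero>\<^bsub>A\<^esub> = (\<lambda>x. 0)"
  by (simp add: A_def group_algebra_def)

lemma abelian_group_A: "abelian_group A"
proof (rule abelian_groupI)
  fix f assume "f \<in> carrier A"
  then show "\<exists>h\<in>carrier A. h \<oplus>\<^bsub>A\<^esub> f = \<zero>\<^bsub>A\<^esub>"
    by (intro bexI[of _ "\<lambda>x. - f x"]) (auto simp: carrier_A add_A zero_A)
qed (auto simp: carrier_A add_A zero_A algebra_simps)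

lemma minus_A:
  assumes "f \<in> carrier A" "h \<in> carrier A"
  shows "f \<ominus>\<^bsub>A\<^esub> h = (\<lambda>x. f x - h x)"
proof -
  interpret A: abelian_group A by (rule abelian_group_A)
  have "\<ominus>\<^bsub>A\<^esub> h = (\<lambda>x. - h x)"
    using assms by (intro A.minus_equality) (auto simp: carrier_A add_A zero_A)
  then show ?thesis by (simp add: a_minus_def add_A)
qed

lemma delta_in: "g \<in> carrier P \<Longrightarrow> delta g \<in> carrier A"
  by (auto simp: carrier_A delta_def)

lemma pair_ext:
  assumes "c \<in> carrier A" "d \<in> carrier A" "\<And>v. pair c v = pair d v"
  shows "c = d"
proof
  fix x show "c x = d x"
  proof (cases "x \<in> carrier P")
    case True
    then show ?thesis using assms(3)[of "delta x"] by (simp add: pair_delta_right)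
  qed (use assms in \<open>simp add: carrier_A\<close>)
qed

lemma mult_in: "f \<otimes>\<^bsub>A\<^esub> h \<in> carrier A"
  by (auto simp: A_def group_algebra_def intro!: sum.neutral)

lemma pair_mult: "pair (f \<otimes>\<^bsub>A\<^esub> h) v = pair f (\<lambda>y. pair h (\<lambda>z. v (y \<otimes> z)))"
proof -
  have "pair (f \<otimes>\<^bsub>A\<^esub> h) v =
      (\<Sum>w\<in>carrier P. \<Sum>(y, z)\<in>{a \<in> carrier P \<times> carrier P. fst a \<otimes> snd a = w}. f y * h z * v (y \<otimes> z))"
    unfolding pair_def
    by (rule sum.cong)
      (auto simp: A_def group_algebra_def sum_distrib_right case_prod_beta intro!: sum.cong)
  also have "\<dots> = (\<Sum>(y, z)\<in>carrier P \<times> carrier P. f y * h z * v (y \<otimes> z))"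
    using finP by (intro sum.group) auto
  also have "\<dots> = pair f (\<lambda>y. pair h (\<lambda>z. v (y \<otimes> z)))"
    by (simp add: pair_def sum_distrib_left mult.assoc flip: sum.cartesian_product)
  finally show ?thesis .
qed

lemma delta_mult:
  assumes "g \<in> carrier P" "h \<in> carrier P"
  shows "delta g \<otimes>\<^bsub>A\<^esub> delta h = delta (g \<otimes> h)"
  using assms by (intro pair_ext) (auto simp: mult_in delta_in pair_mult pair_delta)

lemma pair_add_A: "pair (c \<oplus>\<^bsub>A\<^esub> d) v = pair c v + pair d v"
  by (simp add: add_A pair_left_add)

lemma Der_closed: "D \<in> Der A \<Longrightarrow> c \<in> carrier A \<Longrightarrow> D c \<in> carrier A"
  by (auto simp: Der_def)

text \<open>
  By linearity a derivation is determined by its values at group elements.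
\<close>

lemma pair_Der:
  assumes D: "D \<in> Der A" and c: "c \<in> carrier A"
  shows "pair (D c) v = pair c (dual D v)"
proof -
  have "pair (D (\<lambda>x. if x \<in> S then c x else 0)) v = (\<Sum>g\<in>S. c g * dual D v g)"
    if "finite S" "S \<subseteq> carrier P" for S
    using that
  proof (induction S)
    case empty
    have "D (0 \<odot>\<^bsub>A\<^esub> c) = 0 \<odot>\<^bsub>A\<^esub> D c" using D c by (auto simp: Der_def)
    then show ?case by (simp add: smult_A pair_left_zero)
  next
    case (insert g S)
    let ?u = "\<lambda>x. if x \<in> S then c x else 0"
    have u: "?u \<in> carrier A" using insert by (auto simp: carrier_A)
    have g: "delta g \<in> carrier A" using insert by (simp add: delta_in)
    then have cg: "c g \<odot>\<^bsub>A\<^esub> delta g \<in> carrier A" by (simp add: carrier_A smult_A)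
    have eq: "(\<lambda>x. if x \<in> insert g S then c x else 0) = (c g \<odot>\<^bsub>A\<^esub> delta g) \<oplus>\<^bsub>A\<^esub> ?u"
      using insert by (auto simp: add_A smult_A delta_def)
    have "D ((c g \<odot>\<^bsub>A\<^esub> delta g) \<oplus>\<^bsub>A\<^esub> ?u) = (c g \<odot>\<^bsub>A\<^esub> D (delta g)) \<oplus>\<^bsub>A\<^esub> D ?u"
      using D u g cg by (simp add: Der_def)
    then show ?case
      using insert unfolding eq by (simp add: pair_add_A smult_A pair_left_smult dual_def)
  qed
  from this[OF finP subset_refl]
  have "pair (D (\<lambda>x. if x \<in> carrier P then c x else 0)) v = pair c (dual D v)"
    by (simp add: pair_def)
  moreover have "(\<lambda>x. if x \<in> carrier P then c x else 0) = c"
    using c by (auto simp: carrier_A)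
  ultimately show ?thesis by simp
qed

lemma dual_cong: "(\<And>w. w \<in> carrier P \<Longrightarrow> v w = v' w) \<Longrightarrow> dual D v g = dual D v' g"
  unfolding dual_def by (rule pair_cong)

lemma dual_Leibniz:
  assumes D: "D \<in> Der A" and g: "g \<in> carrier P" and h: "h \<in> carrier P"
  shows "dual D v (g \<otimes> h) = dual D (\<lambda>w. v (w \<otimes> h)) g + dual D (\<lambda>w. v (g \<otimes> w)) h"
proof -
  have "D (delta (g \<otimes> h)) = (D (delta g) \<otimes>\<^bsub>A\<^esub> delta h) \<oplus>\<^bsub>A\<^esub> (delta g \<otimes>\<^bsub>A\<^esub> D (delta h))"
    using D g h by (simp add: Der_def delta_in flip: delta_mult)
  then show ?thesis
    using g h by (simp add: dual_def pair_add_A pair_mult pair_delta)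
qed

lemma DerI:
  assumes D: "D \<in> carrier A \<rightarrow>\<^sub>E carrier A"
    and lin: "\<And>c v. c \<in> carrier A \<Longrightarrow> pair (D c) v = pair c (dual D v)"
    and leibniz: "\<And>v g h. g \<in> carrier P \<Longrightarrow> h \<in> carrier P \<Longrightarrow>
      dual D v (g \<otimes> h) = dual D (\<lambda>w. v (w \<otimes> h)) g + dual D (\<lambda>w. v (g \<otimes> w)) h"
  shows "D \<in> Der A"
proof -
  have cl: "D c \<in> carrier A" if "c \<in> carrier A" for c using D that by auto
  have "D (x \<oplus>\<^bsub>A\<^esub> y) = D x \<oplus>\<^bsub>A\<^esub> D y" if x: "x \<in> carrier A" and y: "y \<in> carrier A" for x y
  proof (rule pair_ext)
    have xy: "x \<oplus>\<^bsub>A\<^esub> y \<in> carrier A" using x y by (simp add: carrier_A add_A)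
    then show "D (x \<oplus>\<^bsub>A\<^esub> y) \<in> carrier A" by (rule cl)
    show "D x \<oplus>\<^bsub>A\<^esub> D y \<in> carrier A" using cl[OF x] cl[OF y] by (simp add: carrier_A add_A)
    show "pair (D (x \<oplus>\<^bsub>A\<^esub> y)) v = pair (D x \<oplus>\<^bsub>A\<^esub> D y) v" for v
      using x y xy by (simp add: lin pair_add_A)
  qed
  moreover have "D (c \<odot>\<^bsub>A\<^esub> x) = c \<odot>\<^bsub>A\<^esub> D x" if x: "x \<in> carrier A" for c x
  proof (rule pair_ext)
    have cx: "c \<odot>\<^bsub>A\<^esub> x \<in> carrier A" using x by (simp add: carrier_A smult_A)
    then show "D (c \<odot>\<^bsub>A\<^esub> x) \<in> carrier A" by (rule cl)
    show "c \<odot>\<^bsub>A\<^esub> D x \<in> carrier A" using cl[OF x] by (simp add: carrier_A smult_A)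
    show "pair (D (c \<odot>\<^bsub>A\<^esub> x)) v = pair (c \<odot>\<^bsub>A\<^esub> D x) v" for v
      using x lin[OF x, of v] lin[OF cx, of v] by (simp add: smult_A pair_left_smult)
  qed
  moreover have "D (x \<otimes>\<^bsub>A\<^esub> y) = (D x \<otimes>\<^bsub>A\<^esub> y) \<oplus>\<^bsub>A\<^esub> (x \<otimes>\<^bsub>A\<^esub> D y)"
    if x: "x \<in> carrier A" and y: "y \<in> carrier A" for x y
  proof (rule pair_ext)
    show "D (x \<otimes>\<^bsub>A\<^esub> y) \<in> carrier A" by (rule cl[OF mult_in])
    show "(D x \<otimes>\<^bsub>A\<^esub> y) \<oplus>\<^bsub>A\<^esub> (x \<otimes>\<^bsub>A\<^esub> D y) \<in> carrier A"
      using mult_in[of "D x" y] mult_in[of x "D y"] by (simp add: carrier_A add_A)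
    fix v
    have "pair (D (x \<otimes>\<^bsub>A\<^esub> y)) v = pair x (\<lambda>g. pair y (\<lambda>h. dual D v (g \<otimes> h)))"
      by (simp add: lin mult_in pair_mult)
    also have "\<dots> = pair x (\<lambda>g. pair y (\<lambda>h. dual D (\<lambda>w. v (w \<otimes> h)) g + dual D (\<lambda>w. v (g \<otimes> w)) h))"
      by (intro pair_cong) (simp add: leibniz)
    also have "\<dots> = pair x (\<lambda>g. pair y (\<lambda>h. dual D (\<lambda>w. v (w \<otimes> h)) g)) +
        pair x (\<lambda>g. pair y (dual D (\<lambda>w. v (g \<otimes> w))))"
      by (simp add: pair_add)
    also have "pair x (\<lambda>g. pair y (\<lambda>h. dual D (\<lambda>w. v (w \<otimes> h)) g)) =
        pair x (dual D (\<lambda>w. pair y (\<lambda>h. v (w \<otimes> h))))"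
      by (intro pair_cong) (simp add: dual_def pair_swap[of y])
    also have "\<dots> = pair (D x \<otimes>\<^bsub>A\<^esub> y) v"
      using x by (simp add: lin pair_mult)
    also have "pair x (\<lambda>g. pair y (dual D (\<lambda>w. v (g \<otimes> w)))) = pair (x \<otimes>\<^bsub>A\<^esub> D y) v"
      using y by (simp add: lin pair_mult)
    finally show "pair (D (x \<otimes>\<^bsub>A\<^esub> y)) v = pair ((D x \<otimes>\<^bsub>A\<^esub> y) \<oplus>\<^bsub>A\<^esub> (x \<otimes>\<^bsub>A\<^esub> D y)) v"
      by (simp add: pair_add_A)
  qed
  ultimately show ?thesis using D by (simp add: Der_def)
qed

lemma Der_eqI:
  assumes D: "D \<in> Der A" and E: "E \<in> Der A"
    and eq: "\<And>v g. g \<in> carrier P \<Longrightarrow> dual D v g = dual E v g"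
  shows "D = E"
proof (rule extensionalityI[of _ "carrier A"])
  show "D \<in> extensional (carrier A)" "E \<in> extensional (carrier A)"
    using D E by (auto simp: Der_def PiE_def)
  fix c assume c: "c \<in> carrier A"
  show "D c = E c"
    using c D E by (intro pair_ext) (auto simp: Der_closed pair_Der eq intro: pair_cong)
qed

text \<open>
  Row \<open>m g\<close> is the prescribed value at the group element \<open>g\<close>; the Leibniz rule for products of group
  elements is all that has to be checked.
\<close>

lemma Der_of_matrix:
  fixes m :: "'g \<Rightarrow> 'g \<Rightarrow> 'k"
  assumes leibniz: "\<And>v g h. g \<in> carrier P \<Longrightarrow> h \<in> carrier P \<Longrightarrow>
      pair (m (g \<otimes> h)) v = pair (m g) (\<lambda>w. v (w \<otimes> h)) + pair (m h) (\<lambda>w. v (g \<otimes> w))"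
  obtains D where "D \<in> Der A" "\<And>v g. g \<in> carrier P \<Longrightarrow> dual D v g = pair (m g) v"
proof -
  define D where "D = (\<lambda>c\<in>carrier A. \<lambda>w. if w \<in> carrier P then pair c (\<lambda>g. m g w) else 0)"
  have D: "D \<in> carrier A \<rightarrow>\<^sub>E carrier A"
    by (auto simp: D_def carrier_A)
  have pD: "pair (D c) v = pair c (\<lambda>g. pair (m g) v)" if "c \<in> carrier A" for c v
  proof -
    have "pair (D c) v = (\<Sum>w\<in>carrier P. \<Sum>g\<in>carrier P. c g * (m g w * v w))"
      using that by (simp add: D_def pair_def sum_distrib_right sum_distrib_left mult.assoc)
    also have "\<dots> = pair c (\<lambda>g. pair (m g) v)"
      by (subst sum.swap) (simp add: pair_def sum_distrib_left)
    finally show ?thesis .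
  qed
  have dD: "dual D v g = pair (m g) v" if "g \<in> carrier P" for v g
    using that by (simp add: dual_def pD delta_in pair_delta)
  have "D \<in> Der A"
  proof (rule DerI[OF D])
    show "pair (D c) v = pair c (dual D v)" if "c \<in> carrier A" for c v
      unfolding pD[OF that] by (rule pair_cong) (simp add: dD)
  qed (simp add: dD leibniz)
  with dD that show ?thesis by blast
qed

lemma carrier_L: "carrier L = Der A"
  and zero_L: "\<zero>\<^bsub>L\<^esub> = (\<lambda>a\<in>carrier A. \<zero>\<^bsub>A\<^esub>)"
  and add_L: "D \<oplus>\<^bsub>L\<^esub> E = (\<lambda>a\<in>carrier A. D a \<oplus>\<^bsub>A\<^esub> E a)"
  and smult_L: "c \<odot>\<^bsub>L\<^esub> D = (\<lambda>a\<in>carrier A. c \<odot>\<^bsub>A\<^esub> D a)"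
  and bracket_L: "bracket L D E = (\<lambda>a\<in>carrier A. D (E a) \<ominus>\<^bsub>A\<^esub> E (D a))"
  by (simp_all add: Der_lie_def)

definition inner_derivation :: "('g \<Rightarrow> 'k) \<Rightarrow> ('g \<Rightarrow> 'k) \<Rightarrow> 'g \<Rightarrow> 'k" where
  "inner_derivation x = (\<lambda>a\<in>carrier A. (x \<otimes>\<^bsub>A\<^esub> a) \<ominus>\<^bsub>A\<^esub> (a \<otimes>\<^bsub>A\<^esub> x))"

lemma InnDer_inn: "InnDer A = inner_derivation ` carrier A"
  by (auto simp: InnDer_def inner_derivation_def)

lemma pair_zero_L: "c \<in> carrier A \<Longrightarrow> pair (\<zero>\<^bsub>L\<^esub> c) v = 0"
  by (simp add: zero_L zero_A pair_left_zero)

lemma pair_add_L: "c \<in> carrier A \<Longrightarrow> pair ((D \<oplus>\<^bsub>L\<^esub> E) c) v = pair (D c) v + pair (E c) v"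
  by (simp add: add_L pair_add_A)

lemma pair_smult_L: "c \<in> carrier A \<Longrightarrow> pair ((a \<odot>\<^bsub>L\<^esub> D) c) v = a * pair (D c) v"
  by (simp add: smult_L smult_A pair_left_smult)

lemma pair_bracket_L:
  assumes "D \<in> Der A" "E \<in> Der A" "c \<in> carrier A"
  shows "pair (bracket L D E c) v = pair c (dual E (dual D v)) - pair c (dual D (dual E v))"
  using assms by (simp add: bracket_L minus_A Der_closed pair_left_diff pair_Der)

lemma pair_inn:
  assumes "x \<in> carrier A" "c \<in> carrier A"
  shows "pair (inner_derivation x c) v = pair c (\<lambda>g. pair x (\<lambda>y. v (y \<otimes> g) - v (g \<otimes> y)))"
  using assms by (simp add: inner_derivation_def minus_A mult_in pair_left_diff pair_mult pair_diff pair_swap[of x])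

lemma dual_zero_L: "g \<in> carrier P \<Longrightarrow> dual \<zero>\<^bsub>L\<^esub> v g = 0"
  and dual_add_L: "g \<in> carrier P \<Longrightarrow> dual (D \<oplus>\<^bsub>L\<^esub> E) v g = dual D v g + dual E v g"
  and dual_smult_L: "g \<in> carrier P \<Longrightarrow> dual (a \<odot>\<^bsub>L\<^esub> D) v g = a * dual D v g"
  and dual_bracket_L: "D \<in> Der A \<Longrightarrow> E \<in> Der A \<Longrightarrow> g \<in> carrier P \<Longrightarrow>
    dual (bracket L D E) v g = dual E (dual D v) g - dual D (dual E v) g"
  and dual_inn: "x \<in> carrier A \<Longrightarrow> g \<in> carrier P \<Longrightarrow>
    dual (inner_derivation x) v g = pair x (\<lambda>y. v (y \<otimes> g) - v (g \<otimes> y))"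
  by (simp_all add: dual_def[of _ _ g] pair_zero_L pair_add_L pair_smult_L pair_bracket_L pair_inn
      delta_in pair_delta)

lemma zero_in_Der: "\<zero>\<^bsub>L\<^esub> \<in> Der A"
proof (rule DerI)
  show "\<zero>\<^bsub>L\<^esub> \<in> carrier A \<rightarrow>\<^sub>E carrier A" by (auto simp: zero_L carrier_A zero_A)
  show "pair (\<zero>\<^bsub>L\<^esub> c) v = pair c (dual \<zero>\<^bsub>L\<^esub> v)" if "c \<in> carrier A" for c v
    using that pair_cong[of "dual \<zero>\<^bsub>L\<^esub> v" "\<lambda>_. 0" c] by (simp add: pair_zero_L dual_zero_L pair_zero)
qed (simp add: dual_zero_L)

lemma add_in_Der:
  assumes D: "D \<in> Der A" and E: "E \<in> Der A"
  shows "D \<oplus>\<^bsub>L\<^esub> E \<in> Der A"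
proof (rule DerI)
  show "D \<oplus>\<^bsub>L\<^esub> E \<in> carrier A \<rightarrow>\<^sub>E carrier A"
    using Der_closed[OF D] Der_closed[OF E] by (auto simp: add_L add_A carrier_A)
  show "pair ((D \<oplus>\<^bsub>L\<^esub> E) c) v = pair c (dual (D \<oplus>\<^bsub>L\<^esub> E) v)" if "c \<in> carrier A" for c v
    using that D E pair_cong[of "dual (D \<oplus>\<^bsub>L\<^esub> E) v" "\<lambda>g. dual D v g + dual E v g" c]
    by (simp add: pair_add_L dual_add_L pair_Der pair_add)
qed (simp add: dual_add_L dual_Leibniz[OF D] dual_Leibniz[OF E])

lemma smult_in_Der:
  assumes D: "D \<in> Der A"
  shows "a \<odot>\<^bsub>L\<^esub> D \<in> Der A"
proof (rule DerI)
  show "a \<odot>\<^bsub>L\<^esub> D \<in> carrier A \<rightarrow>\<^sub>E carrier A"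
    using Der_closed[OF D] by (auto simp: smult_L smult_A carrier_A)
  show "pair ((a \<odot>\<^bsub>L\<^esub> D) c) v = pair c (dual (a \<odot>\<^bsub>L\<^esub> D) v)" if "c \<in> carrier A" for c v
    using that D pair_cong[of "dual (a \<odot>\<^bsub>L\<^esub> D) v" "\<lambda>g. a * dual D v g" c]
    by (simp add: pair_smult_L dual_smult_L pair_Der pair_smult)
qed (simp add: dual_smult_L dual_Leibniz[OF D] algebra_simps)

text \<open>
  The mixed term in the last two lines is symmetric in \<open>D\<close> and \<open>E\<close>, so it disappears in the commutator;
  this is why derivations are closed under the bracket.
\<close>

lemma dual_dual_Leibniz:
  assumes D: "D \<in> Der A" and E: "E \<in> Der A" and g: "g \<in> carrier P" and h: "h \<in> carrier P"
  shows "dual E (dual D v) (g \<otimes> h) =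
    dual E (dual D (\<lambda>w. v (w \<otimes> h))) g + dual E (dual D (\<lambda>w. v (g \<otimes> w))) h +
    (pair (E (delta g)) (\<lambda>w. pair (D (delta h)) (\<lambda>z. v (w \<otimes> z))) +
     pair (D (delta g)) (\<lambda>w. pair (E (delta h)) (\<lambda>z. v (w \<otimes> z))))"
proof -
  have "dual E (\<lambda>w. dual D v (w \<otimes> h)) g =
      dual E (\<lambda>w. dual D (\<lambda>z. v (z \<otimes> h)) w + dual D (\<lambda>z. v (w \<otimes> z)) h) g"
    by (rule dual_cong) (simp add: dual_Leibniz[OF D] h)
  moreover have "dual E (\<lambda>w. dual D v (g \<otimes> w)) h =
      dual E (\<lambda>w. dual D (\<lambda>z. v (z \<otimes> w)) g + dual D (\<lambda>z. v (g \<otimes> z)) w) h"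
    by (rule dual_cong) (simp add: dual_Leibniz[OF D] g)
  ultimately show ?thesis
    unfolding dual_Leibniz[OF E g h]
    by (simp add: dual_def[abs_def] pair_add pair_swap[of "E (delta h)"])
qed

lemma bracket_in_Der:
  assumes D: "D \<in> Der A" and E: "E \<in> Der A"
  shows "bracket L D E \<in> Der A"
proof (rule DerI)
  have "D (E c) \<ominus>\<^bsub>A\<^esub> E (D c) \<in> carrier A" if "c \<in> carrier A" for c
    using Der_closed[OF D Der_closed[OF E that]] Der_closed[OF E Der_closed[OF D that]]
    by (simp add: minus_A) (simp add: carrier_A)
  then show "bracket L D E \<in> carrier A \<rightarrow>\<^sub>E carrier A" by (auto simp: bracket_L)
  show "pair (bracket L D E c) v = pair c (dual (bracket L D E) v)" if "c \<in> carrier A" for c v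
    using that D E
      pair_cong[of "dual (bracket L D E) v" "\<lambda>g. dual E (dual D v) g - dual D (dual E v) g" c]
    by (simp add: pair_bracket_L dual_bracket_L pair_diff)
qed (simp add: dual_bracket_L D E dual_dual_Leibniz algebra_simps)

lemma inn_in_Der:
  assumes x: "x \<in> carrier A"
  shows "inner_derivation x \<in> Der A"
proof (rule DerI)
  have "(x \<otimes>\<^bsub>A\<^esub> c) \<ominus>\<^bsub>A\<^esub> (c \<otimes>\<^bsub>A\<^esub> x) \<in> carrier A" for c
    using mult_in[of x c] mult_in[of c x] by (simp add: minus_A) (simp add: carrier_A)
  then show "inner_derivation x \<in> carrier A \<rightarrow>\<^sub>E carrier A" by (auto simp: inner_derivation_def)
  show "pair (inner_derivation x c) v = pair c (dual (inner_derivation x) v)" if "c \<in> carrier A" for c v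
    unfolding pair_inn[OF x that] by (rule pair_cong) (simp add: dual_inn x)
next
  fix v g h assume g: "g \<in> carrier P" and h: "h \<in> carrier P"
  have "pair x (\<lambda>y. v (y \<otimes> (g \<otimes> h)) - v (g \<otimes> h \<otimes> y)) =
      pair x (\<lambda>y. (v (y \<otimes> g \<otimes> h) - v (g \<otimes> y \<otimes> h)) + (v (g \<otimes> (y \<otimes> h)) - v (g \<otimes> (h \<otimes> y))))"
    by (rule pair_cong) (simp add: g h m_assoc)
  then show "dual (inner_derivation x) v (g \<otimes> h) = dual (inner_derivation x) (\<lambda>w. v (w \<otimes> h)) g + dual (inner_derivation x) (\<lambda>w. v (g \<otimes> w)) h"
    by (simp add: dual_inn x g h pair_add)
qed

text \<open>
  The familiar identity \<open>[D, ad x] = ad (D x)\<close>, which makes the inner derivations an ideal.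
\<close>

lemma bracket_inn:
  assumes D: "D \<in> Der A" and x: "x \<in> carrier A"
  shows "bracket L D (inner_derivation x) = inner_derivation (D x)"
proof (rule Der_eqI)
  show "bracket L D (inner_derivation x) \<in> Der A" "inner_derivation (D x) \<in> Der A"
    using D x by (auto intro: bracket_in_Der inn_in_Der Der_closed)
  fix v g assume g: "g \<in> carrier P"
  have "dual D (dual (inner_derivation x) v) g = dual D (\<lambda>w. pair x (\<lambda>y. v (y \<otimes> w) - v (w \<otimes> y))) g"
    by (rule dual_cong) (simp add: dual_inn x)
  also have "\<dots> = pair x (\<lambda>y. dual D (\<lambda>w. v (y \<otimes> w)) g - dual D (\<lambda>w. v (w \<otimes> y)) g)"
    unfolding dual_def by (subst pair_swap) (simp add: pair_diff)
  finally have "dual (bracket L D (inner_derivation x)) v g =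
      pair x (\<lambda>y. dual D v (y \<otimes> g) - dual D v (g \<otimes> y)) -
      pair x (\<lambda>y. dual D (\<lambda>w. v (y \<otimes> w)) g - dual D (\<lambda>w. v (w \<otimes> y)) g)"
    using g by (simp add: dual_bracket_L D x inn_in_Der dual_inn)
  also have "\<dots> = pair x (\<lambda>y. dual D (\<lambda>w. v (w \<otimes> g)) y - dual D (\<lambda>w. v (g \<otimes> w)) y)"
    unfolding pair_diff[symmetric]
    by (rule pair_cong) (simp add: dual_Leibniz[OF D] g)
  also have "\<dots> = dual (inner_derivation (D x)) v g"
    using g by (simp add: dual_inn Der_closed D x pair_Der pair_diff)
  finally show "dual (bracket L D (inner_derivation x)) v g = dual (inner_derivation (D x)) v g" .
qed

lemma bracket_inn_left:
  assumes D: "D \<in> Der A" and x: "x \<in> carrier A"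
  shows "bracket L (inner_derivation x) D = inner_derivation ((-1) \<odot>\<^bsub>A\<^esub> D x)"
proof (rule Der_eqI)
  have Dx: "D x \<in> carrier A" using D x by (rule Der_closed)
  then have mDx: "(-1) \<odot>\<^bsub>A\<^esub> D x \<in> carrier A" by (simp add: carrier_A smult_A)
  show "bracket L (inner_derivation x) D \<in> Der A" "inner_derivation ((-1) \<odot>\<^bsub>A\<^esub> D x) \<in> Der A"
    using D x mDx by (auto intro: bracket_in_Der inn_in_Der)
  fix v g assume g: "g \<in> carrier P"
  have "dual (bracket L (inner_derivation x) D) v g = - dual (bracket L D (inner_derivation x)) v g"
    using g by (simp add: dual_bracket_L D x inn_in_Der)
  also have "\<dots> = dual (inner_derivation ((-1) \<odot>\<^bsub>A\<^esub> D x)) v g"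
    using Dx mDx g pair_left_smult[of "-1" "D x"] by (simp add: bracket_inn D x dual_inn smult_A)
  finally show "dual (bracket L (inner_derivation x) D) v g = dual (inner_derivation ((-1) \<odot>\<^bsub>A\<^esub> D x)) v g" .
qed

lemma inn_add: 
  assumes "x \<in> carrier A" "y \<in> carrier A"
  shows "inner_derivation x \<oplus>\<^bsub>L\<^esub> inner_derivation y = inner_derivation (x \<oplus>\<^bsub>A\<^esub> y)"
proof -
  have "x \<oplus>\<^bsub>A\<^esub> y \<in> carrier A" using assms by (simp add: carrier_A add_A)
  then show ?thesis
    using assms by (intro Der_eqI) (auto simp: add_in_Der inn_in_Der dual_add_L dual_inn pair_add_A)
qed

lemma inn_smult: 
  assumes "x \<in> carrier A"
  shows "a \<odot>\<^bsub>L\<^esub> inner_derivation x = inner_derivation (a \<odot>\<^bsub>A\<^esub> x)"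
proof -
  have "a \<odot>\<^bsub>A\<^esub> x \<in> carrier A" using assms by (simp add: carrier_A smult_A)
  then show ?thesis
    using assms pair_left_smult[of a x]
    by (intro Der_eqI) (auto simp: smult_in_Der inn_in_Der dual_smult_L dual_inn smult_A)
qed

lemma abelian_group_L: "abelian_group L"
proof (rule abelian_groupI)
  fix D assume "D \<in> carrier L"
  then show "\<exists>E\<in>carrier L. E \<oplus>\<^bsub>L\<^esub> D = \<zero>\<^bsub>L\<^esub>"
    by (intro bexI[of _ "(-1) \<odot>\<^bsub>L\<^esub> D"] Der_eqI)
      (auto simp: carrier_L add_in_Der smult_in_Der zero_in_Der dual_add_L dual_smult_L dual_zero_L)
qed (auto simp: carrier_L add_in_Der zero_in_Der dual_add_L dual_zero_L intro!: Der_eqI)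

lemma lie_ideal_InnDer: "lie_ideal (InnDer A) L"
proof -
  interpret L: abelian_group L by (rule abelian_group_L)
  have "subgroup (InnDer A) (add_monoid L)"
  proof (rule group.subgroupI)
    show "InnDer A \<subseteq> carrier (add_monoid L)"
      by (auto simp: InnDer_inn inn_in_Der carrier_L)
    have "(\<lambda>_. 0) \<in> carrier A" by (simp add: carrier_A)
    then show "InnDer A \<noteq> {}" by (auto simp: InnDer_inn)
    fix D assume "D \<in> InnDer A"
    then obtain x where x: "x \<in> carrier A" "D = inner_derivation x" by (auto simp: InnDer_inn)
    then have mx: "(-1) \<odot>\<^bsub>A\<^esub> x \<in> carrier A" by (simp add: carrier_A smult_A)
    have "inner_derivation ((-1) \<odot>\<^bsub>A\<^esub> x) \<oplus>\<^bsub>L\<^esub> inner_derivation x = \<zero>\<^bsub>L\<^esub>"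
      unfolding inn_smult[OF x(1), symmetric] using x
      by (intro Der_eqI)
        (auto simp: add_in_Der smult_in_Der zero_in_Der inn_in_Der dual_add_L dual_smult_L dual_zero_L)
    then have "\<ominus>\<^bsub>L\<^esub> D = inner_derivation ((-1) \<odot>\<^bsub>A\<^esub> x)"
      using x mx by (intro L.minus_equality) (auto simp: carrier_L inn_in_Der)
    then have "\<ominus>\<^bsub>L\<^esub> D \<in> InnDer A" using mx by (simp add: InnDer_inn)
    then show "inv\<^bsub>add_monoid L\<^esub> D \<in> InnDer A" by (simp add: a_inv_def)
    fix E assume "E \<in> InnDer A"
    then obtain y where y: "y \<in> carrier A" "E = inner_derivation y" by (auto simp: InnDer_inn)
    have "x \<oplus>\<^bsub>A\<^esub> y \<in> carrier A" using x y by (simp add: carrier_A add_A)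
    then show "D \<otimes>\<^bsub>add_monoid L\<^esub> E \<in> InnDer A"
      using x y by (simp add: InnDer_inn inn_add)
  qed (rule L.a_group)
  then have "additive_subgroup (InnDer A) L" by (rule additive_subgroup.intro)
  then interpret abelian_subgroup "InnDer A" L
    by (rule abelian_subgroupI3) (rule abelian_group_L)
  have sm: "a \<odot>\<^bsub>A\<^esub> x \<in> carrier A" if "x \<in> carrier A" for a x
    using that by (simp add: carrier_A smult_A)
  show ?thesis
  proof
    fix D E F a
    assume D: "D \<in> carrier L" and E: "E \<in> carrier L"
    note DE = D[unfolded carrier_L] E[unfolded carrier_L]
    have lin: "dual X (\<lambda>w. u w + v w) g = dual X u g + dual X v g" for X u v g
      by (simp add: dual_def pair_add)
    have d1: "dual X (dual (D \<oplus>\<^bsub>L\<^esub> E) v) g = dual X (dual D v) g + dual X (dual E v) g" for X v g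
      unfolding lin[symmetric] by (rule dual_cong) (simp add: dual_add_L)
    show "a \<odot>\<^bsub>L\<^esub> (D \<oplus>\<^bsub>L\<^esub> E) = a \<odot>\<^bsub>L\<^esub> D \<oplus>\<^bsub>L\<^esub> a \<odot>\<^bsub>L\<^esub> E"
      using DE by (intro Der_eqI)
        (auto simp: add_in_Der smult_in_Der dual_add_L dual_smult_L algebra_simps)
    assume F: "F \<in> carrier L"
    show "bracket L (D \<oplus>\<^bsub>L\<^esub> E) F = bracket L D F \<oplus>\<^bsub>L\<^esub> bracket L E F"
      using DE F[unfolded carrier_L] by (intro Der_eqI)
        (auto simp: add_in_Der bracket_in_Der dual_add_L dual_bracket_L d1)
  next
    fix D E F
    assume D: "D \<in> carrier L" and E: "E \<in> carrier L" and F: "F \<in> carrier L"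
    have lin: "dual X (\<lambda>w. u w + v w) g = dual X u g + dual X v g" for X u v g
      by (simp add: dual_def pair_add)
    have d1: "dual X (dual (E \<oplus>\<^bsub>L\<^esub> F) v) g = dual X (dual E v) g + dual X (dual F v) g" for X v g
      unfolding lin[symmetric] by (rule dual_cong) (simp add: dual_add_L)
    show "bracket L D (E \<oplus>\<^bsub>L\<^esub> F) = bracket L D E \<oplus>\<^bsub>L\<^esub> bracket L D F"
      using D E F unfolding carrier_L by (intro Der_eqI)
        (auto simp: add_in_Der bracket_in_Der dual_add_L dual_bracket_L d1)
  next
    show "a \<odot>\<^bsub>L\<^esub> D \<in> InnDer A" if "D \<in> InnDer A" for a D
      using that sm by (auto simp: InnDer_inn inn_smult)
    show "bracket L D E \<in> InnDer A" if "D \<in> InnDer A" "E \<in> carrier L" for D E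
      using that sm by (auto simp: InnDer_inn bracket_inn_left carrier_L Der_closed)
    show "bracket L E D \<in> InnDer A" if "E \<in> carrier L" "D \<in> InnDer A" for D E
      using that by (auto simp: InnDer_inn bracket_inn carrier_L Der_closed)
  qed (auto simp: carrier_L smult_in_Der bracket_in_Der)
qed

lemma lie_solvable_HH1_iff:
  "lie_solvable (HH1 A) \<longleftrightarrow> (\<exists>n. (lie_derived L ^^ n) (Der A) \<subseteq> InnDer A)"
  using lie_ideal.lie_solvable_quotient_iff[OF lie_ideal_InnDer] by (simp add: HH1_def carrier_L)

end

section \<open>Closed walks in finite relations\<close>

lemma sum_fiber_nonzero:
  assumes "finite S" "(\<Sum>w\<in>S. F w) \<noteq> (0 :: 'b::comm_monoid_add)"
  shows "\<exists>t\<in>S. (\<Sum>w\<in>{w \<in> S. q w = q t}. F w) \<noteq> 0"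
proof (rule ccontr)
  assume "\<not> ?thesis"
  then have "(\<Sum>y\<in>q ` S. \<Sum>w\<in>{w \<in> S. q w = y}. F w) = 0"
    by (intro sum.neutral) auto
  then show False
    using assms(2) sum.image_gen[OF assms(1), of F q] by simp
qed

text \<open>
  \<open>E x a\<close> is read as the statement that \<open>x\<close> lies in the class \<open>a\<close>. If an edge between classes can be
  realized by an edge from some member of the first class to every member of the second, then so can
  every walk, and the members chosen along a closed walk can be matched up.
\<close>

lemma trancl_lift:
  assumes step: "\<And>a b. (a, b) \<in> Q \<Longrightarrow> \<exists>x. E x a \<and> (\<forall>y. E y b \<longrightarrow> (x, y) \<in> R)"
    and "(a, b) \<in> Q\<^sup>+"
  shows "\<exists>x. E x a \<and> (\<forall>y. E y b \<longrightarrow> (x, y) \<in> R\<^sup>+)"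
  using assms(2)
proof (induction rule: trancl_induct)
  case (base b)
  then show ?case using step by blast
next
  case (step b c)
  then obtain x y where "E x a" "\<forall>y. E y b \<longrightarrow> (x, y) \<in> R\<^sup>+" "E y b" "\<forall>z. E z c \<longrightarrow> (y, z) \<in> R"
    using assms(1)[of b c] by blast
  then show ?case by (meson trancl.trancl_into_trancl)
qed

lemma acyclic_lift:
  assumes "\<And>a b. (a, b) \<in> Q \<Longrightarrow> \<exists>x. E x a \<and> (\<forall>y. E y b \<longrightarrow> (x, y) \<in> R)" and "acyclic R"
  shows "acyclic Q"
  unfolding acyclic_def
proof (intro allI notI)
  fix a assume "(a, a) \<in> Q\<^sup>+"
  then obtain x where "E x a" "\<forall>y. E y a \<longrightarrow> (x, y) \<in> R\<^sup>+"
    using trancl_lift[of Q E R, OF assms(1)] by blast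
  then show False using assms(2) by (auto simp: acyclic_def)
qed

lemma acyclic_walks_bounded:
  assumes "finite Q" "acyclic Q"
  shows "\<exists>n. Q ^^ n = {}"
proof -
  have "\<exists>N. \<forall>m\<ge>N. \<forall>a. (a, c) \<notin> Q ^^ m" for c
  proof (induction c rule: wf_induct_rule[OF finite_acyclic_wf[OF assms]])
    case (1 c)
    then obtain N where N: "\<And>b m a. (b, c) \<in> Q \<Longrightarrow> m \<ge> N b \<Longrightarrow> (a, b) \<notin> Q ^^ m" by metis
    have fin: "finite {b. (b, c) \<in> Q}"
      using finite_subset[of "{b. (b, c) \<in> Q}" "fst ` Q"] assms(1) by force
    show ?case
    proof (intro exI[of _ "Suc (\<Sum>b | (b, c) \<in> Q. N b)"] allI impI notI)
      fix m a assume m: "m \<ge> Suc (\<Sum>b | (b, c) \<in> Q. N b)" and "(a, c) \<in> Q ^^ m"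
      then obtain k b where k: "m = Suc k" "(a, b) \<in> Q ^^ k" "(b, c) \<in> Q"
        by (cases m) auto
      then have "N b \<le> (\<Sum>b | (b, c) \<in> Q. N b)"
        using fin by (intro member_le_sum) auto
      then show False using N[OF k(3), of k a] k m by simp
    qed
  qed
  then obtain N where N: "\<And>c m a. m \<ge> N c \<Longrightarrow> (a, c) \<notin> Q ^^ m" by metis
  let ?n = "Suc (\<Sum>c\<in>snd ` Q. N c)"
  have "(a, c) \<notin> Q ^^ ?n" for a c
  proof
    assume ac: "(a, c) \<in> Q ^^ ?n"
    then have "c \<in> snd ` Q" by force
    then have "N c \<le> (\<Sum>c\<in>snd ` Q. N c)"
      using assms(1) by (intro member_le_sum) auto
    then show False using N[of c ?n a] ac by simp
  qed
  then show ?thesis by (intro exI[of _ ?n]) auto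
qed

section \<open>The symbol of a derivation\<close>

lemma (in group) inv_cancel:
  assumes "x \<in> carrier G" "y \<in> carrier G"
  shows "inv x \<otimes> (x \<otimes> y) = y" "x \<otimes> (inv x \<otimes> y) = y"
  using assms by (simp_all flip: m_assoc)

context finite_group_algebra
begin

lemma character_mult:
  "additive_character P (carrier P) f \<Longrightarrow> x \<in> carrier P \<Longrightarrow> y \<in> carrier P \<Longrightarrow> f (x \<otimes> y) = f x + f y"
  by (rule additive_characterD)

lemma character_inv:
  "additive_character P (carrier P) f \<Longrightarrow> x \<in> carrier P \<Longrightarrow> f (inv x) = - f x"
  by (rule additive_character_inv[OF _ subgroup_self])

text \<open>
  In characteristic \<open>p\<close>, this is equality in the largest elementary abelian \<open>p\<close>-quotient of \<open>P\<close>,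
  expressed by characters. For a \<open>p\<close>-group this quotient is \<open>P/\<Phi>(P)\<close>, but the description by characters makes all
  computations additive: two words in the group are equivalent if they agree after abelianization.
\<close>

definition eqv :: "'g \<Rightarrow> 'g \<Rightarrow> bool" where
  "eqv x y \<longleftrightarrow> (\<forall>f :: 'g \<Rightarrow> 'k. additive_character P (carrier P) f \<longrightarrow> f x = f y)"

lemmas eqv_simps = eqv_def character_mult character_inv

lemma eqv_refl [simp]: "eqv x x"
  by (simp add: eqv_def)

lemma eqv_sym: "eqv x y \<Longrightarrow> eqv y x"
  unfolding eqv_def by (intro allI impI) (drule spec, drule mp, assumption, erule sym)

lemma eqv_trans: "eqv x y \<Longrightarrow> eqv y z \<Longrightarrow> eqv x z"
  unfolding eqv_def by (intro allI impI) (drule spec, drule mp, assumption, drule spec, drule mp, assumption, erule (1) trans)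

lemma eqv_left_cong: "eqv x y \<Longrightarrow> eqv x a \<longleftrightarrow> eqv y a"
  using eqv_sym[of x y] eqv_trans[of x y a] eqv_trans[of y x a] by argo

lemma eqv_right_cong: "eqv x y \<Longrightarrow> (\<lambda>a. eqv a x) = (\<lambda>a. eqv a y)"
  using eqv_sym[of x y] eqv_trans[of _ x y] eqv_trans[of _ y x] by blast

lemma eqv_mult_right: "x \<in> carrier P \<Longrightarrow> y \<in> carrier P \<Longrightarrow> z \<in> carrier P \<Longrightarrow>
    eqv (x \<otimes> z) (y \<otimes> z) \<longleftrightarrow> eqv x y"
  and eqv_mult_left: "x \<in> carrier P \<Longrightarrow> y \<in> carrier P \<Longrightarrow> z \<in> carrier P \<Longrightarrow>
    eqv (z \<otimes> x) (z \<otimes> y) \<longleftrightarrow> eqv x y"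
  by (simp_all add: eqv_simps)

text \<open>
  The invariant functions are the linear functionals on the group algebra of the quotient by \<open>eqv\<close>.
\<close>

definition invariant :: "('g \<Rightarrow> 'k) \<Rightarrow> bool" where
  "invariant v \<longleftrightarrow> (\<forall>x\<in>carrier P. \<forall>y\<in>carrier P. eqv x y \<longrightarrow> v x = v y)"

lemma invariantD: "invariant v \<Longrightarrow> x \<in> carrier P \<Longrightarrow> y \<in> carrier P \<Longrightarrow> eqv x y \<Longrightarrow> v x = v y"
  unfolding invariant_def by blast

definition class_indicator :: "'g \<Rightarrow> 'g \<Rightarrow> 'k" where
  "class_indicator a = (\<lambda>w. if eqv w a then 1 else 0)"

lemma invariant_ind: "invariant (class_indicator a)"
  unfolding invariant_def class_indicator_def by (intro ballI impI) (drule eqv_left_cong[of _ _ a], simp)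

lemma ind_cong: "eqv a b \<Longrightarrow> class_indicator a = class_indicator b"
  by (drule eqv_right_cong) (simp add: class_indicator_def fun_eq_iff)

text \<open>
  Sum over the equivalence classes first: some class must contribute.
\<close>

lemma pair_invariant_nonzero:
  assumes v: "invariant v" and nz: "pair c v \<noteq> 0"
  shows "\<exists>t\<in>carrier P. v t \<noteq> 0 \<and> pair c (class_indicator t) \<noteq> 0"
proof -
  define q where "q = (\<lambda>w. {x. eqv x w})"
  have q: "q w = q t \<longleftrightarrow> eqv w t" for w t
  proof
    assume "q w = q t"
    moreover have "w \<in> q w" by (simp add: q_def)
    ultimately show "eqv w t" by (simp add: q_def)
  next
    assume "eqv w t"
    from eqv_right_cong[OF this] show "q w = q t" by (simp add: q_def fun_eq_iff)
  qed
  obtain t where t: "t \<in> carrier P"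
    and s: "(\<Sum>w\<in>{w \<in> carrier P. q w = q t}. c w * v w) \<noteq> 0"
    using sum_fiber_nonzero[OF finP, of "\<lambda>w. c w * v w" q] nz by (auto simp: pair_def)
  have "(\<Sum>w\<in>{w \<in> carrier P. q w = q t}. c w * v w) = (\<Sum>w\<in>{w \<in> carrier P. q w = q t}. c w * v t)"
  proof (rule sum.cong[OF refl])
    fix w assume "w \<in> {w \<in> carrier P. q w = q t}"
    then have "v w = v t" using q t by (intro invariantD[OF v]) auto
    then show "c w * v w = c w * v t" by simp
  qed
  also have "\<dots> = (\<Sum>w\<in>{w \<in> carrier P. eqv w t}. c w) * v t"
    by (simp add: q sum_distrib_right)
  also have "(\<Sum>w\<in>{w \<in> carrier P. eqv w t}. c w) = pair c (class_indicator t)"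
    unfolding pair_def class_indicator_def using finP by (intro sum.mono_neutral_cong_left) auto
  finally have "pair c (class_indicator t) * v t \<noteq> 0" using s by simp
  then show ?thesis using t by (intro bexI[of _ t]) auto
qed

text \<open>
  A derivation of \<open>kP\<close> induces one of the group algebra of the quotient \<open>E\<close> of \<open>P\<close> by \<open>eqv\<close>, which can be written uniquely as \<open>\<Sum>a\<in>E. a \<cdot> \<partial>\<^sub>f\<close> with characters \<open>f = f\<^sub>a\<close>, where \<open>\<partial>\<^sub>f\<close> multiplies a group
  element \<open>g\<close> by \<open>f g\<close>. The value \<open>symbol D a g\<close> is \<open>f\<^sub>a g\<close>: the sum of the coefficients of \<open>D g\<close> over
  the class of \<open>a \<otimes> g\<close>.
\<close>

definition symbol :: "(('g \<Rightarrow> 'k) \<Rightarrow> 'g \<Rightarrow> 'k) \<Rightarrow> 'g \<Rightarrow> 'g \<Rightarrow> 'k" where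
  "symbol D a g = dual D (class_indicator (a \<otimes> g)) g"

lemma symbol_cong:
  assumes "eqv a b" "a \<in> carrier P" "b \<in> carrier P" "g \<in> carrier P"
  shows "symbol D a g = symbol D b g"
proof -
  have "class_indicator (a \<otimes> g) = class_indicator (b \<otimes> g)"
    using assms by (intro ind_cong) (simp add: eqv_mult_right)
  then show ?thesis by (simp add: symbol_def)
qed

lemma symbol_character:
  assumes D: "D \<in> Der A" and a: "a \<in> carrier P"
  shows "additive_character P (carrier P) (symbol D a)"
  unfolding additive_character_def
proof (intro ballI)
  fix g h assume g: "g \<in> carrier P" and h: "h \<in> carrier P"
  have "dual D (\<lambda>w. class_indicator (a \<otimes> (g \<otimes> h)) (w \<otimes> h)) g = dual D (class_indicator (a \<otimes> g)) g"
    by (rule dual_cong) (use a g h in \<open>simp add: class_indicator_def eqv_mult_right flip: m_assoc\<close>)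
  moreover have "dual D (\<lambda>w. class_indicator (a \<otimes> (g \<otimes> h)) (g \<otimes> w)) h = dual D (class_indicator (a \<otimes> h)) h"
    by (rule dual_cong) (use a g h in \<open>simp add: class_indicator_def eqv_simps algebra_simps\<close>)
  ultimately show "symbol D a (g \<otimes> h) = symbol D a g + symbol D a h"
    by (simp add: symbol_def dual_Leibniz[OF D g h])
qed

lemma dual_ind:
  assumes "h \<in> carrier P" "c \<in> carrier P"
  shows "dual D (class_indicator c) h = symbol D (c \<otimes> inv h) h"
  using assms by (simp add: symbol_def m_assoc)

lemma invariant_dual_ind:
  assumes D: "D \<in> Der A" and c: "c \<in> carrier P"
  shows "invariant (dual D (class_indicator c))"
  unfolding invariant_def
proof (intro ballI impI)
  fix x y assume x: "x \<in> carrier P" and y: "y \<in> carrier P" and xy: "eqv x y"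
  have "symbol D (c \<otimes> inv x) x = symbol D (c \<otimes> inv y) x"
    using x y c xy by (intro symbol_cong) (simp_all add: eqv_simps)
  also have "\<dots> = symbol D (c \<otimes> inv y) y"
    using xy symbol_character[OF D, of "c \<otimes> inv y"] c y by (simp add: eqv_def)
  finally show "dual D (class_indicator c) x = dual D (class_indicator c) y"
    using x y c by (simp add: dual_ind)
qed

text \<open>
  Evaluating \<open>D (E g)\<close> on a class. Every \<open>h\<close> in the support of \<open>E g\<close> is split as \<open>(h \<otimes> inv g) \<otimes> g\<close>, and the
  Leibniz rule is applied; the second summand is the one that is symmetric in \<open>D\<close> and \<open>E\<close>, since the
  quotient is commutative.
\<close>

lemma dual_dual_ind:
  assumes D: "D \<in> Der A" and E: "E \<in> Der A" and c: "c \<in> carrier P" and g: "g \<in> carrier P"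
  shows "dual E (dual D (class_indicator (c \<otimes> g))) g =
    dual E (\<lambda>h. dual D (class_indicator c) (h \<otimes> inv g)) g +
    pair (E (delta g)) (\<lambda>h. pair (D (delta g)) (\<lambda>w. class_indicator (c \<otimes> g) (h \<otimes> inv g \<otimes> w)))"
proof -
  have "dual E (dual D (class_indicator (c \<otimes> g))) g =
      dual E (\<lambda>h. dual D (class_indicator c) (h \<otimes> inv g) + dual D (\<lambda>w. class_indicator (c \<otimes> g) (h \<otimes> inv g \<otimes> w)) g) g"
  proof (rule dual_cong)
    fix h assume h: "h \<in> carrier P"
    have "dual D (class_indicator (c \<otimes> g)) (h \<otimes> inv g \<otimes> g) = dual D (\<lambda>w. class_indicator (c \<otimes> g) (w \<otimes> g)) (h \<otimes> inv g) +
        dual D (\<lambda>w. class_indicator (c \<otimes> g) (h \<otimes> inv g \<otimes> w)) g"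
      using h g by (intro dual_Leibniz[OF D]) auto
    also have "dual D (\<lambda>w. class_indicator (c \<otimes> g) (w \<otimes> g)) (h \<otimes> inv g) = dual D (class_indicator c) (h \<otimes> inv g)"
      by (rule dual_cong) (use c g in \<open>simp add: class_indicator_def eqv_mult_right\<close>)
    finally show "dual D (class_indicator (c \<otimes> g)) h =
        dual D (class_indicator c) (h \<otimes> inv g) + dual D (\<lambda>w. class_indicator (c \<otimes> g) (h \<otimes> inv g \<otimes> w)) g"
      using h g by (simp add: m_assoc)
  qed
  then show ?thesis by (simp add: dual_def[of E] dual_def[of D _ g] pair_add)
qed

text \<open>
  If \<open>[a \<partial>\<^sub>f, b \<partial>\<^sub>e] = f(b) a b \<partial>\<^sub>e - e(a) a b \<partial>\<^sub>f\<close> has a component at \<open>c\<close>, then \<open>c = a \<otimes> b\<close> where the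
  character at \<open>a\<close> does not vanish on \<open>b\<close>, or the same with the two factors exchanged.
\<close>

lemma symbol_bracket_nonzero:
  assumes D: "D \<in> Der A" and E: "E \<in> Der A" and c: "c \<in> carrier P" and g: "g \<in> carrier P"
    and nz: "symbol (bracket L D E) c g \<noteq> 0"
  shows "\<exists>b\<in>carrier P. symbol D (c \<otimes> inv b) b \<noteq> 0 \<or> symbol E (c \<otimes> inv b) b \<noteq> 0"
proof -
  have "pair (E (delta g)) (\<lambda>h. pair (D (delta g)) (\<lambda>w. class_indicator (c \<otimes> g) (h \<otimes> inv g \<otimes> w))) =
      pair (D (delta g)) (\<lambda>w. pair (E (delta g)) (\<lambda>h. class_indicator (c \<otimes> g) (w \<otimes> inv g \<otimes> h)))"
    unfolding pair_swap[of "E (delta g)"]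
    by (intro pair_cong)
      (use c g in \<open>auto simp: eqv_simps algebra_simps intro!: invariantD[OF invariant_ind]\<close>)
  then have "dual E (\<lambda>h. dual D (class_indicator c) (h \<otimes> inv g)) g \<noteq> 0 \<or>
      dual D (\<lambda>h. dual E (class_indicator c) (h \<otimes> inv g)) g \<noteq> 0"
    using nz by (auto simp: symbol_def dual_bracket_L D E g c dual_dual_ind)
  moreover have "\<exists>b\<in>carrier P. symbol X (c \<otimes> inv b) b \<noteq> 0"
    if X: "X \<in> Der A" and Y: "dual Y (\<lambda>h. dual X (class_indicator c) (h \<otimes> inv g)) g \<noteq> 0" for X Y
  proof -
    have "invariant (\<lambda>h. dual X (class_indicator c) (h \<otimes> inv g))"
      unfolding invariant_def
    proof (intro ballI impI)
      fix x y assume "x \<in> carrier P" "y \<in> carrier P" "eqv x y"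
      with g show "dual X (class_indicator c) (x \<otimes> inv g) = dual X (class_indicator c) (y \<otimes> inv g)"
        by (intro invariantD[OF invariant_dual_ind[OF X c]]) (simp_all add: eqv_mult_right)
    qed
    from pair_invariant_nonzero[OF this Y[unfolded dual_def[of Y]]]
    obtain t where t: "t \<in> carrier P" "dual X (class_indicator c) (t \<otimes> inv g) \<noteq> 0" by blast
    then show ?thesis
      using g c by (intro bexI[of _ "t \<otimes> inv g"]) (auto simp: dual_ind)
  qed
  ultimately show ?thesis using D E by blast
qed

section \<open>Acyclicity bounds the derived series\<close>

definition symbol_rel :: "'g rel" where
  "symbol_rel = {(a, b). a \<in> carrier P \<and> b \<in> carrier P \<and> (\<exists>D\<in>Der A. symbol D a b \<noteq> 0)}"

lemma derived_series_subset_Der: "(lie_derived L ^^ n) (Der A) \<subseteq> Der A"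
  using lie_ideal.derived_series_subset[OF lie_ideal_InnDer] by (simp add: carrier_L)

text \<open>
  This is where acyclicity forces solvability. A nonzero symbol at \<open>c\<close> in the next derived algebra comes
  from \<open>c = a \<otimes> b\<close> with an edge from \<open>a\<close> to \<open>b\<close> given by a character \<open>f\<close>. As there is no loop at \<open>a\<close>,
  \<open>f (a \<otimes> b) = f a + f b = f b\<close>, so there is also an edge from \<open>a\<close> to \<open>c\<close>. Thus each derivation step
  prolongs the walk that ends at a surviving symbol by one.
\<close>

lemma derived_series_walk:
  assumes irr: "\<And>a. (a, a) \<notin> symbol_rel"
  shows "D \<in> (lie_derived L ^^ n) (Der A) \<Longrightarrow> c \<in> carrier P \<Longrightarrow> g \<in> carrier P \<Longrightarrow> symbol D c g \<noteq> 0 \<Longrightarrow>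
    \<exists>a. (a, c) \<in> symbol_rel ^^ n"
proof (induction n arbitrary: D c g)
  case 0
  then show ?case by auto
next
  case (Suc n)
  let ?U = "(lie_derived L ^^ n) (Der A)"
  have "D \<in> lie_span L {bracket L u v | u v. u \<in> ?U \<and> v \<in> ?U}"
    using Suc.prems(1) by (simp add: lie_derived_def[of L ?U])
  then have "\<forall>g\<in>carrier P. symbol D c g \<noteq> 0 \<longrightarrow> (\<exists>a. (a, c) \<in> symbol_rel ^^ Suc n)"
  proof (induction rule: lie_span.induct)
    case (base D)
    then obtain X Y where X: "X \<in> ?U" and Y: "Y \<in> ?U" and D: "D = bracket L X Y" by auto
    show ?case
    proof (intro ballI impI)
      fix g assume g: "g \<in> carrier P" and nz: "symbol D c g \<noteq> 0"
      have "X \<in> Der A" "Y \<in> Der A" using X Y derived_series_subset_Der by auto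
      then obtain Z b where Z: "Z \<in> ?U" and b: "b \<in> carrier P" "symbol Z (c \<otimes> inv b) b \<noteq> 0"
        using symbol_bracket_nonzero[OF _ _ Suc.prems(2) g nz[unfolded D]] X Y by blast
      define a where "a = c \<otimes> inv b"
      have a: "a \<in> carrier P" using b Suc.prems(2) by (simp add: a_def)
      have ZD: "Z \<in> Der A" using Z derived_series_subset_Der by auto
      have "symbol Z a (a \<otimes> b) = symbol Z a a + symbol Z a b"
        using symbol_character[OF ZD a] a b by (simp add: character_mult)
      moreover have "symbol Z a a = 0" using irr[of a] ZD a by (auto simp: symbol_rel_def)
      moreover have "a \<otimes> b = c" using b Suc.prems(2) by (simp add: a_def m_assoc)
      ultimately have "symbol Z a c \<noteq> 0" using b by (simp add: a_def)
      then have "(a, c) \<in> symbol_rel" using a Suc.prems(2) ZD by (auto simp: symbol_rel_def)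
      moreover obtain a0 where "(a0, a) \<in> symbol_rel ^^ n"
        using Suc.IH[OF Z a b(1)] b(2) by (auto simp: a_def)
      ultimately show "\<exists>a. (a, c) \<in> symbol_rel ^^ Suc n" by auto
    qed
  qed (auto simp: symbol_def dual_zero_L dual_add_L dual_smult_L)
  then show ?case using Suc.prems by blast
qed

lemma finite_symbol_rel: "finite symbol_rel"
  by (rule finite_subset[of _ "carrier P \<times> carrier P"]) (auto simp: symbol_rel_def finP)

lemma acyclic_symbol_rel_imp:
  assumes "acyclic symbol_rel"
  shows "\<exists>n. \<forall>D\<in>(lie_derived L ^^ n) (Der A). \<forall>c\<in>carrier P. \<forall>g\<in>carrier P. symbol D c g = 0"
proof -
  obtain n where n: "symbol_rel ^^ n = {}"
    using acyclic_walks_bounded[OF finite_symbol_rel assms] by blast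
  have "(a, a) \<notin> symbol_rel" for a
    using assms by (auto simp: acyclic_def)
  from derived_series_walk[OF this, of _ n] n show ?thesis by blast
qed

section \<open>Homogeneous derivations\<close>

text \<open>
  \<open>D\<close> induces the derivation \<open>a \<cdot> \<partial>\<^sub>f\<close> on the group algebra of the quotient by \<open>eqv\<close>.
\<close>

definition acts :: "(('g \<Rightarrow> 'k) \<Rightarrow> 'g \<Rightarrow> 'k) \<Rightarrow> 'g \<Rightarrow> ('g \<Rightarrow> 'k) \<Rightarrow> bool" where
  "acts D a f \<longleftrightarrow> (\<forall>v. invariant v \<longrightarrow> (\<forall>g\<in>carrier P. dual D v g = f g * v (a \<otimes> g)))"

lemma actsD: "acts D a f \<Longrightarrow> invariant v \<Longrightarrow> g \<in> carrier P \<Longrightarrow> dual D v g = f g * v (a \<otimes> g)"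
  by (simp add: acts_def)

lemma acts_symb: "acts D a f \<Longrightarrow> g \<in> carrier P \<Longrightarrow> symbol D a g = f g"
  by (simp add: symbol_def actsD invariant_ind) (simp add: class_indicator_def)

lemma acts_character:
  assumes D: "D \<in> Der A" and a: "a \<in> carrier P" and f: "acts D a f"
  shows "additive_character P (carrier P) f"
  using symbol_character[OF D a] acts_symb[OF f] by (simp add: additive_character_def)

lemma acts_dual_dual:
  assumes a: "a \<in> carrier P" and b: "b \<in> carrier P"
    and D: "D \<in> Der A" "acts D a f" and E: "E \<in> Der A" "acts E b e"
    and v: "invariant v" and g: "g \<in> carrier P"
  shows "dual E (dual D v) g = e g * (f b + f g) * v (a \<otimes> b \<otimes> g)"
proof -
  have f: "additive_character P (carrier P) f" by (rule acts_character[OF D(1) a D(2)])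
  have "invariant (\<lambda>h. f h * v (a \<otimes> h))"
    unfolding invariant_def
  proof (intro ballI impI)
    fix x y assume xy: "x \<in> carrier P" "y \<in> carrier P" "eqv x y"
    then have "v (a \<otimes> x) = v (a \<otimes> y)"
      using a by (intro invariantD[OF v]) (simp_all add: eqv_mult_left)
    moreover have "f x = f y" using xy(3) f by (simp add: eqv_def)
    ultimately show "f x * v (a \<otimes> x) = f y * v (a \<otimes> y)" by simp
  qed
  moreover have "dual E (dual D v) g = dual E (\<lambda>h. f h * v (a \<otimes> h)) g"
    by (rule dual_cong) (rule actsD[OF D(2) v])
  ultimately show ?thesis
    using a b g f by (simp add: actsD[OF E(2)] character_mult m_assoc)
qed

lemma acts_bracket:
  assumes a: "a \<in> carrier P" and b: "b \<in> carrier P"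
    and D: "D \<in> Der A" "acts D a f" and E: "E \<in> Der A" "acts E b e"
  shows "acts (bracket L D E) (a \<otimes> b) (\<lambda>g. f b * e g - e a * f g)"
  unfolding acts_def
proof (intro allI impI ballI)
  fix v g assume v: "invariant v" and g: "g \<in> carrier P"
  have "v (b \<otimes> a \<otimes> g) = v (a \<otimes> b \<otimes> g)"
    using a b g by (intro invariantD[OF v]) (simp_all add: eqv_simps)
  then show "dual (bracket L D E) v g = (f b * e g - e a * f g) * v (a \<otimes> b \<otimes> g)"
    using g by (simp add: dual_bracket_L D(1) E(1) acts_dual_dual[OF a b D E v g]
        acts_dual_dual[OF b a E D v g] algebra_simps)
qed

lemma acts_smult: "acts D a f \<Longrightarrow> acts (c \<odot>\<^bsub>L\<^esub> D) a (\<lambda>g. c * f g)"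
  by (simp add: acts_def dual_smult_L)

lemma acts_cong:
  assumes "acts D a f" "a = b" "\<And>g. g \<in> carrier P \<Longrightarrow> f g = e g"
  shows "acts D b e"
  using assms by (simp add: acts_def)

lemma inn_acts_zero:
  assumes x: "x \<in> carrier A" and a: "a \<in> carrier P" and g: "g \<in> carrier P"
  shows "symbol (inner_derivation x) a g = 0"
proof -
  have "pair x (\<lambda>y. class_indicator (a \<otimes> g) (y \<otimes> g) - class_indicator (a \<otimes> g) (g \<otimes> y)) = pair x (\<lambda>y. 0)"
    using g by (intro pair_cong)
      (simp add: invariantD[OF invariant_ind, of "_ \<otimes> g" "g \<otimes> _"] eqv_simps add.commute)
  then show ?thesis using x g by (simp add: symbol_def dual_inn pair_zero)
qed

section \<open>Characters of centralizers\<close>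

text \<open>
  The first cohomology of \<open>P\<close> with coefficients in \<open>kP\<close> is the sum of \<open>Hom(C\<^sub>P(x), k)\<close> over the conjugacy
  classes; the characters \<open>F\<close> realizable at \<open>x\<close> are the symbols at \<open>x\<close> of the corresponding derivations.
\<close>

definition realizable :: "'g \<Rightarrow> ('g \<Rightarrow> 'k) \<Rightarrow> bool" where
  "realizable x F \<longleftrightarrow> (\<exists>f. additive_character P (centralizer P x) f \<and>
    F = transferred_character P (centralizer P x) f)"

lemma finite_subgroup_centralizer:
  assumes x: "x \<in> carrier P"
  shows "finite_subgroup P (centralizer P x)"
proof -
  have "subgroup (centralizer P x) P"
  proof (rule subgroupI)
    show "centralizer P x \<noteq> {}" using x by (auto simp: centralizer_def)
    fix g assume "g \<in> centralizer P x"
    then have g: "g \<in> carrier P" "g \<otimes> x = x \<otimes> g" by (auto simp: centralizer_def)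
    then have "inv g \<otimes> (g \<otimes> x) \<otimes> inv g = inv g \<otimes> (x \<otimes> g) \<otimes> inv g" by simp
    then have "x \<otimes> inv g = inv g \<otimes> x" using g(1) x by (simp add: m_assoc inv_cancel)
    then show "inv g \<in> centralizer P x" using g(1) by (simp add: centralizer_def)
    fix h assume "h \<in> centralizer P x"
    then have h: "h \<in> carrier P" "h \<otimes> x = x \<otimes> h" by (auto simp: centralizer_def)
    have "g \<otimes> h \<otimes> x = g \<otimes> x \<otimes> h" using g(1) h x by (simp add: m_assoc)
    also have "\<dots> = x \<otimes> (g \<otimes> h)" using g h(1) x by (simp add: m_assoc)
    finally show "g \<otimes> h \<in> centralizer P x" using g(1) h(1) by (simp add: centralizer_def)
  qed (auto simp: centralizer_def)
  then show ?thesis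
    using finP by (intro finite_subgroup.intro finite_subgroup_axioms.intro) (auto intro: is_group)
qed

lemma centralizer_inv:
  assumes x: "x \<in> carrier P"
  shows "centralizer P (inv x) = centralizer P x"
proof -
  have "centralizer P y \<subseteq> centralizer P (inv y)" if y: "y \<in> carrier P" for y
  proof
    fix g assume "g \<in> centralizer P y"
    then have g: "g \<in> carrier P" "g \<otimes> y = y \<otimes> g" by (auto simp: centralizer_def)
    then have "inv y \<otimes> (g \<otimes> y) \<otimes> inv y = inv y \<otimes> (y \<otimes> g) \<otimes> inv y" by simp
    then have "inv y \<otimes> g = g \<otimes> inv y" using g(1) y by (simp add: m_assoc inv_cancel)
    then show "g \<in> centralizer P (inv y)" using g(1) by (simp add: centralizer_def)
  qed
  from this[of x] this[of "inv x"] x show ?thesis by auto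
qed

lemma realizable_inv: "x \<in> carrier P \<Longrightarrow> realizable x F \<Longrightarrow> realizable (inv x) F"
  by (simp add: realizable_def centralizer_inv)

lemma conj_coset:
  assumes x: "x \<in> carrier P" and h: "h \<in> centralizer P x" and t: "t \<in> carrier P"
  shows "inv (h \<otimes> t) \<otimes> x \<otimes> (h \<otimes> t) = inv t \<otimes> x \<otimes> t"
proof -
  have hc: "h \<in> carrier P" "h \<otimes> x = x \<otimes> h" using h by (auto simp: centralizer_def)
  have "inv (h \<otimes> t) \<otimes> x \<otimes> (h \<otimes> t) = inv t \<otimes> (inv h \<otimes> (x \<otimes> h) \<otimes> t)"
    using hc(1) x t by (simp add: inv_mult_group m_assoc)
  also have "inv h \<otimes> (x \<otimes> h) = x"
    unfolding hc(2)[symmetric] using hc(1) x by (simp flip: m_assoc)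
  finally show ?thesis using x t by (simp add: m_assoc)
qed

text \<open>
  The derivation sends \<open>g\<close> to \<open>\<Sum>t (\<theta> (t \<otimes> g) - \<theta> t) \<cdot> x\<^sup>t \<otimes> g\<close>, where \<open>x\<^sup>t\<close> runs through the conjugates of
  \<open>x\<close> and \<open>\<theta>\<close> is a primitive of \<open>f\<close> on the cosets of the centralizer. All conjugates of \<open>x\<close> are
  equivalent, so the symbol is the sum of the coefficients, which is the transferred character.
\<close>

lemma realizable_acts:
  assumes x: "x \<in> carrier P" and F: "realizable x F"
  shows "\<exists>D\<in>Der A. acts D x F"
proof -
  let ?H = "centralizer P x"
  interpret H: finite_subgroup P ?H by (rule finite_subgroup_centralizer[OF x])
  let ?T = "set H.reps"
  obtain f :: "'g \<Rightarrow> 'k" where f: "additive_character P ?H f" "F = transferred_character P ?H f"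
    using F by (auto simp: realizable_def)
  obtain \<theta> where \<theta>: "\<And>h u. h \<in> ?H \<Longrightarrow> u \<in> carrier P \<Longrightarrow> \<theta> (h \<otimes> u) = f h + \<theta> u"
    using H.ex_coset_cochain[of f] f(1) by metis
  define xc where "xc = (\<lambda>t. inv t \<otimes> x \<otimes> t)"
  define m where "m = (\<lambda>g w. \<Sum>t\<in>?T. (\<theta> (t \<otimes> g) - \<theta> t) * delta (xc t \<otimes> g) w)"
  have xc: "xc t \<in> carrier P" if "t \<in> carrier P" for t
    using that x by (simp add: xc_def)
  note T = H.reps_in_carrier
  have pm: "pair (m g) v = (\<Sum>t\<in>?T. (\<theta> (t \<otimes> g) - \<theta> t) * v (xc t \<otimes> g))"
    if g: "g \<in> carrier P" for g v
  proof -
    have "pair (m g) v = (\<Sum>t\<in>?T. (\<theta> (t \<otimes> g) - \<theta> t) * pair (delta (xc t \<otimes> g)) v)"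
      unfolding pair_def m_def sum_distrib_right sum_distrib_left
      by (subst sum.swap) (simp add: mult.assoc)
    also have "\<dots> = (\<Sum>t\<in>?T. (\<theta> (t \<otimes> g) - \<theta> t) * v (xc t \<otimes> g))"
      using g xc T by (intro sum.cong) (auto simp: pair_delta)
    finally show ?thesis .
  qed
  obtain D where D: "D \<in> Der A" and dD: "\<And>v g. g \<in> carrier P \<Longrightarrow> dual D v g = pair (m g) v"
  proof (rule Der_of_matrix[of m])
    fix v g h assume g: "g \<in> carrier P" and h: "h \<in> carrier P"
    \<comment> \<open>The part of the Leibniz rule with \<open>g\<close> on the left; conjugating \<open>x\<^sup>t\<close> past \<open>g\<close> amounts to a
      translation of the transversal.\<close>
    define K where "K = (\<lambda>t. (\<theta> (t \<otimes> h) - \<theta> t) * v (g \<otimes> (xc t \<otimes> h)))"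
    have "(\<Sum>t\<in>?T. K (t \<otimes> g)) = (\<Sum>t\<in>?T. K t)"
    proof (rule H.sum_reps_translate[OF _ g])
      fix y t assume y: "y \<in> ?H" and t: "t \<in> carrier P"
      have "\<theta> (y \<otimes> t \<otimes> h) - \<theta> (y \<otimes> t) = \<theta> (t \<otimes> h) - \<theta> t"
        using y t h \<theta>[of y "t \<otimes> h"] \<theta>[of y t] H.mem_carrier by (simp add: m_assoc)
      moreover have "xc (y \<otimes> t) = xc t"
        using conj_coset[OF x y t] by (simp add: xc_def)
      ultimately show "K (y \<otimes> t) = K t" by (simp add: K_def)
    qed
    also have "K (t \<otimes> g) = (\<theta> (t \<otimes> g \<otimes> h) - \<theta> (t \<otimes> g)) * v (xc t \<otimes> g \<otimes> h)" if "t \<in> ?T" for t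
    proof -
      have t: "t \<in> carrier P" using that T by simp
      have "g \<otimes> (xc (t \<otimes> g) \<otimes> h) = (g \<otimes> inv g) \<otimes> (inv t \<otimes> (x \<otimes> (t \<otimes> (g \<otimes> h))))"
        using t g h x by (simp add: xc_def inv_mult_group m_assoc inv_cancel)
      also have "\<dots> = xc t \<otimes> g \<otimes> h" using t g h x by (simp add: xc_def m_assoc)
      finally show ?thesis by (simp add: K_def)
    qed
    then have "(\<Sum>t\<in>?T. K (t \<otimes> g)) =
        (\<Sum>t\<in>?T. (\<theta> (t \<otimes> g \<otimes> h) - \<theta> (t \<otimes> g)) * v (xc t \<otimes> g \<otimes> h))"
      by (rule sum.cong[OF refl])
    finally have K: "(\<Sum>t\<in>?T. K t) = \<dots>" by simp
    have "pair (m h) (\<lambda>w. v (g \<otimes> w)) = (\<Sum>t\<in>?T. K t)"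
      by (simp add: pm h K_def)
    moreover have "pair (m (g \<otimes> h)) v = (\<Sum>t\<in>?T. (\<theta> (t \<otimes> g \<otimes> h) - \<theta> t) * v (xc t \<otimes> g \<otimes> h))"
      unfolding pm[OF m_closed[OF g h]]
      using T xc g h by (intro sum.cong) (auto simp: m_assoc)
    ultimately show "pair (m (g \<otimes> h)) v = pair (m g) (\<lambda>w. v (w \<otimes> h)) + pair (m h) (\<lambda>w. v (g \<otimes> w))"
      unfolding K pm[OF g] by (simp add: algebra_simps sum.distrib sum_subtractf)
  qed blast
  have "acts D x F"
    unfolding acts_def
  proof (intro allI impI ballI)
    fix v g assume v: "invariant v" and g: "g \<in> carrier P"
    have "dual D v g = (\<Sum>t\<in>?T. (\<theta> (t \<otimes> g) - \<theta> t) * v (x \<otimes> g))"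
      unfolding dD[OF g] pm[OF g]
    proof (rule sum.cong[OF refl])
      fix t assume "t \<in> ?T"
      then have t: "t \<in> carrier P" by (rule T)
      have "v (xc t \<otimes> g) = v (x \<otimes> g)"
        using t g x by (intro invariantD[OF v]) (simp_all add: xc_def eqv_simps)
      then show "(\<theta> (t \<otimes> g) - \<theta> t) * v (xc t \<otimes> g) = (\<theta> (t \<otimes> g) - \<theta> t) * v (x \<otimes> g)" by simp
    qed
    also have "\<dots> = F g * v (x \<otimes> g)"
      using H.transferred_character_telescope[of \<theta> f g] \<theta> g f(2) by (simp flip: sum_distrib_right)
    finally show "dual D v g = F g * v (x \<otimes> g)" .
  qed
  with D show ?thesis by blast
qed

text \<open>
  Conversely, the coefficient \<open>\<phi> z g\<close> of \<open>z \<otimes> g\<close> in \<open>D g\<close> is a cocycle for the conjugation action. A class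
  for equivalence is a union of conjugacy classes, so some conjugacy class, say that of \<open>x\<close>, contributes
  to a nonzero symbol; on the centralizer of \<open>x\<close> the function \<open>\<phi> x\<close> is a character, and on the whole
  group it is a primitive for it.
\<close>

lemma symbol_nonzero_realizable:
  assumes D: "D \<in> Der A" and a: "a \<in> carrier P" and y: "y \<in> carrier P" and nz: "symbol D a y \<noteq> 0"
  shows "\<exists>x\<in>carrier P. eqv x a \<and> (\<exists>F. realizable x F \<and> F y \<noteq> 0)"
proof -
  define \<phi> where "\<phi> = (\<lambda>z g. dual D (delta (z \<otimes> g)) g)"
  have cocycle: "\<phi> z (g \<otimes> h) = \<phi> z g + \<phi> (inv g \<otimes> z \<otimes> g) h"
    if z: "z \<in> carrier P" and g: "g \<in> carrier P" and h: "h \<in> carrier P" for z g h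
  proof -
    have "dual D (\<lambda>w. delta (z \<otimes> (g \<otimes> h)) (w \<otimes> h)) g = \<phi> z g"
      unfolding \<phi>_def by (rule dual_cong) (use z g h in \<open>simp add: delta_def flip: m_assoc\<close>)
    moreover have "dual D (\<lambda>w. delta (z \<otimes> (g \<otimes> h)) (g \<otimes> w)) h = \<phi> (inv g \<otimes> z \<otimes> g) h"
      unfolding \<phi>_def
    proof (rule dual_cong)
      fix w assume w: "w \<in> carrier P"
      have "z \<otimes> (g \<otimes> h) = g \<otimes> (inv g \<otimes> z \<otimes> g \<otimes> h)"
        using z g h by (simp add: m_assoc inv_cancel)
      then show "delta (z \<otimes> (g \<otimes> h)) (g \<otimes> w) = delta (inv g \<otimes> z \<otimes> g \<otimes> h) w"
        using z g h w by (simp add: delta_def)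
    qed
    ultimately show ?thesis
      by (simp add: \<phi>_def[of] dual_Leibniz[OF D g h])
  qed
  define S where "S = {z \<in> carrier P. eqv z a}"
  have finS: "finite S" using finP by (simp add: S_def)
  have "symbol D a y = (\<Sum>w\<in>carrier P. D (delta y) w * class_indicator (a \<otimes> y) w)"
    by (simp add: symbol_def dual_def pair_def)
  also have "\<dots> = (\<Sum>z\<in>carrier P. D (delta y) (z \<otimes> y) * class_indicator (a \<otimes> y) (z \<otimes> y))"
    by (rule sum.reindex_bij_witness[of _ "\<lambda>z. z \<otimes> y" "\<lambda>w. w \<otimes> inv y"]) (auto simp: y m_assoc)
  also have "\<dots> = (\<Sum>z\<in>carrier P. if eqv z a then \<phi> z y else 0)"
    by (rule sum.cong) (auto simp: class_indicator_def eqv_mult_right a y \<phi>_def dual_def pair_delta_right)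
  also have "\<dots> = (\<Sum>z\<in>S. \<phi> z y)"
    unfolding S_def using finP by (rule sum.inter_filter[symmetric])
  finally have "(\<Sum>z\<in>S. \<phi> z y) \<noteq> 0" using nz by simp
  define q where "q = (\<lambda>z. (\<lambda>t. inv t \<otimes> z \<otimes> t) ` carrier P)"
  obtain x where xS: "x \<in> S" and sx: "(\<Sum>z\<in>{z \<in> S. q z = q x}. \<phi> z y) \<noteq> 0"
    using sum_fiber_nonzero[OF finS \<open>(\<Sum>z\<in>S. \<phi> z y) \<noteq> 0\<close>, of q] by blast
  have x: "x \<in> carrier P" and xa: "eqv x a" using xS by (auto simp: S_def)
  let ?H = "centralizer P x"
  interpret H: finite_subgroup P ?H by (rule finite_subgroup_centralizer[OF x])
  let ?T = "set H.reps"
  define xc where "xc = (\<lambda>t. inv t \<otimes> x \<otimes> t)"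
  have conj2: "inv s \<otimes> (inv t \<otimes> z \<otimes> t) \<otimes> s = inv (t \<otimes> s) \<otimes> z \<otimes> (t \<otimes> s)"
    if "s \<in> carrier P" "t \<in> carrier P" "z \<in> carrier P" for s t z
    using that by (simp add: inv_mult_group m_assoc)
  have cl: "{z \<in> S. q z = q x} = xc ` ?T"
  proof (intro subset_antisym subsetI)
    fix z assume "z \<in> {z \<in> S. q z = q x}"
    then have z: "z \<in> carrier P" "q z = q x" by (auto simp: S_def)
    have "z \<in> q z" unfolding q_def by (rule image_eqI[of _ _ \<one>]) (use z(1) in auto)
    then have "z \<in> q x" by (simp only: z(2))
    then obtain u where u: "u \<in> carrier P" "z = xc u" by (auto simp: q_def xc_def)
    obtain h t where ht: "h \<in> ?H" "t \<in> ?T" "u = h \<otimes> t" using H.coset_decomposition[OF u(1)] .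
    then have "z = xc t" using u conj_coset[OF x ht(1)] H.reps_in_carrier by (simp add: xc_def)
    with ht show "z \<in> xc ` ?T" by simp
  next
    fix z assume "z \<in> xc ` ?T"
    then obtain t where t: "t \<in> carrier P" "z = xc t" using H.reps_in_carrier by auto
    have "eqv z x" using t x by (simp add: xc_def eqv_simps)
    then have "eqv z a" using xa by (rule eqv_trans)
    then have "z \<in> S" using t x by (simp add: S_def xc_def)
    moreover have "q z = q x"
    proof (intro subset_antisym subsetI)
      fix w assume "w \<in> q z"
      then obtain s where s: "s \<in> carrier P" "w = inv s \<otimes> z \<otimes> s" unfolding q_def by blast
      then have "w = inv (t \<otimes> s) \<otimes> x \<otimes> (t \<otimes> s)" using conj2[of s t x] t x by (simp add: xc_def)
      then show "w \<in> q x"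
        unfolding q_def by (rule image_eqI) (use s(1) t(1) in simp)
    next
      fix w assume "w \<in> q x"
      then obtain s where s: "s \<in> carrier P" "w = inv s \<otimes> x \<otimes> s" unfolding q_def by blast
      have "w = inv (inv t \<otimes> s) \<otimes> xc t \<otimes> (inv t \<otimes> s)"
        using s t x by (simp add: xc_def inv_mult_group m_assoc inv_cancel)
      then show "w \<in> q z"
        unfolding q_def t(2) by (rule image_eqI) (use s(1) t(1) in simp)
    qed
    ultimately show "z \<in> {z \<in> S. q z = q x}" by simp
  qed
  have inj: "inj_on xc ?T"
  proof (rule inj_onI)
    fix s t assume s: "s \<in> ?T" and t: "t \<in> ?T" and eq: "xc s = xc t"
    have sc: "s \<in> carrier P" and tc: "t \<in> carrier P"
      using H.reps_in_carrier[OF s] H.reps_in_carrier[OF t] by simp_all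
    have "s \<otimes> xc s \<otimes> inv t = s \<otimes> xc t \<otimes> inv t" by (simp add: eq)
    then have "(s \<otimes> inv t) \<otimes> x = x \<otimes> (s \<otimes> inv t)"
      using sc tc x by (simp add: xc_def m_assoc inv_cancel)
    then have "s \<otimes> inv t \<in> ?H" unfolding centralizer_def using sc tc by blast
    moreover have "\<one> \<otimes> s = (s \<otimes> inv t) \<otimes> t" using sc tc by (simp add: m_assoc)
    ultimately show "s = t" using H.coset_unique(2)[OF s t H.one_closed] by blast
  qed
  define f where "f = \<phi> x"
  have \<theta>: "f (h \<otimes> u) = f h + f u" if "h \<in> ?H" "u \<in> carrier P" for h u
  proof -
    have h: "h \<in> carrier P" "h \<otimes> x = x \<otimes> h"
      using that(1) unfolding centralizer_def by blast+
    have "inv h \<otimes> x \<otimes> h = x"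
      unfolding m_assoc[OF inv_closed[OF h(1)] x h(1)] h(2)[symmetric]
      using h(1) x by (simp add: inv_cancel)
    then show ?thesis using cocycle[OF x h(1) that(2)] by (simp add: f_def)
  qed
  have "(\<Sum>z\<in>{z \<in> S. q z = q x}. \<phi> z y) = (\<Sum>t\<in>?T. \<phi> (xc t) y)"
    unfolding cl using sum.reindex[OF inj] by simp
  also have "\<dots> = (\<Sum>t\<in>?T. f (t \<otimes> y) - f t)"
    by (rule sum.cong) (auto simp: f_def cocycle[OF x _ y] xc_def H.reps_in_carrier)
  also have "\<dots> = transferred_character P ?H f y"
    using \<theta> y by (rule H.transferred_character_telescope)
  finally have "transferred_character P ?H f y \<noteq> 0" using sx by simp
  moreover have "additive_character P ?H f"
    using \<theta> H.mem_carrier by (simp add: additive_character_def)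
  ultimately show ?thesis using x xa by (auto simp: realizable_def)
qed

end

section \<open>Fixed points of p-groups\<close>

text \<open>
  Every orbit has cardinality 1 or divisible by \<open>p\<close>, so a single fixed point is impossible when \<open>p\<close>
  divides the cardinality of the set.
\<close>

lemma (in group_action) another_fixed_point:
  assumes fin: "finite E" and p: "prime p" and ord: "order G = p ^ n" and dvd: "p dvd card E"
    and e0: "e0 \<in> E" "\<And>g. g \<in> carrier G \<Longrightarrow> \<phi> g e0 = e0"
  shows "\<exists>e\<in>E. e \<noteq> e0 \<and> (\<forall>g\<in>carrier G. \<phi> g e = e)"
proof (rule ccontr)
  assume no: "\<not> ?thesis"
  interpret grp: group G using group_hom group_hom.axioms(1) by auto
  let ?O = "orbits G E \<phi>"
  have o0: "orbit G \<phi> e0 = {e0}"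
  proof -
    have "orbit G \<phi> e0 = (\<lambda>g. \<phi> g e0) ` carrier G" unfolding orbit_def by (rule Setcompr_eq_image)
    also have "\<dots> = (\<lambda>g. e0) ` carrier G" by (rule image_cong[OF refl e0(2)])
    also have "\<dots> = {e0}" using grp.one_closed by auto
    finally show ?thesis .
  qed
  have finO: "finite ?O"
    using fin by (simp add: orbits_def Setcompr_eq_image)
  have e0O: "{e0} \<in> ?O"
    using o0 e0(1) by (auto simp: orbits_def)
  have pO: "p dvd card B" if B: "B \<in> ?O - {{e0}}" for B
  proof -
    obtain x where x: "x \<in> E" "B = orbit G \<phi> x" using B by (auto simp: orbits_def)
    have "card B dvd p ^ n"
      using orbit_stabilizer_theorem[OF x(1)] ord x(2) by (metis dvd_triv_left)
    then obtain i where i: "card B = p ^ i"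
      using p divides_primepow_nat by blast
    have "i \<noteq> 0"
    proof
      assume "i = 0"
      then obtain b where b: "B = {b}" using i by (auto simp: card_1_singleton_iff)
      have xB: "x \<in> B" using orbit_refl[OF x(1)] x(2) by simp
      have "\<phi> g x = x" if "g \<in> carrier G" for g
      proof -
        have "\<phi> g x \<in> B" using that x(2) by (auto simp: orbit_def)
        then show ?thesis using b xB by simp
      qed
      then have "x = e0" using no x(1) by blast
      then show False using B x(2) o0 by simp
    qed
    then show ?thesis using i by (simp add: dvd_power)
  qed
  have "card E = (\<Sum>B\<in>?O. card B)"
    using disjoint_sum[OF fin, of "\<lambda>_. 1 :: nat"] by simp
  also have "\<dots> = card {e0} + (\<Sum>B\<in>?O - {{e0}}. card B)"
    by (rule sum.remove[OF finO e0O])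
  finally have "p dvd 1 + (\<Sum>B\<in>?O - {{e0}}. card B)"
    using dvd by simp
  moreover have "p dvd (\<Sum>B\<in>?O - {{e0}}. card B)"
    by (rule dvd_sum) (rule pO)
  ultimately have "p dvd 1"
    by (metis dvd_add_left_iff)
  then show False using p not_prime_unit by blast
qed

text \<open>
  The group \<open>P\<close> acts on the cosets of \<open>Y\<close>, whose number is a power of \<open>p\<close> other than 1, and fixes the coset
  \<open>Y\<close>; any further fixed coset consists of elements that are fixed modulo \<open>Y\<close>.
\<close>

lemma p_group_fixed_coset:
  assumes "comm_group X" and P: "group P" and p: "prime p"
    and ordX: "order X = p ^ k" and ordP: "order P = p ^ n"
    and Y: "subgroup Y X" "Y \<noteq> carrier X"
    and T: "\<And>h. h \<in> carrier P \<Longrightarrow> T h \<in> hom X X"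
    and T1: "\<And>u. u \<in> carrier X \<Longrightarrow> T \<one>\<^bsub>P\<^esub> u = u"
    and TT: "\<And>h h' u. h \<in> carrier P \<Longrightarrow> h' \<in> carrier P \<Longrightarrow> u \<in> carrier X \<Longrightarrow>
      T (h \<otimes>\<^bsub>P\<^esub> h') u = T h (T h' u)"
    and TY: "\<And>h y. h \<in> carrier P \<Longrightarrow> y \<in> Y \<Longrightarrow> T h y \<in> Y"
  shows "\<exists>u\<in>carrier X - Y. \<forall>h\<in>carrier P. T h u \<otimes>\<^bsub>X\<^esub> inv\<^bsub>X\<^esub> u \<in> Y"
proof -
  interpret X: comm_group X by fact
  interpret P: group P by fact
  interpret Y: subgroup Y X by fact
  have finX: "finite (carrier X)"
    using ordX p by (intro X.order_gt_0_iff_finite[THEN iffD1]) (simp add: prime_gt_0_nat)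
  have TX: "T h u \<in> carrier X" if "h \<in> carrier P" "u \<in> carrier X" for h u
    using T[OF that(1)] that(2) by (auto simp: hom_def)
  have Tm: "T h (u \<otimes>\<^bsub>X\<^esub> v) = T h u \<otimes>\<^bsub>X\<^esub> T h v"
    if "h \<in> carrier P" "u \<in> carrier X" "v \<in> carrier X" for h u v
    using T[OF that(1)] that by (auto simp: hom_def)
  let ?E = "rcosets\<^bsub>X\<^esub> Y"
  define \<phi> where "\<phi> = (\<lambda>h. \<lambda>C\<in>?E. T h ` C)"
  have Tcos: "T h ` (Y #>\<^bsub>X\<^esub> u) = Y #>\<^bsub>X\<^esub> T h u" if h: "h \<in> carrier P" and u: "u \<in> carrier X" for h u
  proof (intro subset_antisym subsetI)
    fix z assume "z \<in> T h ` (Y #>\<^bsub>X\<^esub> u)"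
    then obtain y where y: "y \<in> Y" "z = T h (y \<otimes>\<^bsub>X\<^esub> u)" by (auto simp: r_coset_def)
    then have "z = T h y \<otimes>\<^bsub>X\<^esub> T h u" using h u by (simp add: Tm)
    then show "z \<in> Y #>\<^bsub>X\<^esub> T h u" using TY[OF h y(1)] by (auto simp: r_coset_def)
  next
    fix z assume "z \<in> Y #>\<^bsub>X\<^esub> T h u"
    then obtain y where y: "y \<in> Y" "z = y \<otimes>\<^bsub>X\<^esub> T h u" by (auto simp: r_coset_def)
    define y' where "y' = T (inv\<^bsub>P\<^esub> h) y"
    have y': "y' \<in> Y" using TY h y(1) by (simp add: y'_def)
    have "T h y' = y" using TT[of h "inv\<^bsub>P\<^esub> h" y] T1[of y] h y(1) by (simp add: y'_def)
    then have "z = T h (y' \<otimes>\<^bsub>X\<^esub> u)" using y(2) y' h u by (simp add: Tm)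
    then show "z \<in> T h ` (Y #>\<^bsub>X\<^esub> u)" using y' by (auto simp: r_coset_def)
  qed
  have E: "C \<in> ?E \<longleftrightarrow> (\<exists>u\<in>carrier X. C = Y #>\<^bsub>X\<^esub> u)" for C
    by (auto simp: RCOSETS_def)
  have \<phi>E: "\<phi> h (Y #>\<^bsub>X\<^esub> u) = Y #>\<^bsub>X\<^esub> T h u" if "h \<in> carrier P" "u \<in> carrier X" for h u
  proof -
    have "Y #>\<^bsub>X\<^esub> u \<in> ?E" using E that(2) by blast
    then show ?thesis by (simp add: \<phi>_def Tcos[OF that])
  qed
  have \<phi>cl: "\<phi> h C \<in> ?E" if h: "h \<in> carrier P" and C: "C \<in> ?E" for h C
  proof -
    obtain u where u: "u \<in> carrier X" "C = Y #>\<^bsub>X\<^esub> u" using C E by blast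
    show ?thesis unfolding u(2) \<phi>E[OF h u(1)] using E TX[OF h u(1)] by blast
  qed
  have \<phi>m: "\<phi> (h \<otimes>\<^bsub>P\<^esub> h') C = \<phi> h (\<phi> h' C)"
    if h: "h \<in> carrier P" and h': "h' \<in> carrier P" and C: "C \<in> ?E" for h h' C
  proof -
    obtain u where u: "u \<in> carrier X" "C = Y #>\<^bsub>X\<^esub> u" using C E by blast
    show ?thesis
      unfolding u(2) using h h' u(1) by (simp add: \<phi>E TX TT)
  qed
  have \<phi>1: "\<phi> \<one>\<^bsub>P\<^esub> C = C" if C: "C \<in> ?E" for C
  proof -
    obtain u where u: "u \<in> carrier X" "C = Y #>\<^bsub>X\<^esub> u" using C E by blast
    show ?thesis unfolding u(2) using u(1) by (simp add: \<phi>E T1)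
  qed
  have "group_action P ?E \<phi>"
    unfolding group_action_def group_hom_def group_hom_axioms_def
  proof (intro conjI)
    show "group P" by fact
    show "group (BijGroup ?E)" by (rule group_BijGroup)
    have bij: "\<phi> h \<in> Bij ?E" if h: "h \<in> carrier P" for h
      unfolding Bij_def
    proof (intro IntI CollectI)
      show "\<phi> h \<in> extensional ?E" by (simp add: \<phi>_def)
      show "bij_betw (\<phi> h) ?E ?E"
      proof (rule bij_betw_byWitness[where f' = "\<phi> (inv\<^bsub>P\<^esub> h)"])
        show "\<forall>C\<in>?E. \<phi> (inv\<^bsub>P\<^esub> h) (\<phi> h C) = C" "\<forall>C\<in>?E. \<phi> h (\<phi> (inv\<^bsub>P\<^esub> h) C) = C"
          using h by (simp_all add: \<phi>1 flip: \<phi>m)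
        show "\<phi> h ` ?E \<subseteq> ?E" "\<phi> (inv\<^bsub>P\<^esub> h) ` ?E \<subseteq> ?E" using \<phi>cl h by auto
      qed
    qed
    show "\<phi> \<in> hom P (BijGroup ?E)"
    proof (rule homI)
      show "\<phi> h \<in> carrier (BijGroup ?E)" if "h \<in> carrier P" for h
        using bij[OF that] by (simp add: BijGroup_def)
      show "\<phi> (h \<otimes>\<^bsub>P\<^esub> h') = \<phi> h \<otimes>\<^bsub>BijGroup ?E\<^esub> \<phi> h'"
        if "h \<in> carrier P" "h' \<in> carrier P" for h h'
      proof (rule extensionalityI[of _ ?E])
        show "\<phi> (h \<otimes>\<^bsub>P\<^esub> h') \<in> extensional ?E" by (simp add: \<phi>_def)
        show "\<phi> h \<otimes>\<^bsub>BijGroup ?E\<^esub> \<phi> h' \<in> extensional ?E"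
          using that bij by (simp add: BijGroup_def)
        show "\<phi> (h \<otimes>\<^bsub>P\<^esub> h') C = (\<phi> h \<otimes>\<^bsub>BijGroup ?E\<^esub> \<phi> h') C" if "C \<in> ?E" for C
          using that \<open>h \<in> carrier P\<close> \<open>h' \<in> carrier P\<close> bij by (simp add: BijGroup_def compose_def \<phi>m)
      qed
    qed
  qed
  then interpret act: group_action P ?E \<phi> .
  have cE: "card ?E * card Y = p ^ k"
    using X.lagrange[OF Y(1)] ordX by simp
  have finE: "finite ?E" using finX by (simp add: RCOSETS_def)
  have YE: "Y \<in> ?E" using E[of Y] X.coset_mult_one[OF Y.subset] X.one_closed by blast
  obtain z where z: "z \<in> carrier X" "z \<notin> Y" using Y Y.subset by blast
  have "Y #>\<^bsub>X\<^esub> z \<noteq> Y" using z X.rcos_self[OF z(1) Y(1)] by auto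
  moreover have "Y #>\<^bsub>X\<^esub> z \<in> ?E" using E z(1) by blast
  ultimately have "card ?E \<noteq> 1" using YE by (metis card_1_singletonE singletonD)
  moreover have "card ?E dvd p ^ k" using cE by (metis dvd_triv_left)
  ultimately have "p dvd card ?E"
    using p divides_primepow_nat by (metis dvd_power gr_zeroI power_0)
  moreover have "\<phi> h Y = Y" if "h \<in> carrier P" for h
  proof -
    have "T h \<one>\<^bsub>X\<^esub> \<in> Y" using TY that by simp
    then have "Y #>\<^bsub>X\<^esub> T h \<one>\<^bsub>X\<^esub> = Y" using X.coset_join2 Y(1) by simp
    then show ?thesis using \<phi>E[OF that X.one_closed] X.coset_mult_one[OF Y.subset] by simp
  qed
  ultimately obtain C where C: "C \<in> ?E" "C \<noteq> Y" "\<And>h. h \<in> carrier P \<Longrightarrow> \<phi> h C = C"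
    using act.another_fixed_point[OF finE p ordP _ YE] by blast
  obtain u where u: "u \<in> carrier X" "C = Y #>\<^bsub>X\<^esub> u" using C(1) E by blast
  have "u \<notin> Y" using C(2) u X.coset_join2[OF u(1) Y(1)] by blast
  moreover have "T h u \<otimes>\<^bsub>X\<^esub> inv\<^bsub>X\<^esub> u \<in> Y" if h: "h \<in> carrier P" for h
  proof -
    have "Y #>\<^bsub>X\<^esub> T h u = Y #>\<^bsub>X\<^esub> u" using C(3)[OF h] u \<phi>E[OF h u(1)] by simp
    then have "T h u \<in> Y #>\<^bsub>X\<^esub> u" using X.rcos_self[OF TX[OF h u(1)] Y(1)] by simp
    then obtain y where y: "y \<in> Y" "T h u = y \<otimes>\<^bsub>X\<^esub> u" by (auto simp: r_coset_def)
    then show ?thesis using u(1) by (simp add: X.m_assoc)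
  qed
  ultimately show ?thesis using u(1) by blast
qed

section \<open>Polynomial functions and derivations of positive degree\<close>

context finite_group_algebra
begin

text \<open>
  Functions of polynomial degree less than \<open>m\<close>: those killed by \<open>m\<close> successive differences. These are the
  functionals that vanish on the \<open>m\<close>-th power of the augmentation ideal. Membership is a condition on
  values of functions, whereas the powers of the ideal would have to be described as spans.
\<close>

primrec poly_below :: "nat \<Rightarrow> ('g \<Rightarrow> 'k) set" where
  "poly_below 0 = {u. \<forall>g\<in>carrier P. u g = 0}"
| "poly_below (Suc m) = {u. \<forall>h\<in>carrier P. (\<lambda>g. u (h \<otimes> g) - u g) \<in> poly_below m}"

lemma poly_below_SucD: "u \<in> poly_below (Suc m) \<Longrightarrow> h \<in> carrier P \<Longrightarrow> (\<lambda>g. u (h \<otimes> g) - u g) \<in> poly_below m"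
  by simp

lemma poly_below_SucI: "(\<And>h. h \<in> carrier P \<Longrightarrow> (\<lambda>g. u (h \<otimes> g) - u g) \<in> poly_below m) \<Longrightarrow> u \<in> poly_below (Suc m)"
  by simp

lemma poly_below_cong:
  "u \<in> poly_below m \<Longrightarrow> (\<And>g. g \<in> carrier P \<Longrightarrow> u g = v g) \<Longrightarrow> v \<in> poly_below m"
proof (induction m arbitrary: u v)
  case 0
  then show ?case by simp
next
  case (Suc m)
  show ?case
  proof (rule poly_below_SucI)
    fix h assume h: "h \<in> carrier P"
    show "(\<lambda>g. v (h \<otimes> g) - v g) \<in> poly_below m"
      by (rule Suc.IH[OF poly_below_SucD[OF Suc.prems(1) h]]) (simp add: Suc.prems(2) h)
  qed
qed

lemma poly_below_linear: "u \<in> poly_below m \<Longrightarrow> v \<in> poly_below m \<Longrightarrow> (\<lambda>g. u g + c * v g) \<in> poly_below m"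
proof (induction m arbitrary: u v)
  case 0
  then show ?case by simp
next
  case (Suc m)
  show ?case
  proof (rule poly_below_SucI)
    fix h assume h: "h \<in> carrier P"
    from Suc.IH[OF poly_below_SucD[OF Suc.prems(1) h] poly_below_SucD[OF Suc.prems(2) h]]
    show "(\<lambda>g. (u (h \<otimes> g) + c * v (h \<otimes> g)) - (u g + c * v g)) \<in> poly_below m"
      by (rule poly_below_cong) (simp add: algebra_simps)
  qed
qed

lemma poly_below_zero: "(\<lambda>g. 0) \<in> poly_below m"
  by (induction m) simp_all

lemma poly_below_add: "u \<in> poly_below m \<Longrightarrow> v \<in> poly_below m \<Longrightarrow> (\<lambda>g. u g + v g) \<in> poly_below m"
  using poly_below_linear[of u m v 1] by simp

lemma poly_below_diff: "u \<in> poly_below m \<Longrightarrow> v \<in> poly_below m \<Longrightarrow> (\<lambda>g. u g - v g) \<in> poly_below m"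
  using poly_below_linear[of u m v "-1"] by simp

lemma poly_below_smult: "v \<in> poly_below m \<Longrightarrow> (\<lambda>g. c * v g) \<in> poly_below m"
  using poly_below_linear[OF poly_below_zero, of v m c] by simp

lemma poly_below_sum:
  "finite S \<Longrightarrow> (\<And>s. s \<in> S \<Longrightarrow> w s \<in> poly_below m) \<Longrightarrow> (\<lambda>g. \<Sum>s\<in>S. c s * w s g) \<in> poly_below m"
proof (induction S rule: finite_induct)
  case empty
  then show ?case by (simp add: poly_below_zero)
next
  case (insert s S)
  have "(\<lambda>g. \<Sum>s\<in>S. c s * w s g) \<in> poly_below m" using insert by simp
  from poly_below_linear[OF this insert.prems[of s], of "c s"] insert.hyps show ?case
    by (simp add: add.commute)
qed

lemma poly_below_Suc: "u \<in> poly_below m \<Longrightarrow> u \<in> poly_below (Suc m)"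
proof (induction m arbitrary: u)
  case 0
  then show ?case by simp
next
  case (Suc m)
  show ?case by (rule poly_below_SucI) (rule Suc.IH[OF poly_below_SucD[OF Suc.prems]])
qed

lemma poly_below_mono: "m \<le> n \<Longrightarrow> u \<in> poly_below m \<Longrightarrow> u \<in> poly_below n"
  by (induction n rule: dec_induct) (auto simp del: poly_below.simps intro: poly_below_Suc)

lemma poly_below_translate: "u \<in> poly_below m \<Longrightarrow> h \<in> carrier P \<Longrightarrow> (\<lambda>g. u (g \<otimes> h)) \<in> poly_below m"
proof (induction m arbitrary: u)
  case 0
  then show ?case by simp
next
  case (Suc m)
  show ?case
  proof (rule poly_below_SucI)
    fix k assume k: "k \<in> carrier P"
    from Suc.IH[OF poly_below_SucD[OF Suc.prems(1) k] Suc.prems(2)]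
    show "(\<lambda>g. u (k \<otimes> g \<otimes> h) - u (g \<otimes> h)) \<in> poly_below m"
      by (rule poly_below_cong) (simp add: k Suc.prems(2) m_assoc)
  qed
qed

lemma poly_below_one_const:
  assumes u: "u \<in> poly_below (Suc 0)" and g: "g \<in> carrier P"
  shows "u g = u \<one>"
proof -
  have "\<forall>k\<in>carrier P. u (g \<otimes> k) - u k = 0"
    using poly_below_SucD[OF u g] by simp
  from bspec[OF this one_closed] show ?thesis using g by simp
qed

text \<open>
  Left and right differences commute. Hence the degree may be computed with either of them, which
  reflects that the augmentation ideal is two-sided; the Leibniz rule below uses one side, convolution
  the other.
\<close>

lemma poly_below_right:
  "u \<in> poly_below (Suc m) \<Longrightarrow> h \<in> carrier P \<Longrightarrow> (\<lambda>g. u (g \<otimes> h) - u g) \<in> poly_below m"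
proof (induction m arbitrary: u)
  case 0
  have const: "u g = u \<one>" if "g \<in> carrier P" for g
    by (rule poly_below_one_const[OF 0(1) that])
  have "u (g \<otimes> h) - u g = 0" if "g \<in> carrier P" for g
    using const[of "g \<otimes> h"] const[of g] that 0(2) by simp
  then show ?case by simp
next
  case (Suc m)
  show ?case
  proof (rule poly_below_SucI)
    fix k assume k: "k \<in> carrier P"
    from Suc.IH[OF poly_below_SucD[OF Suc.prems(1) k] Suc.prems(2)]
    show "(\<lambda>g. (u (k \<otimes> g \<otimes> h) - u (k \<otimes> g)) - (u (g \<otimes> h) - u g)) \<in> poly_below m"
      by (rule poly_below_cong) (simp add: k Suc.prems(2) m_assoc)
  qed
qed

lemma poly_below_rightI:
  "(\<And>h. h \<in> carrier P \<Longrightarrow> (\<lambda>g. u (g \<otimes> h) - u g) \<in> poly_below m) \<Longrightarrow> u \<in> poly_below (Suc m)"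
proof (induction m arbitrary: u)
  case 0
  have const: "u g = u \<one>" if "g \<in> carrier P" for g
  proof -
    have "\<forall>k\<in>carrier P. u (k \<otimes> g) - u k = 0" using 0[OF that] by simp
    from bspec[OF this one_closed] show ?thesis using that by simp
  qed
  have "u (h \<otimes> g) - u g = 0" if "h \<in> carrier P" "g \<in> carrier P" for g h
    using const[of "h \<otimes> g"] const[of g] that by simp
  then show ?case by simp
next
  case (Suc m)
  show ?case
  proof (rule poly_below_SucI)
    fix k assume k: "k \<in> carrier P"
    show "(\<lambda>g. u (k \<otimes> g) - u g) \<in> poly_below (Suc m)"
    proof (rule Suc.IH)
      fix h assume h: "h \<in> carrier P"
      from poly_below_SucD[OF Suc.prems[OF h] k]
      show "(\<lambda>g. (u (k \<otimes> (g \<otimes> h)) - u (g \<otimes> h)) - (u (k \<otimes> g) - u g)) \<in> poly_below m"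
        by (rule poly_below_cong) (simp add: h k m_assoc)
    qed
  qed
qed

text \<open>
  An element \<open>c\<close> of \<open>kP\<close> that vanishes in the group algebra of the quotient by \<open>eqv\<close> lies in the square of the
  augmentation ideal, so it lowers degrees by two. For degree at most one this holds because an affine
  function, up to a constant, is a character.
\<close>

lemma poly_below_convolve:
  assumes c: "\<And>v. invariant v \<Longrightarrow> pair c v = 0"
  shows "u \<in> poly_below (Suc (Suc m)) \<Longrightarrow> (\<lambda>g. pair c (\<lambda>w. u (g \<otimes> w))) \<in> poly_below m"
proof (induction m arbitrary: u)
  case 0
  have aff: "u (h \<otimes> g) - u g = u h - u \<one>" if h: "h \<in> carrier P" and g: "g \<in> carrier P" for g h
  proof -
    have *: "u (h \<otimes> (k \<otimes> l)) - u (k \<otimes> l) = u (h \<otimes> l) - u l"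
      if "k \<in> carrier P" "l \<in> carrier P" for k l
      using poly_below_SucD[OF poly_below_SucD[OF 0 h] that(1)] that(2) by simp
    from *[OF g one_closed] show ?thesis using h g by simp
  qed
  have ch: "additive_character P (carrier P) (\<lambda>g. u g - u \<one>)"
    unfolding additive_character_def
  proof (intro ballI)
    fix x y assume "x \<in> carrier P" "y \<in> carrier P"
    from aff[OF this] show "u (x \<otimes> y) - u \<one> = (u x - u \<one>) + (u y - u \<one>)"
      by (simp add: algebra_simps)
  qed
  have "invariant (\<lambda>w. u (g \<otimes> w))" if g: "g \<in> carrier P" for g
    unfolding invariant_def
  proof (intro ballI impI)
    fix x y assume x: "x \<in> carrier P" and y: "y \<in> carrier P" and xy: "eqv x y"
    have eq: "u x - u \<one> = u y - u \<one>" using xy[unfolded eqv_def, rule_format, OF ch] .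
    then show "u (g \<otimes> x) = u (g \<otimes> y)"
      using aff[OF g x] aff[OF g y] eq by (metis diff_add_cancel)
  qed
  then show ?case using c by simp
next
  case (Suc m)
  show ?case
  proof (rule poly_below_SucI)
    fix h assume h: "h \<in> carrier P"
    from Suc.IH[OF poly_below_SucD[OF Suc.prems h]]
    show "(\<lambda>g. pair c (\<lambda>w. u (h \<otimes> g \<otimes> w)) - pair c (\<lambda>w. u (g \<otimes> w))) \<in> poly_below m"
    proof (rule poly_below_cong)
      fix g assume g: "g \<in> carrier P"
      show "pair c (\<lambda>w. u (h \<otimes> (g \<otimes> w)) - u (g \<otimes> w)) =
          pair c (\<lambda>w. u (h \<otimes> g \<otimes> w)) - pair c (\<lambda>w. u (g \<otimes> w))"
        unfolding pair_diff[symmetric] by (rule pair_cong) (simp add: g h m_assoc)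
    qed
  qed
qed

text \<open>
  In terms of the augmentation ideal \<open>J\<close>, these derivations map \<open>J\<^sup>m\<close> into \<open>J\<^sup>m\<^sup>+\<^sup>j\<close> for all \<open>m\<close>.
\<close>

definition degree_lowering :: "nat \<Rightarrow> (('g \<Rightarrow> 'k) \<Rightarrow> 'g \<Rightarrow> 'k) set" where
  "degree_lowering j = {D \<in> Der A. \<forall>m. \<forall>u\<in>poly_below (m + j). dual D u \<in> poly_below m}"

text \<open>
  A derivation without symbol has all its values in the square of the augmentation ideal. By the
  Leibniz rule it then raises the filtration by the powers of that ideal.
\<close>

lemma degree_lowering_one:
  assumes D: "D \<in> Der A" and triv: "\<And>c g. c \<in> carrier P \<Longrightarrow> g \<in> carrier P \<Longrightarrow> symbol D c g = 0"
  shows "D \<in> degree_lowering 1"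
proof -
  have z: "dual D v g = 0" if v: "invariant v" and g: "g \<in> carrier P" for v g
  proof (rule ccontr)
    assume "dual D v g \<noteq> 0"
    then obtain t where t: "t \<in> carrier P" "pair (D (delta g)) (class_indicator t) \<noteq> 0"
      using pair_invariant_nonzero[OF v] unfolding dual_def by blast
    then show False using triv[of "t \<otimes> inv g" g] g dual_ind[of g t D] by (simp add: dual_def)
  qed
  have "dual D u \<in> poly_below m" if "u \<in> poly_below (Suc m)" for u m
    using that
  proof (induction m arbitrary: u)
    case 0
    have const: "u g = u \<one>" if "g \<in> carrier P" for g
      by (rule poly_below_one_const[OF 0 that])
    have "invariant u" unfolding invariant_def
    proof (intro ballI impI)
      fix x y assume "x \<in> carrier P" "y \<in> carrier P"
      then show "u x = u y" using const[of x] const[of y] by simp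
    qed
    then show ?case using z by simp
  next
    case (Suc m)
    show ?case
    proof (rule poly_below_rightI)
      fix h assume h: "h \<in> carrier P"
      have "(\<lambda>g. pair (D (delta h)) (\<lambda>w. u (g \<otimes> w))) \<in> poly_below m"
        by (rule poly_below_convolve[OF _ Suc.prems]) (use z h in \<open>simp add: dual_def\<close>)
      from poly_below_add[OF Suc.IH[OF poly_below_right[OF Suc.prems h]] this]
      show "(\<lambda>g. dual D u (g \<otimes> h) - dual D u g) \<in> poly_below m"
      proof (rule poly_below_cong)
        fix g assume g: "g \<in> carrier P"
        show "dual D (\<lambda>g. u (g \<otimes> h) - u g) g + pair (D (delta h)) (\<lambda>w. u (g \<otimes> w)) =
            dual D u (g \<otimes> h) - dual D u g"
          unfolding dual_Leibniz[OF D g h] by (simp add: dual_def pair_diff)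
      qed
    qed
  qed
  then show ?thesis using D by (simp add: degree_lowering_def del: poly_below.simps)
qed

lemma degree_lowering_bracket:
  assumes D: "D \<in> degree_lowering (Suc j)" and E: "E \<in> degree_lowering (Suc j)"
  shows "bracket L D E \<in> degree_lowering (Suc (Suc j))"
proof -
  have DE: "D \<in> Der A" "E \<in> Der A" using D E by (auto simp: degree_lowering_def)
  have *: "dual Y (dual X u) \<in> poly_below m"
    if X: "X \<in> degree_lowering (Suc j)" and Y: "Y \<in> degree_lowering (Suc j)"
      and u: "u \<in> poly_below (m + Suc (Suc j))" for X Y u m
  proof -
    have "dual X u \<in> poly_below (Suc m)"
      using X u unfolding degree_lowering_def by (simp del: poly_below.simps)
    then have "dual X u \<in> poly_below (m + Suc j)" by (rule poly_below_mono[rotated]) simp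
    then show ?thesis using Y unfolding degree_lowering_def by (simp del: poly_below.simps)
  qed
  have "dual (bracket L D E) u \<in> poly_below m" if "u \<in> poly_below (m + Suc (Suc j))" for u m
    using poly_below_diff[OF *[OF D E that] *[OF E D that]]
    by (rule poly_below_cong) (simp add: dual_bracket_L DE)
  then show ?thesis using DE by (simp add: degree_lowering_def bracket_in_Der del: poly_below.simps)
qed

lemma lie_derived_degree_lowering:
  assumes U: "U \<subseteq> degree_lowering (Suc j)"
  shows "lie_derived L U \<subseteq> degree_lowering (Suc (Suc j))"
proof
  fix D assume "D \<in> lie_derived L U"
  then show "D \<in> degree_lowering (Suc (Suc j))"
    unfolding lie_derived_def
  proof (induction rule: lie_span.induct)
    case zero
    have "dual \<zero>\<^bsub>L\<^esub> u \<in> poly_below m" for u m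
      by (rule poly_below_cong[OF poly_below_zero]) (simp add: dual_zero_L)
    then show ?case by (simp add: degree_lowering_def zero_in_Der del: poly_below.simps)
  next
    case (base D)
    then show ?case using U degree_lowering_bracket by blast
  next
    case (add D E)
    have "dual (D \<oplus>\<^bsub>L\<^esub> E) u \<in> poly_below m" if "u \<in> poly_below (m + Suc (Suc j))" for u m
      by (rule poly_below_cong[OF poly_below_add[of "dual D u" m "dual E u"]])
        (use add.IH that in \<open>auto simp: degree_lowering_def dual_add_L simp del: poly_below.simps\<close>)
    then show ?case using add.IH by (simp add: degree_lowering_def add_in_Der del: poly_below.simps)
  next
    case (smult D c)
    have "dual (c \<odot>\<^bsub>L\<^esub> D) u \<in> poly_below m" if "u \<in> poly_below (m + Suc (Suc j))" for u m
      by (rule poly_below_cong[OF poly_below_smult[of "dual D u" m c]])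
        (use smult.IH that in \<open>auto simp: degree_lowering_def dual_smult_L simp del: poly_below.simps\<close>)
    then show ?case using smult.IH by (simp add: degree_lowering_def smult_in_Der del: poly_below.simps)
  qed
qed

end

section \<open>Derivations without symbol form a nilpotent algebra\<close>

locale p_group_algebra = finite_group_algebra P A
  for P :: "('g, 'm) monoid_scheme" (structure) and A :: "('k::field, 'g \<Rightarrow> 'k) module" +
  fixes n :: nat
  assumes p: "prime CHAR('k)" and ord: "order P = CHAR('k) ^ n"

context p_group_algebra
begin

lemma finite_prime_field:
  "card (range (of_nat :: nat \<Rightarrow> 'k)) = CHAR('k)" "finite (range (of_nat :: nat \<Rightarrow> 'k))"
proof -
  let ?p = "CHAR('k)"
  have p0: "?p > 0" using p by (rule prime_gt_0_nat)
  have "range (of_nat :: nat \<Rightarrow> 'k) = of_nat ` {..<?p}"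
  proof (intro subset_antisym subsetI)
    fix x :: 'k assume "x \<in> range of_nat"
    then obtain i :: nat where "x = of_nat i" by auto
    also have "\<dots> = of_nat (i mod ?p)"
      by (simp add: of_nat_eq_iff_cong_CHAR cong_def)
    finally show "x \<in> of_nat ` {..<?p}" using p0 by auto
  qed auto
  moreover have "inj_on (of_nat :: nat \<Rightarrow> 'k) {..<?p}"
    by (rule inj_onI) (auto simp: of_nat_eq_iff_cong_CHAR cong_def)
  ultimately show "card (range (of_nat :: nat \<Rightarrow> 'k)) = ?p" "finite (range (of_nat :: nat \<Rightarrow> 'k))"
    by (simp_all add: card_image)
qed

lemma prime_field_uminus: "x \<in> range (of_nat :: nat \<Rightarrow> 'k) \<Longrightarrow> - x \<in> range (of_nat :: nat \<Rightarrow> 'k)"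
proof -
  assume "x \<in> range (of_nat :: nat \<Rightarrow> 'k)"
  then obtain i :: nat where i: "x = of_nat i" by auto
  have "x + of_nat (i * (CHAR('k) - 1)) = of_nat (i * CHAR('k))"
    using prime_gt_0_nat[OF p] unfolding i of_nat_add[symmetric]
    by (metis Suc_pred' add.commute mult_Suc_right diff_Suc_1 One_nat_def add.commute)
  also have "\<dots> = 0" by simp
  finally have "- x = of_nat (i * (CHAR('k) - 1))" by (simp only: add_eq_0_iff)
  then show ?thesis by (simp only: rangeI)
qed

text \<open>
  The augmentation ideal of a \<open>p\<close>-group in characteristic \<open>p\<close> is nilpotent. Fixed points can only be
  counted in finite sets, so functions with values in the prime field are considered first: if those of
  bounded degree were a proper subgroup, some function outside it would be fixed modulo the subgroup,
  that is, all its differences would have bounded degree, and so would the function itself.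
\<close>

lemma all_functions_poly_below: "\<exists>N. \<forall>u. u \<in> poly_below N"
proof -
  let ?F = "range (of_nat :: nat \<Rightarrow> 'k)"
  define X where "X = \<lparr>carrier = carrier P \<rightarrow>\<^sub>E ?F, mult = (\<lambda>u v. \<lambda>g\<in>carrier P. u g + v g),
    one = (\<lambda>g\<in>carrier P. 0 :: 'k)\<rparr>"
  have X: "carrier X = carrier P \<rightarrow>\<^sub>E ?F" "u \<otimes>\<^bsub>X\<^esub> v = (\<lambda>g\<in>carrier P. u g + v g)"
    "\<one>\<^bsub>X\<^esub> = (\<lambda>g\<in>carrier P. 0)" for u v
    by (simp_all add: X_def)
  have F0: "0 \<in> ?F" by (metis of_nat_0 rangeI)
  have F1: "1 \<in> ?F" by (metis of_nat_1 rangeI)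
  have Fadd: "x + y \<in> ?F" if "x \<in> ?F" "y \<in> ?F" for x y
    using that by (auto simp flip: of_nat_add)
  have neg: "(\<lambda>g\<in>carrier P. - u g) \<in> carrier X" if "u \<in> carrier X" for u
    using that prime_field_uminus unfolding X by (intro restrict_PiE_iff[THEN iffD2]) auto
  have "comm_group X"
  proof (rule comm_groupI)
    fix u v w assume u: "u \<in> carrier X" and v: "v \<in> carrier X"
    show "u \<otimes>\<^bsub>X\<^esub> v \<in> carrier X"
      unfolding X by (rule restrict_PiE_iff[THEN iffD2]) (use u v Fadd in \<open>auto simp: X dest!: PiE_mem\<close>)
    show "u \<otimes>\<^bsub>X\<^esub> v = v \<otimes>\<^bsub>X\<^esub> u" unfolding X by (simp add: add.commute)
    show "u \<otimes>\<^bsub>X\<^esub> v \<otimes>\<^bsub>X\<^esub> w = u \<otimes>\<^bsub>X\<^esub> (v \<otimes>\<^bsub>X\<^esub> w)"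
      unfolding X by (rule restrict_ext) (simp add: add.assoc)
  next
    show "\<one>\<^bsub>X\<^esub> \<in> carrier X" unfolding X using F0 by (intro restrict_PiE_iff[THEN iffD2]) auto
    fix u assume u: "u \<in> carrier X"
    show "\<one>\<^bsub>X\<^esub> \<otimes>\<^bsub>X\<^esub> u = u"
      using u unfolding X by (intro ext) (auto simp: PiE_def extensional_def)
    show "\<exists>v\<in>carrier X. v \<otimes>\<^bsub>X\<^esub> u = \<one>\<^bsub>X\<^esub>"
      by (rule bexI[OF _ neg[OF u]]) (unfold X, rule restrict_ext, simp)
  qed
  then interpret X: comm_group X .
  have invX: "inv\<^bsub>X\<^esub> u = (\<lambda>g\<in>carrier P. - u g)" if "u \<in> carrier X" for u
    by (rule X.inv_equality[OF _ that neg[OF that]]) (unfold X, rule restrict_ext, simp)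
  have ordX: "order X = CHAR('k) ^ card (carrier P)"
    by (simp add: order_def X card_PiE finP finite_prime_field)
  define Y where "Y = {u \<in> carrier X. \<exists>m. u \<in> poly_below m}"
  have Ym: "u \<otimes>\<^bsub>X\<^esub> v \<in> Y" if u: "u \<in> Y" and v: "v \<in> Y" for u v
  proof -
    obtain a b where a: "u \<in> poly_below a" "v \<in> poly_below b" using u v unfolding Y_def by blast
    have ab: "u \<in> poly_below (max a b)" "v \<in> poly_below (max a b)"
      using poly_below_mono[OF _ a(1), of "max a b"] poly_below_mono[OF _ a(2), of "max a b"] by simp_all
    have "u \<otimes>\<^bsub>X\<^esub> v \<in> poly_below (max a b)"
      by (rule poly_below_cong[OF poly_below_add[OF ab]]) (simp add: X)
    moreover have "u \<otimes>\<^bsub>X\<^esub> v \<in> carrier X" using u v by (intro X.m_closed) (auto simp: Y_def)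
    ultimately show ?thesis unfolding Y_def by blast
  qed
  have sY: "subgroup Y X"
  proof (rule X.subgroupI)
    show "Y \<subseteq> carrier X" by (auto simp: Y_def)
    have "\<one>\<^bsub>X\<^esub> \<in> poly_below 0" by (simp add: X)
    then have "\<one>\<^bsub>X\<^esub> \<in> Y" unfolding Y_def using X.one_closed by blast
    then show "Y \<noteq> {}" by blast
    fix u assume u: "u \<in> Y"
    then obtain m where m: "u \<in> poly_below m" "u \<in> carrier X" unfolding Y_def by blast
    have "inv\<^bsub>X\<^esub> u \<in> poly_below m"
      by (rule poly_below_cong[OF poly_below_smult[OF m(1), of "-1"]]) (simp add: invX m(2))
    then show "inv\<^bsub>X\<^esub> u \<in> Y" unfolding Y_def using X.inv_closed[OF m(2)] by blast
    fix v assume "v \<in> Y"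
    with u show "u \<otimes>\<^bsub>X\<^esub> v \<in> Y" by (rule Ym)
  qed
  define T where "T = (\<lambda>h u. \<lambda>g\<in>carrier P. u (g \<otimes> h) :: 'k)"
  have TX: "T h u \<in> carrier X" if "h \<in> carrier P" "u \<in> carrier X" for h u
    unfolding X T_def
  proof (intro restrict_PiE_iff[THEN iffD2] ballI)
    fix g assume "g \<in> carrier P"
    then show "u (g \<otimes> h) \<in> ?F" using that PiE_mem[of u "carrier P" "\<lambda>_. ?F"] unfolding X by blast
  qed
  have "Y = carrier X"
  proof (rule ccontr)
    assume ne: "Y \<noteq> carrier X"
    have "\<exists>u\<in>carrier X - Y. \<forall>h\<in>carrier P. T h u \<otimes>\<^bsub>X\<^esub> inv\<^bsub>X\<^esub> u \<in> Y"
    proof (rule p_group_fixed_coset[OF X.comm_group_axioms is_group p ordX ord sY ne])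
      show "T h \<in> hom X X" if h: "h \<in> carrier P" for h
      proof (rule homI)
        show "T h u \<in> carrier X" if "u \<in> carrier X" for u by (rule TX[OF h that])
        show "T h (u \<otimes>\<^bsub>X\<^esub> v) = T h u \<otimes>\<^bsub>X\<^esub> T h v" for u v
          unfolding X T_def by (rule restrict_ext) (simp add: h)
      qed
      show "T \<one> u = u" if "u \<in> carrier X" for u
        using that unfolding X T_def by (intro ext) (auto simp: PiE_def extensional_def)
      show "T (h \<otimes> h') u = T h (T h' u)" if "h \<in> carrier P" "h' \<in> carrier P" for h h' u
        unfolding T_def by (rule restrict_ext) (simp add: that m_assoc)
      show "T h y \<in> Y" if h: "h \<in> carrier P" and y: "y \<in> Y" for h y
      proof -
        obtain m where m: "y \<in> poly_below m" "y \<in> carrier X" using y unfolding Y_def by blast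
        have "T h y \<in> poly_below m" by (rule poly_below_cong[OF poly_below_translate[OF m(1) h]]) (simp add: T_def)
        then show ?thesis unfolding Y_def using TX[OF h m(2)] by blast
      qed
    qed
    then obtain u where u: "u \<in> carrier X" "u \<notin> Y"
      and fixed: "\<And>h. h \<in> carrier P \<Longrightarrow> T h u \<otimes>\<^bsub>X\<^esub> inv\<^bsub>X\<^esub> u \<in> Y" by blast
    have "\<forall>h. \<exists>m. h \<in> carrier P \<longrightarrow> T h u \<otimes>\<^bsub>X\<^esub> inv\<^bsub>X\<^esub> u \<in> poly_below m"
      using fixed unfolding Y_def by blast
    then obtain m where m: "\<And>h. h \<in> carrier P \<Longrightarrow> T h u \<otimes>\<^bsub>X\<^esub> inv\<^bsub>X\<^esub> u \<in> poly_below (m h)" by metis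
    have "u \<in> poly_below (Suc (\<Sum>h\<in>carrier P. m h))"
    proof (rule poly_below_rightI)
      fix h assume h: "h \<in> carrier P"
      have "m h \<le> (\<Sum>h\<in>carrier P. m h)" using finP h by (intro member_le_sum) auto
      from poly_below_mono[OF this m[OF h]] show "(\<lambda>g. u (g \<otimes> h) - u g) \<in> poly_below (\<Sum>h\<in>carrier P. m h)"
        by (rule poly_below_cong) (simp add: invX[OF u(1)] X T_def)
    qed
    then show False using u unfolding Y_def by blast
  qed
  moreover have "restrict (delta g) (carrier P) \<in> carrier X" for g
    unfolding X delta_def using F0 F1 by (intro restrict_PiE_iff[THEN iffD2]) simp
  ultimately have "\<forall>g. \<exists>m. restrict (delta g) (carrier P) \<in> poly_below m"
    unfolding Y_def by blast
  then obtain m where m: "\<And>g. restrict (delta g) (carrier P) \<in> poly_below (m g)" by metis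
  let ?N = "\<Sum>g\<in>carrier P. m g"
  have "u \<in> poly_below ?N" for u
  proof -
    have "(\<lambda>x. \<Sum>g\<in>carrier P. u g * restrict (delta g) (carrier P) x) \<in> poly_below ?N"
    proof (rule poly_below_sum[OF finP])
      fix g assume "g \<in> carrier P"
      then have "m g \<le> ?N" using finP by (intro member_le_sum) auto
      from poly_below_mono[OF this m] show "restrict (delta g) (carrier P) \<in> poly_below ?N" .
    qed
    then show ?thesis
    proof (rule poly_below_cong)
      fix x assume x: "x \<in> carrier P"
      then have "(\<Sum>g\<in>carrier P. u g * restrict (delta g) (carrier P) x) =
          (\<Sum>g\<in>carrier P. if x = g then u g else 0)"
        by (intro sum.cong) (auto simp: delta_def)
      also have "\<dots> = u x" using x finP by simp
      finally show "(\<Sum>g\<in>carrier P. u g * restrict (delta g) (carrier P) x) = u x" .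
    qed
  qed
  then show ?thesis by blast
qed

lemma zero_in_InnDer: "\<zero>\<^bsub>L\<^esub> \<in> InnDer A"
proof -
  interpret lie_ideal "InnDer A" L by (rule lie_ideal_InnDer)
  show ?thesis by (rule additive_subgroup.zero_closed[OF is_additive_subgroup])
qed

text \<open>
  Once the symbols have disappeared, every further step of the derived series raises the degree by one,
  until it exceeds the nilpotency degree of the augmentation ideal.
\<close>

lemma symbol_free_imp_solvable:
  assumes triv: "\<forall>D\<in>(lie_derived L ^^ i) (Der A). \<forall>c\<in>carrier P. \<forall>g\<in>carrier P. symbol D c g = 0"
  shows "lie_solvable (HH1 A)"
proof -
  obtain N where N: "\<And>u. u \<in> poly_below N" using all_functions_poly_below by blast
  have low: "(lie_derived L ^^ (j + i)) (Der A) \<subseteq> degree_lowering (Suc j)" for j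
  proof (induction j)
    case 0
    show ?case
    proof
      fix D assume D: "D \<in> (lie_derived L ^^ (0 + i)) (Der A)"
      then have "D \<in> Der A" using derived_series_subset_Der by blast
      then have "D \<in> degree_lowering 1" by (rule degree_lowering_one) (use triv D in simp)
      then show "D \<in> degree_lowering (Suc 0)" by simp
    qed
  next
    case (Suc j)
    then show ?case using lie_derived_degree_lowering[OF Suc] by simp
  qed
  have "(lie_derived L ^^ (N + i)) (Der A) \<subseteq> InnDer A"
  proof
    fix D assume "D \<in> (lie_derived L ^^ (N + i)) (Der A)"
    then have D: "D \<in> degree_lowering (Suc N)" using low by blast
    then have DD: "D \<in> Der A" by (simp add: degree_lowering_def)
    have "dual D u \<in> poly_below 0" for u
    proof -
      have "u \<in> poly_below (0 + Suc N)" by (rule poly_below_mono[OF _ N]) simp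
      with D show ?thesis unfolding degree_lowering_def by blast
    qed
    then have "D = \<zero>\<^bsub>L\<^esub>"
      by (intro Der_eqI[OF DD zero_in_Der]) (simp add: dual_zero_L)
    then show "D \<in> InnDer A" using zero_in_InnDer by simp
  qed
  then show ?thesis using lie_solvable_HH1_iff by blast
qed

section \<open>The transfer relation and cycles\<close>

text \<open>
  The edges of the graph before passing to classes modulo the Frattini subgroup.
\<close>

definition transfer_rel :: "'g rel" where
  "transfer_rel = {(x, y). x \<in> carrier P \<and> y \<in> carrier P \<and>
    group_transfer P (centralizer P x) y \<notin> frattini (abelianization P (centralizer P x))}"

lemma transfer_rel_iff:
  "(x, y) \<in> transfer_rel \<longleftrightarrow>
    x \<in> carrier P \<and> y \<in> carrier P \<and> (\<exists>F. realizable x F \<and> F y \<noteq> 0)"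
proof (cases "x \<in> carrier P \<and> y \<in> carrier P")
  case True
  then interpret H: finite_subgroup P "centralizer P x" by (intro finite_subgroup_centralizer) simp
  show ?thesis
    using H.transfer_notin_frattini_iff[OF p ord, of y] True
    by (auto simp: transfer_rel_def realizable_def)
qed (auto simp: transfer_rel_def)

lemma realizable_character:
  assumes "x \<in> carrier P" "realizable x F"
  shows "additive_character P (carrier P) F"
  using realizable_acts[OF assms] acts_character assms(1) by blast

lemma transfer_rel_cong:
  assumes xy: "(x, y) \<in> transfer_rel" and z: "z \<in> carrier P" "eqv z y"
  shows "(x, z) \<in> transfer_rel"
proof -
  obtain F where x: "x \<in> carrier P" and F: "realizable x F" "F y \<noteq> 0"
    using xy transfer_rel_iff by blast
  have "F z = F y" using realizable_character[OF x F(1)] z(2) unfolding eqv_def by blast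
  then show ?thesis using x z F transfer_rel_iff by auto
qed

lemma acyclic_symbol_rel:
  assumes "acyclic transfer_rel"
  shows "acyclic symbol_rel"
proof (rule acyclic_lift[where E = "\<lambda>x a. x \<in> carrier P \<and> eqv x a", OF _ assms])
  fix a b assume "(a, b) \<in> symbol_rel"
  then obtain D where a: "a \<in> carrier P" and b: "b \<in> carrier P" and D: "D \<in> Der A" "symbol D a b \<noteq> 0"
    unfolding symbol_rel_def by blast
  then obtain x F where x: "x \<in> carrier P" "eqv x a" "realizable x F" "F b \<noteq> 0"
    using symbol_nonzero_realizable[OF D(1) a b D(2)] by blast
  then have "(x, b) \<in> transfer_rel" using b transfer_rel_iff by blast
  then show "\<exists>x. (x \<in> carrier P \<and> eqv x a) \<and> (\<forall>y. y \<in> carrier P \<and> eqv y b \<longrightarrow> (x, y) \<in> transfer_rel)"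
    using x(1,2) transfer_rel_cong by blast
qed

text \<open>
  The homogeneous symbol \<open>a \<cdot> \<partial>\<^sub>f\<close> occurs in the \<open>i\<close>-th term of the derived series.
\<close>

definition attained :: "nat \<Rightarrow> 'g \<Rightarrow> ('g \<Rightarrow> 'k) \<Rightarrow> bool" where
  "attained i a f \<longleftrightarrow> (\<exists>D\<in>(lie_derived L ^^ i) (Der A). acts D a f)"

lemma attained_0: "x \<in> carrier P \<Longrightarrow> realizable x F \<Longrightarrow> attained 0 x F"
  using realizable_acts by (simp add: attained_def)

lemma attained_character:
  "attained i a f \<Longrightarrow> a \<in> carrier P \<Longrightarrow> additive_character P (carrier P) f"
  using acts_character derived_series_subset_Der unfolding attained_def by blast

lemma attained_bracket:
  assumes a: "a \<in> carrier P" "attained i a f" and b: "b \<in> carrier P" "attained i b e"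
  shows "attained (Suc i) (a \<otimes> b) (\<lambda>g. f b * e g - e a * f g)"
proof -
  obtain D E where D: "D \<in> (lie_derived L ^^ i) (Der A)" "acts D a f"
    and E: "E \<in> (lie_derived L ^^ i) (Der A)" "acts E b e"
    using a b unfolding attained_def by blast
  have "bracket L D E \<in> (lie_derived L ^^ Suc i) (Der A)"
    using bracket_in_lie_derived[OF D(1) E(1)] by simp
  moreover have "acts (bracket L D E) (a \<otimes> b) (\<lambda>g. f b * e g - e a * f g)"
    using D E a b derived_series_subset_Der by (intro acts_bracket) auto
  ultimately show ?thesis unfolding attained_def by blast
qed

lemma attained_scale:
  assumes "attained (Suc i) a f" "a = b" "\<And>g. g \<in> carrier P \<Longrightarrow> c * f g = e g"
  shows "attained (Suc i) b e"
proof -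
  obtain D where D: "D \<in> (lie_derived L ^^ Suc i) (Der A)" "acts D a f"
    using assms(1) unfolding attained_def by blast
  have "c \<odot>\<^bsub>L\<^esub> D \<in> (lie_derived L ^^ Suc i) (Der A)"
    using D(1) smult_in_lie_derived[of D L "(lie_derived L ^^ i) (Der A)" c] by simp
  moreover have "acts (c \<odot>\<^bsub>L\<^esub> D) b e"
    by (rule acts_cong[OF acts_smult[OF D(2)] assms(2,3)])
  ultimately show ?thesis unfolding attained_def by blast
qed

lemma attained_antimono: "attained (Suc i) a f \<Longrightarrow> attained i a f"
  using lie_ideal.derived_series_antimono[OF lie_ideal_InnDer] unfolding attained_def carrier_L
  by blast

text \<open>
  The symbols \<open>x \<cdot> \<partial>\<^sub>F\<close>, \<open>\<partial>\<^sub>F\<close> and \<open>x\<^sup>-\<^sup>1 \<cdot> \<partial>\<^sub>F\<close> span a copy of \<open>sl\<^sub>2\<close> if \<open>F x \<noteq> 0\<close>, and it is perfect in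
  characteristic other than 2. That \<open>x\<^sup>-\<^sup>1 \<cdot> \<partial>\<^sub>F\<close> is available is due to \<open>x\<close> and its inverse having the same
  centralizer.
\<close>

lemma loop_attained:
  assumes odd: "CHAR('k) \<noteq> 2" and x: "x \<in> carrier P" and F: "realizable x F" "F x \<noteq> 0"
  shows "attained i x F \<and> attained i (inv x) F"
proof (induction i)
  case 0
  show ?case using x F realizable_inv by (simp add: attained_0)
next
  case (Suc i)
  have ch: "additive_character P (carrier P) F" by (rule realizable_character[OF x F(1)])
  have F1: "F \<one> = 0" using additive_character_one[OF ch subgroup_self] .
  have Fi: "F (inv x) = - F x" by (rule character_inv[OF ch x])
  have "(2 :: 'k) \<noteq> 0"
  proof
    assume "(2 :: 'k) = 0"
    then have "of_nat 2 = (0 :: 'k)" by simp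
    then have "CHAR('k) dvd 2" by (simp only: of_nat_eq_0_iff_char_dvd)
    then show False using odd p primes_dvd_imp_eq two_is_prime_nat by blast
  qed
  then have nz: "- (2 * F x) \<noteq> 0" using F(2) by simp
  \<comment> \<open>The bracket of \<open>x \<cdot> \<partial>\<^sub>F\<close> and \<open>x\<^sup>-\<^sup>1 \<cdot> \<partial>\<^sub>F\<close> is \<open>- 2 F(x) \<partial>\<^sub>F\<close>, which is not zero in odd
    characteristic.\<close>
  have "attained (Suc i) \<one> F"
  proof (rule attained_scale[where c = "inverse (- (2 * F x))"])
    show "attained (Suc i) (x \<otimes> inv x) (\<lambda>g. F (inv x) * F g - F x * F g)"
      using Suc x by (intro attained_bracket) auto
    show "x \<otimes> inv x = \<one>" using x by simp
    show "inverse (- (2 * F x)) * (F (inv x) * F g - F x * F g) = F g" for g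
    proof -
      have "F (inv x) * F g - F x * F g = - (2 * F x) * F g" by (simp add: Fi algebra_simps)
      then show ?thesis using nz by (simp only: mult.assoc[symmetric] left_inverse) simp
    qed
  qed
  then have one: "attained i \<one> F" by (rule attained_antimono)
  have "attained (Suc i) y F" if y: "y \<in> carrier P" "attained i y F" "F y \<noteq> 0" for y
  proof (rule attained_scale[where c = "inverse (F y)"])
    show "attained (Suc i) (\<one> \<otimes> y) (\<lambda>g. F y * F g - F \<one> * F g)"
      using one y by (intro attained_bracket) auto
    show "\<one> \<otimes> y = y" using y by simp
    show "inverse (F y) * (F y * F g - F \<one> * F g) = F g" for g
      using y(3) by (simp add: F1)
  qed
  then show ?case using Suc x F(2) Fi by simp
qed

text \<open>
  The identity behind this is \<open>[x\<^sup>-\<^sup>1 \<partial>\<^sub>f, [x \<partial>\<^sub>f, y \<partial>\<^sub>e]] = f(y)\<^sup>2 \<cdot> y \<partial>\<^sub>e\<close> for \<open>f x = 0\<close>: an edge from \<open>x\<close> to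
  \<open>y\<close> lets a symbol at \<open>y\<close> survive one more step if the symbols at \<open>x\<close> and its inverse do.
\<close>

lemma predecessor_attained:
  assumes x: "x \<in> carrier P" "attained i x f" "attained i (inv x) f"
    and fx: "f x = 0" and fy: "f y \<noteq> 0" and y: "y \<in> carrier P" "attained i y e"
  shows "attained (Suc i) y e"
proof (rule attained_scale[where c = "inverse (f y * f y)"])
  define h where "h = (\<lambda>g. f y * e g - e x * f g)"
  have f: "additive_character P (carrier P) f" and e: "additive_character P (carrier P) e"
    using attained_character x y by blast+
  have "attained i (x \<otimes> y) h"
    unfolding h_def using x y by (intro attained_antimono[OF attained_bracket])
  then show "attained (Suc i) (inv x \<otimes> (x \<otimes> y)) (\<lambda>g. f (x \<otimes> y) * h g - h (inv x) * f g)"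
    using x y by (intro attained_bracket) auto
  show "inv x \<otimes> (x \<otimes> y) = y" using x y by (simp add: inv_cancel)
  fix g assume "g \<in> carrier P"
  have cancel: "inverse c * (c * z) = z" if "c \<noteq> 0" for c z :: 'k
    using that by (simp flip: mult.assoc)
  have eq: "f (x \<otimes> y) * h g - h (inv x) * f g = (f y * f y) * e g"
    using x(1) y(1) fx by (simp add: h_def character_mult[OF f] character_inv[OF f]
        character_inv[OF e] algebra_simps)
  show "inverse (f y * f y) * (f (x \<otimes> y) * h g - h (inv x) * f g) = e g"
    unfolding eq by (rule cancel) (use fy in simp)
qed

text \<open>
  On a cycle every vertex has a predecessor on the cycle, so no symbol there ever dies out.
\<close>

lemma cycle_attained:
  assumes no_loop: "\<And>x. (x, x) \<notin> transfer_rel"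
  shows "(y, y) \<in> transfer_rel\<^sup>+ \<Longrightarrow> realizable y G \<Longrightarrow> attained i y G \<and> attained i (inv y) G"
proof (induction i arbitrary: y G)
  case 0
  then have "y \<in> carrier P" by (metis tranclD transfer_rel_iff)
  then show ?case using 0 realizable_inv by (simp add: attained_0)
next
  case (Suc i)
  obtain x where xy: "(x, y) \<in> transfer_rel" and yx: "(y, x) \<in> transfer_rel\<^sup>*"
    using tranclD2[OF Suc.prems(1)] by blast
  have xx: "(x, x) \<in> transfer_rel\<^sup>+" by (rule rtrancl_into_trancl2[OF xy yx])
  obtain f where x: "x \<in> carrier P" and y: "y \<in> carrier P" and f: "realizable x f" "f y \<noteq> 0"
    using xy transfer_rel_iff by blast
  have fx: "f x = 0" using no_loop[of x] x f(1) transfer_rel_iff by blast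
  have ax: "attained i x f" "attained i (inv x) f" using Suc.IH[OF xx f(1)] by blast+
  have ay: "attained i y G" "attained i (inv y) G" using Suc.IH[OF Suc.prems] by blast+
  have "f (inv y) \<noteq> 0" using f(2) character_inv[OF realizable_character[OF x f(1)] y] by simp
  then show ?case
    using predecessor_attained[OF x ax fx f(2) y ay(1)]
      predecessor_attained[OF x ax fx _ inv_closed[OF y] ay(2)] by blast
qed

text \<open>
  Inner derivations have no symbol, so symbols that persist in the derived series of all derivations
  prevent it from entering the inner ones.
\<close>

theorem lie_solvable_HH1_iff_acyclic:
  assumes odd: "CHAR('k) \<noteq> 2"
  shows "lie_solvable (HH1 A) \<longleftrightarrow> acyclic transfer_rel"
proof
  assume "acyclic transfer_rel"
  then show "lie_solvable (HH1 A)"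
    using acyclic_symbol_rel_imp[OF acyclic_symbol_rel] symbol_free_imp_solvable by blast
next
  assume "lie_solvable (HH1 A)"
  then obtain i where i: "(lie_derived L ^^ i) (Der A) \<subseteq> InnDer A"
    using lie_solvable_HH1_iff by blast
  have vanish: "f g = 0" if att: "attained i a f" and a: "a \<in> carrier P" and g: "g \<in> carrier P" for a f g
  proof -
    obtain D where "D \<in> (lie_derived L ^^ i) (Der A)" and D: "acts D a f"
      using att unfolding attained_def by blast
    then have "D \<in> InnDer A" using i by blast
    then obtain u where "u \<in> carrier A" "D = inner_derivation u" by (auto simp: InnDer_inn)
    then have "symbol D a g = 0" using inn_acts_zero a g by blast
    then show ?thesis using acts_symb[OF D g] by simp
  qed
  have no_loop: "(x, x) \<notin> transfer_rel" for x
  proof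
    assume "(x, x) \<in> transfer_rel"
    then obtain F where F: "x \<in> carrier P" "realizable x F" "F x \<noteq> 0" using transfer_rel_iff by blast
    then show False using loop_attained[OF odd F, of i] vanish[of x F x] by blast
  qed
  show "acyclic transfer_rel"
    unfolding acyclic_def
  proof (intro allI notI)
    fix x assume xx: "(x, x) \<in> transfer_rel\<^sup>+"
    then obtain y where "(x, y) \<in> transfer_rel" using tranclD by metis
    then obtain F where F: "x \<in> carrier P" "y \<in> carrier P" "realizable x F" "F y \<noteq> 0"
      using transfer_rel_iff by blast
    then show False using cycle_attained[OF no_loop xx F(3), of i] vanish[of x F y] by blast
  qed
qed

lemma subgroup_frattini: "subgroup (frattini P) P"
proof (rule subgroupI)
  note ms = maximal_subgroup_def
  show "frattini P \<subseteq> carrier P" by (auto simp: frattini_def)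
  have "\<one> \<in> frattini P" by (auto simp: frattini_def ms subgroup.one_closed)
  then show "frattini P \<noteq> {}" by auto
  show "inv a \<in> frattini P" if "a \<in> frattini P" for a
    using that by (auto simp: frattini_def ms subgroup.m_inv_closed)
  show "a \<otimes> b \<in> frattini P" if "a \<in> frattini P" "b \<in> frattini P" for a b
    using that by (auto simp: frattini_def ms subgroup.m_closed)
qed

text \<open>
  Characters vanish on the Frattini subgroup, so its cosets are finer than equivalence. This one
  inclusion is enough to compare cycles in the graph with cycles in \<open>transfer_rel\<close>.
\<close>

lemma frattini_coset_eqv:
  assumes x: "x \<in> carrier P" and y: "y \<in> carrier P" and eq: "frattini P #> x = frattini P #> y"
  shows "eqv x y"
proof -
  have "x \<in> frattini P #> y" using rcos_self[OF x subgroup_frattini] eq by simp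
  then obtain z where z: "z \<in> frattini P" "x = z \<otimes> y" by (auto simp: r_coset_def)
  have zP: "z \<in> carrier P" using z(1) by (simp add: frattini_def)
  have "f z = 0" if "additive_character P (carrier P) f" for f :: "'g \<Rightarrow> 'k"
    using character_separated_by_maximal_subgroup[OF finP p that zP] z(1)
    by (auto simp: frattini_def)
  then show ?thesis using z(2) zP y by (simp add: eqv_simps)
qed

lemma parcs_Gamma: "parcs (Gamma P) = (\<lambda>(x, y). (frattini P #> x, frattini P #> y)) ` transfer_rel"
  by (fastforce simp: Gamma_def transfer_rel_def)

lemma acyclic_parcs_Gamma_iff: "acyclic (parcs (Gamma P)) \<longleftrightarrow> acyclic transfer_rel"
proof
  assume ac: "acyclic (parcs (Gamma P))"
  have "(frattini P #> x, frattini P #> y) \<in> (parcs (Gamma P))\<^sup>+" if "(x, y) \<in> transfer_rel\<^sup>+" for x y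
    using that
  proof (induction rule: trancl_induct)
    case (base y)
    then show ?case by (intro r_into_trancl) (auto simp: parcs_Gamma)
  next
    case (step y z)
    have "(frattini P #> y, frattini P #> z) \<in> parcs (Gamma P)" using step(2) by (auto simp: parcs_Gamma)
    with step.IH show ?case by (rule trancl_into_trancl)
  qed
  then show "acyclic transfer_rel" using ac unfolding acyclic_def by blast
next
  assume ac: "acyclic transfer_rel"
  show "acyclic (parcs (Gamma P))"
  proof (rule acyclic_lift[where E = "\<lambda>x C. x \<in> carrier P \<and> C = frattini P #> x", OF _ ac])
    fix C D assume "(C, D) \<in> parcs (Gamma P)"
    then obtain x y where xy: "(x, y) \<in> transfer_rel" "C = frattini P #> x" "D = frattini P #> y"
      by (auto simp: parcs_Gamma)
    have c: "x \<in> carrier P" "y \<in> carrier P" using xy(1) by (auto simp: transfer_rel_def)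
    have "(x, z) \<in> transfer_rel" if "z \<in> carrier P" "D = frattini P #> z" for z
      using transfer_rel_cong[OF xy(1) that(1)] frattini_coset_eqv[OF that(1) c(2)] that(2) xy(3) by simp
    then show "\<exists>x. (x \<in> carrier P \<and> C = frattini P #> x) \<and>
        (\<forall>y. y \<in> carrier P \<and> D = frattini P #> y \<longrightarrow> (x, y) \<in> transfer_rel)"
      using c xy(2) by blast
  qed
qed

text \<open>
  A cycle in the sense of \<open>cycle\<close> has distinct vertices, but every closed walk contains one.
\<close>

lemma acyclic_digraph_Gamma_iff: "acyclic_digraph (Gamma P) \<longleftrightarrow> acyclic (parcs (Gamma P))"
proof -
  let ?G = "with_proj (Gamma P)"
  have car: "frattini P #> x \<in> pverts (Gamma P)" if "x \<in> carrier P" for x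
    using that by (auto simp: Gamma_def carrier_FactGroup)
  interpret G: wf_digraph ?G
    by (unfold_locales) (auto simp: parcs_Gamma transfer_rel_def intro: car)
  have ends: "arcs_ends ?G = parcs (Gamma P)"
    by (auto simp: arcs_ends_def arc_to_ends_def)
  have "(\<exists>c. G.cycle c) \<longleftrightarrow> (\<exists>u. (u, u) \<in> (parcs (Gamma P))\<^sup>+)"
  proof
    assume "\<exists>c. G.cycle c"
    then obtain c u where "G.awalk u c u" "c \<noteq> []" by (auto simp: G.cycle_def)
    then show "\<exists>u. (u, u) \<in> (parcs (Gamma P))\<^sup>+" using G.reachable1_awalk[of u u] ends by auto
  next
    assume "\<exists>u. (u, u) \<in> (parcs (Gamma P))\<^sup>+"
    then obtain u c where "G.awalk u c u" "c \<noteq> []" using G.reachable1_awalk ends by auto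
    then have "G.closed_w c" by (auto simp: G.closed_w_def)
    then show "\<exists>c. G.cycle c" by (rule G.closed_w_imp_cycle)
  qed
  then show ?thesis by (simp add: acyclic_digraph_def acyclic_def)
qed

end

theorem theorem1p2:
  fixes p :: nat and P :: "('g, 'm) monoid_scheme"
  assumes "prime p" and "p \<noteq> 2"
    and "CHAR('k::field) = p"
    and "group P" and "finite (carrier P)" and "\<exists>n. order P = p ^ n"
  shows "lie_solvable (HH1 (group_algebra P :: ('k, 'g \<Rightarrow> 'k) module)) \<longleftrightarrow>
    acyclic_digraph (Gamma P)"
proof -
  obtain n where n: "order P = CHAR('k) ^ n" using assms(3,6) by blast
  interpret group P by fact
  interpret p_group_algebra P "group_algebra P :: ('k, 'g \<Rightarrow> 'k) module" n
    by (unfold_locales) (use assms n in auto)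
  show ?thesis
    using lie_solvable_HH1_iff_acyclic assms(2,3)
    by (simp add: acyclic_digraph_Gamma_iff acyclic_parcs_Gamma_iff)
qed

end
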